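(* Let $T\subset\mathbb{R}^3$ be a nondegenerate tetrahedron with Alfeld split $T^z$ and let $r\ge5$. A function $\omega\in M_{d,r-2}^2(T^z)$ is uniquely determined by the values (a) $\omega(a)$, $\operatorname{div}\omega(a)$ for all $a\in\Delta_0(T)$ ($16$ DOFs); (b) $\int_e\omega\cdot\kappa\,ds$ for all $\kappa\in[\mathcal{P}_{r-4}(e)]^3$, $e\in\Delta_1(T)$ ($18(r-3)$ DOFs); (c) $\int_e(\operatorname{div}\omega)\kappa\,ds$ for all $\kappa\in\mathcal{P}_{r-5}(e)$, $e\in\Delta_1(T)$ ($6(r-4)$ DOFs); (d) $\int_F\omega\cdot\kappa\,dA$ for all $\kappa\in[\mathcal{P}_{r-5}(F)]^3$, $F\in\Delta_2(T)$ ($6(r-3)(r-4)$ DOFs); (e) $\int_F(\operatorname{div}\omega)\kappa\,dA$ for all $\kappa\in\mathcal{P}_{r-6}(F)$, $F\in\Delta_2(T)$ ($2(r-4)(r-5)$ DOFs); (f) $\int_T\omega\cdot\kappa\,dx$ for all $\kappa\in\operatorname{curl}\mathring{M}_{d,r-1}^1(T^z)$ ($\frac{(r-4)(r-3)(4r-11)}3$ DOFs); (g) $\int_T(\operatorname{div}\omega)\kappa\,dx$ for all $\kappa\in\mathring{M}_{d,r-3}^3(T^z)$ ($\frac13(2r-7)(r^2-7r+15)-1$ DOFs).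
   Context: Let $T=[x_0,x_1,x_2,x_3]\subset\mathbb{R}^3$ be a nondegenerate tetrahedron with barycenter $z$. The Alfeld split is $T^z=\{T_0,\dots,T_3\}$, where $T_i$ is obtained from $T$ by replacing the vertex $x_i$ by $z$. $\Delta_s(T)$ is the set of $s$-dimensional subsimplices of $T$ (vertices, edges, faces for $s=0,1,2$). $\mathcal{P}_r(S)$ denotes polynomials of total degree at most $r$ on a simplex $S$, $\{0\}$ if $r<0$. $C^0(T)$ means continuous on the closed tetrahedron. $M_r^0(T^z)=\{\omega\in C^0(T):\omega|_{T_i}\in\mathcal{P}_r(T_i),\ 0\le i\le3\}$; $M_{d,r}^1(T^z)=\{\omega\in[M_r^0(T^z)]^3:\operatorname{curl}\omega\in[C^0(T)]^3\}$; $M_{d,r}^2(T^z)=\{\omega\in[M_r^0(T^z)]^3:\operatorname{div}\omega\in C^0(T)\}$; $\mathring{M}_{d,r}^1(T^z)=\{\omega\in M_{d,r}^1(T^z):\omega=0,\ \operatorname{curl}\omega=0\text{ on }\partial T\}$; $\mathring{M}_{d,r}^3(T^z)=\{\omega\in M_r^0(T^z):\omega=0\text{ on }\partial T,\ \int_T\omega\,dx=0\}$. "($N$ DOFs)" is the number of scalar conditions when test functions run through a basis. "Uniquely determined" means that two elements of the space with the same values of all the DOFs coincide. *)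

theory Defs
  imports "HOL-Analysis.Analysis" "HOL-Library.Function_Algebras"
begin

text \<open>
  Convention: a function on a set \<open>S \<subseteq> \<real>\<^sup>3\<close> is represented by the total function that
  agrees with it on \<open>S\<close> and is 0 outside \<open>S\<close>. Hence equality of representatives is equality
  on \<open>S\<close>, and the function spaces below are subspaces of \<open>real ^ 3 \<Rightarrow> 'b\<close> of the right
  dimension. Polynomial degrees are integers, because negative degrees occur.
\<close>

definition C0 :: "(real ^ 3) set \<Rightarrow> (real ^ 3 \<Rightarrow> 'b::real_normed_vector) set" where
  "C0 S = {f. continuous_on S f \<and> (\<forall>y. y \<notin> S \<longrightarrow> f y = 0)}"

text \<open>
  Every polynomial on a simplex \<open>S\<close>, also on one of dimension less than 3, is the restriction
  of a polynomial on \<open>\<real>\<^sup>3\<close> of the same total degree. For \<open>r < 0\<close> the sum is empty.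
\<close>

definition PolyOn :: "int \<Rightarrow> (real ^ 3) set \<Rightarrow> (real ^ 3 \<Rightarrow> real) set" where
  "PolyOn r S = {f. (\<forall>y. y \<notin> S \<longrightarrow> f y = 0) \<and>
     (\<exists>c :: nat ^ 3 \<Rightarrow> real. \<forall>y\<in>S.
        f y = (\<Sum>\<alpha> | int (\<Sum>i\<in>UNIV. \<alpha> $ i) \<le> r. c \<alpha> * (\<Prod>i\<in>UNIV. (y $ i) ^ (\<alpha> $ i))))}"

definition vec3 :: "(real ^ 3 \<Rightarrow> real) set \<Rightarrow> (real ^ 3 \<Rightarrow> real ^ 3) set" where
  "vec3 V = {\<omega>. \<forall>i. (\<lambda>y. \<omega> y $ i) \<in> V}"

text \<open>The four elements of the index type \<open>4\<close> are \<open>0, 1, 2, 3\<close>, in this order.\<close>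

definition nondegenerate :: "(4 \<Rightarrow> real ^ 3) \<Rightarrow> bool" where
  "nondegenerate x \<longleftrightarrow> inj x \<and> \<not> affine_dependent (range x)"

definition tetra :: "(4 \<Rightarrow> real ^ 3) \<Rightarrow> (real ^ 3) set" where
  "tetra x = convex hull (range x)"

definition barycenter :: "(4 \<Rightarrow> real ^ 3) \<Rightarrow> real ^ 3" where
  "barycenter x = (1 / 4) *\<^sub>R (\<Sum>i\<in>UNIV. x i)"

definition alfeld :: "(4 \<Rightarrow> real ^ 3) \<Rightarrow> 4 \<Rightarrow> (real ^ 3) set" where
  "alfeld x i = tetra (x(i := barycenter x))"

text \<open>
  Vertices, edges and faces are given by their vertices, listed in increasing order of the
  index, so that each edge and each face occurs exactly once.
\<close>

definition vertices :: "(4 \<Rightarrow> real ^ 3) \<Rightarrow> (real ^ 3) set" where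
  "vertices x = range x"

definition edges :: "(4 \<Rightarrow> real ^ 3) \<Rightarrow> ((real ^ 3) \<times> (real ^ 3)) set" where
  "edges x = {(x i, x j) | i j. i < j}"

definition faces :: "(4 \<Rightarrow> real ^ 3) \<Rightarrow> ((real ^ 3) \<times> (real ^ 3) \<times> (real ^ 3)) set" where
  "faces x = {(x i, x j, x k) | i j k. i < j \<and> j < k}"

text \<open>
  Arc length integral over the segment from \<open>a\<close> to \<open>b\<close>, and surface integral over the
  triangle with vertices \<open>a\<close>, \<open>b\<close>, \<open>c\<close>, by affine parametrization. The factors are the
  arc length and area elements; neither integral depends on the order of the vertices.
\<close>

definition edge_integral :: "real ^ 3 \<Rightarrow> real ^ 3 \<Rightarrow> (real ^ 3 \<Rightarrow> real) \<Rightarrow> real" where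
  "edge_integral a b f =
     norm (b - a) * (LINT s:{0..1}|lborel. f (a + s *\<^sub>R (b - a)))"

definition face_integral ::
  "real ^ 3 \<Rightarrow> real ^ 3 \<Rightarrow> real ^ 3 \<Rightarrow> (real ^ 3 \<Rightarrow> real) \<Rightarrow> real" where
  "face_integral a b c f =
     norm (cross3 (b - a) (c - a)) *
     (LINT s:{0..1}|lborel. LINT t:{0..1 - s}|lborel. f (a + s *\<^sub>R (b - a) + t *\<^sub>R (c - a)))"

text \<open>\<open>jacobian v (at y) $ i $ j\<close> is the partial derivative of \<open>v\<^sub>i\<close> in direction \<open>j\<close>.\<close>

definition pt_div :: "(real ^ 3 \<Rightarrow> real ^ 3) \<Rightarrow> real ^ 3 \<Rightarrow> real" where
  "pt_div v y = trace (jacobian v (at y))"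

definition pt_curl :: "(real ^ 3 \<Rightarrow> real ^ 3) \<Rightarrow> real ^ 3 \<Rightarrow> real ^ 3" where
  "pt_curl v y = (let J = jacobian v (at y) in
     vector [J $ 3 $ 2 - J $ 2 $ 3, J $ 1 $ 3 - J $ 3 $ 1, J $ 2 $ 1 - J $ 1 $ 2])"

text \<open>
  The divergence and the curl of a piecewise polynomial are defined only inside the
  subtetrahedra. That such a function \<open>f\<close> is in \<open>C0 (tetra x)\<close> means that some
  \<open>g \<in> C0 (tetra x)\<close> agrees with it there. For nondegenerate \<open>x\<close> the interiors of the
  subtetrahedra are dense in \<open>tetra x\<close>, so there is at most one such \<open>g\<close>, and its values
  are the values of \<open>f\<close> at vertices, on edges and on faces.
\<close>

definition C0_repr ::
  "(4 \<Rightarrow> real ^ 3) \<Rightarrow> (real ^ 3 \<Rightarrow> 'b::real_normed_vector) \<Rightarrow> (real ^ 3 \<Rightarrow> 'b) \<Rightarrow> bool" where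
  "C0_repr x f g \<longleftrightarrow>
     g \<in> C0 (tetra x) \<and> (\<forall>i. \<forall>y\<in>interior (alfeld x i). g y = f y)"

definition div_T :: "(4 \<Rightarrow> real ^ 3) \<Rightarrow> (real ^ 3 \<Rightarrow> real ^ 3) \<Rightarrow> real ^ 3 \<Rightarrow> real" where
  "div_T x \<omega> = (THE g. C0_repr x (pt_div \<omega>) g)"

definition curl_T :: "(4 \<Rightarrow> real ^ 3) \<Rightarrow> (real ^ 3 \<Rightarrow> real ^ 3) \<Rightarrow> real ^ 3 \<Rightarrow> real ^ 3" where
  "curl_T x \<omega> = (THE g. C0_repr x (pt_curl \<omega>) g)"

definition M0 :: "int \<Rightarrow> (4 \<Rightarrow> real ^ 3) \<Rightarrow> (real ^ 3 \<Rightarrow> real) set" where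
  "M0 r x = {\<omega> \<in> C0 (tetra x).
     \<forall>i. \<exists>p \<in> PolyOn r (alfeld x i). \<forall>y\<in>alfeld x i. \<omega> y = p y}"

definition M1 :: "int \<Rightarrow> (4 \<Rightarrow> real ^ 3) \<Rightarrow> (real ^ 3 \<Rightarrow> real ^ 3) set" where
  "M1 r x = {\<omega> \<in> vec3 (M0 r x). \<exists>g. C0_repr x (pt_curl \<omega>) g}"

definition M2 :: "int \<Rightarrow> (4 \<Rightarrow> real ^ 3) \<Rightarrow> (real ^ 3 \<Rightarrow> real ^ 3) set" where
  "M2 r x = {\<omega> \<in> vec3 (M0 r x). \<exists>g. C0_repr x (pt_div \<omega>) g}"

text \<open>The suffix \<open>zero\<close> stands for the ring accent: zero boundary values.\<close>

definition M1_zero :: "int \<Rightarrow> (4 \<Rightarrow> real ^ 3) \<Rightarrow> (real ^ 3 \<Rightarrow> real ^ 3) set" where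
  "M1_zero r x = {\<omega> \<in> M1 r x. \<forall>y\<in>frontier (tetra x). \<omega> y = 0 \<and> curl_T x \<omega> y = 0}"

definition M3_zero :: "int \<Rightarrow> (4 \<Rightarrow> real ^ 3) \<Rightarrow> (real ^ 3 \<Rightarrow> real) set" where
  "M3_zero r x = {\<omega> \<in> M0 r x.
     (\<forall>y\<in>frontier (tetra x). \<omega> y = 0) \<and> (LINT y:tetra x|lborel. \<omega> y) = 0}"

global_interpretation funs:
  vector_space "\<lambda>(c::real) (f :: 'a \<Rightarrow> 'b::real_vector) y. c *\<^sub>R f y"
  defines fun_dim = funs.dim
  by unfold_locales (auto simp: fun_eq_iff algebra_simps)

end

theory Submission
  imports Defs
begin

text \<open>
  Let \<open>\<lambda>\<^sub>0, \<dots>, \<lambda>\<^sub>3\<close> be the barycentric coordinates of the tetrahedron and \<open>g\<^sub>i\<close> their gradients. The cell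
  \<open>T\<^sub>i\<close> of the Alfeld split is the set where \<open>\<lambda>\<^sub>i\<close> is smallest, so \<open>m = min\<^sub>i \<lambda>\<^sub>i\<close> is continuous and
  piecewise linear, equals \<open>\<lambda>\<^sub>i\<close> on \<open>T\<^sub>i\<close>, and vanishes on the boundary. Polynomials are written as
  homogeneous polynomials in the \<open>\<lambda>\<^sub>i\<close> (Bernstein form), where the restriction to a face keeps the
  terms that do not contain one of the coordinates. A piecewise polynomial is a family of four
  polynomials on all of space (\<open>glue\<close>); continuity means that pieces \<open>i\<close> and \<open>j\<close> agree where
  \<open>\<lambda>\<^sub>i = \<lambda>\<^sub>j\<close> (\<open>compat\<close>).

  Unisolvence (\<open>unisolvence\<close>): let \<open>\<omega>\<close> be a field whose degrees of freedom vanish. A polynomial that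
  vanishes on the boundary of an edge or face is the product of the coordinates of that simplex and a
  polynomial of correspondingly lower degree, which is an admissible test function; its moment is the
  integral of a nonnegative function (\<open>moments_zero_imp_zero\<close>). So, from vertices to edges to faces,
  \<open>\<omega>\<close> and \<open>div \<omega>\<close> vanish on the boundary. By the divergence theorem \<open>div \<omega>\<close> has mean value zero, so
  (g) may be tested with \<open>div \<omega>\<close>, and \<open>div \<omega> = 0\<close>. Then \<open>\<omega>\<close> is the curl of a field admitted in (f)
  (\<open>curl_image\<close>), and testing with \<open>\<omega>\<close> gives \<open>\<omega> = 0\<close>.

  The potential of a divergence-free field (\<open>curl_potential_pieces\<close>) is found as a sum of terms
  \<open>m\<^sup>k\<^sup>+\<^sup>1 w\<^sub>k\<close> with polynomials \<open>w\<^sub>k\<close> on the whole tetrahedron. On \<open>T\<^sub>i\<close>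
  the curl of \<open>m\<^sup>k\<^sup>+\<^sup>1 w\<close> is \<open>\<lambda>\<^sub>i\<^sup>k ((k + 1) g\<^sub>i \<times> w + \<lambda>\<^sub>i curl w)\<close>. A field \<open>\<lambda>\<^sub>i\<^sup>k E\<^sub>i\<close> is matched to leading
  order if \<open>(k + 1) g\<^sub>i \<times> w = E\<^sub>i\<close> on the face \<open>\<lambda>\<^sub>i = 0\<close>, for all four \<open>i\<close> at once. For the Bernstein
  coefficient with exponent \<open>\<alpha>\<close> these are linear equations for the \<open>i\<close> with \<open>\<alpha>\<^sub>i = 0\<close>. They are solvable
  because the numbers \<open>g\<^sub>j \<bullet> E\<^sub>i\<close> are antisymmetric: on faces since the divergence is zero, and on
  interfaces, with normal \<open>g\<^sub>i - g\<^sub>j\<close>, since the normal component is continuous. The remainder has one more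
  factor \<open>\<lambda>\<^sub>i\<close> and lower degree. In the same way every piecewise polynomial with mean value zero is the
  divergence of a continuous one with zero boundary values (\<open>div_potential_pieces\<close>).

  Dimensions: the products \<open>m\<^sup>k \<lambda>\<^sup>\<alpha>\<close>, where \<open>\<alpha>\<close> has a zero entry, are a basis of the continuous piecewise
  polynomials of degree \<open>k + |\<alpha>|\<close>, those with \<open>k > 0\<close> of the ones with zero boundary values
  (\<open>is_basis_family_M0_zero\<close>). The space in (f) is the kernel of the divergence on fields with such
  components, whose image is known, so rank and nullity give its dimension (\<open>fun_dim_div_free\<close>).
\<close>

section \<open>Counting exponent vectors, edges and faces\<close>

lemma finite_exponents:
  assumes "finite J"
  shows "finite {\<alpha> :: 'a \<Rightarrow> nat. (\<forall>i. i \<notin> J \<longrightarrow> \<alpha> i = 0) \<and> sum \<alpha> J = d}"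
proof (rule finite_subset)
  show "{\<alpha>. (\<forall>i. i \<notin> J \<longrightarrow> \<alpha> i = 0) \<and> sum \<alpha> J = d} \<subseteq> (\<lambda>f i. if i \<in> J then f i else 0) ` (PiE J (\<lambda>_. {..d}))"
  proof clarify
    fix \<alpha> :: "'a \<Rightarrow> nat" assume *: "\<forall>i. i \<notin> J \<longrightarrow> \<alpha> i = 0" "d = sum \<alpha> J"
    then have "restrict \<alpha> J \<in> PiE J (\<lambda>_. {..sum \<alpha> J})" using assms by (auto simp: member_le_sum)
    moreover have "\<alpha> = (\<lambda>i. if i \<in> J then restrict \<alpha> J i else 0)" using * by auto
    ultimately show "\<alpha> \<in> (\<lambda>f i. if i \<in> J then f i else 0) ` (PiE J (\<lambda>_. {..sum \<alpha> J}))" by blast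
  qed
  show "finite ((\<lambda>f i. if i \<in> J then f i else 0 :: nat) ` (PiE J (\<lambda>_. {..d})))"
    using assms by (intro finite_imageI finite_PiE) auto
qed

text \<open>
  Recursion on \<open>J\<close>: the entry at a new index takes the part of the total
  \<open>d\<close> that the others leave, so the counts for totals up to \<open>d\<close> are
  summed, and binomial coefficients sum along a diagonal.
\<close>

lemma card_exponents:
  assumes "finite J" "J \<noteq> {}"
  shows "card {\<alpha> :: 'a \<Rightarrow> nat. (\<forall>i. i \<notin> J \<longrightarrow> \<alpha> i = 0) \<and> sum \<alpha> J = d} = (d + card J - 1) choose (card J - 1)"
  using assms
proof (induction J arbitrary: d rule: finite_ne_induct)
  case (singleton i)
  have "{\<alpha> :: 'a \<Rightarrow> nat. (\<forall>j. j \<notin> {i} \<longrightarrow> \<alpha> j = 0) \<and> sum \<alpha> {i} = d} = {(\<lambda>_. 0)(i := d)}" by auto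
  then show ?case by simp
next
  case (insert i J)
  define S where "S d = {\<alpha> :: 'a \<Rightarrow> nat. (\<forall>i. i \<notin> J \<longrightarrow> \<alpha> i = 0) \<and> sum \<alpha> J = d}" for d
  have i0: "\<alpha> i = 0" if "\<alpha> \<in> S k" for \<alpha> k using that insert.hyps by (auto simp: S_def)
  have split: "{\<alpha>. (\<forall>j. j \<notin> insert i J \<longrightarrow> \<alpha> j = 0) \<and> sum \<alpha> (insert i J) = d} = (\<Union>k\<le>d. (\<lambda>\<alpha>. \<alpha>(i := d - k)) ` S k)" (is "?L = ?R")
  proof
    show "?L \<subseteq> ?R"
    proof
      fix \<alpha> assume "\<alpha> \<in> ?L"
      then have a: "\<forall>j. j \<notin> insert i J \<longrightarrow> \<alpha> j = 0" "\<alpha> i + sum \<alpha> J = d" using insert.hyps by auto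
      have "sum (\<alpha>(i := 0)) J = sum \<alpha> J" using insert.hyps by (intro sum.cong) auto
      then have "\<alpha>(i := 0) \<in> S (sum \<alpha> J)" using a by (auto simp: S_def)
      moreover have "\<alpha> = (\<alpha>(i := 0))(i := d - sum \<alpha> J)" using a by auto
      ultimately show "\<alpha> \<in> ?R" using a(2) by (metis (no_types, lifting) UN_I atMost_iff imageI le_add2)
    qed
    show "?R \<subseteq> ?L"
    proof clarify
      fix k \<alpha> assume "k \<le> d" "\<alpha> \<in> S k"
      moreover have "sum (\<alpha>(i := d - k)) J = sum \<alpha> J" using insert.hyps by (intro sum.cong) auto
      ultimately show "(\<forall>j. j \<notin> insert i J \<longrightarrow> (\<alpha>(i := d - k)) j = 0) \<and> sum (\<alpha>(i := d - k)) (insert i J) = d"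
        using insert.hyps by (auto simp: S_def)
    qed
  qed
  have inj: "inj_on (\<lambda>\<alpha>. \<alpha>(i := d - k)) (S k)" for k
    by (rule inj_onI) (metis fun_upd_triv fun_upd_upd i0)
  have "card (\<Union>k\<le>d. (\<lambda>\<alpha>. \<alpha>(i := d - k)) ` S k) = (\<Sum>k\<le>d. card ((\<lambda>\<alpha>. \<alpha>(i := d - k)) ` S k))"
  proof (rule card_UN_disjoint)
    show "\<forall>k\<in>{..d}. \<forall>k'\<in>{..d}. k \<noteq> k' \<longrightarrow> (\<lambda>\<alpha>. \<alpha>(i := d - k)) ` S k \<inter> (\<lambda>\<alpha>. \<alpha>(i := d - k')) ` S k' = {}"
      by (auto simp: fun_eq_iff) (metis atMost_iff diff_diff_cancel)
  qed (use insert.hyps in \<open>auto simp: S_def finite_exponents\<close>)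
  also have "\<dots> = (\<Sum>k\<le>d. (k + card J - 1) choose (card J - 1))"
    by (simp add: card_image inj) (simp add: S_def insert.IH)
  also have "\<dots> = (d + card J) choose (card J)"
  proof -
    obtain m where "card J = Suc m"
      using insert.hyps by (metis card_0_eq not0_implies_Suc)
    then show ?thesis using choose_rising_sum(1)[of m d] by (simp add: add.commute)
  qed
  finally show ?case unfolding split using insert.hyps by simp
qed

text \<open>
  The exponents of the homogeneous monomials of degree \<open>d\<close> in four barycentric
  coordinates.
\<close>

definition expos :: "nat \<Rightarrow> (4 \<Rightarrow> nat) set" where
  "expos d = {\<alpha>. sum \<alpha> UNIV = d}"

lemma finite_expos [simp]: "finite (expos d)"
  using finite_exponents[of "UNIV :: 4 set" d] by (simp add: expos_def)

lemma expos_0: "expos 0 = {\<lambda>_. 0}"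
  by (auto simp: expos_def)

lemma card_expos_supported:
  assumes "J \<noteq> {}"
  shows "card {\<alpha> \<in> expos d. \<forall>i. i \<notin> J \<longrightarrow> \<alpha> i = 0} = (d + card J - 1) choose (card J - 1)"
proof -
  have "sum \<alpha> UNIV = sum \<alpha> J" if "\<forall>i. i \<notin> J \<longrightarrow> \<alpha> i = 0" for \<alpha> :: "4 \<Rightarrow> nat"
    using that by (intro sum.mono_neutral_right) auto
  then have "{\<alpha> \<in> expos d. \<forall>i. i \<notin> J \<longrightarrow> \<alpha> i = 0} = {\<alpha>. (\<forall>i. i \<notin> J \<longrightarrow> \<alpha> i = 0) \<and> sum \<alpha> J = d}"
    unfolding expos_def by (intro Collect_cong) auto
  then show ?thesis using card_exponents[OF _ assms, of d] by simp
qed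

lemma card_expos: "card (expos d) = (d + 3) choose 3"
proof -
  have "card {\<alpha> \<in> expos d. \<forall>i. i \<notin> UNIV \<longrightarrow> \<alpha> i = 0} = (d + CARD(4) - 1) choose (CARD(4) - 1)"
    by (rule card_expos_supported) simp
  moreover have "{\<alpha> \<in> expos d. \<forall>i. i \<notin> UNIV \<longrightarrow> \<alpha> i = 0} = expos d" "d + CARD(4) - 1 = d + 3" "CARD(4) - 1 = 3"
    by simp_all
  ultimately show ?thesis by (simp only:)
qed

text \<open>
  Subtracting 1 from every entry maps the exponents without zero entry onto all exponents of
  total \<open>s - 3\<close>, so the number is \<open>(s + 4 choose 3) - (s choose 3)\<close>.
\<close>

lemma card_expos_zero_entry: "card {\<alpha> \<in> expos (Suc s). \<exists>i. \<alpha> i = 0} = 2 * (s + 1)\<^sup>2 + 2"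
proof -
  let ?P = "{\<alpha> \<in> expos (Suc s). \<forall>i. 0 < \<alpha> i}"
  have card_P: "card ?P = s choose 3"
  proof (cases "3 \<le> s")
    case True
    have "bij_betw (\<lambda>\<alpha> i. \<alpha> i + 1) (expos (s - 3)) ?P"
      by (rule bij_betwI[where g = "\<lambda>\<alpha> i. \<alpha> i - 1"])
         (use True in \<open>auto simp: expos_def sum.distrib fun_eq_iff sum_subtractf_nat Suc_leI sum_Suc\<close>)
    then show ?thesis using True by (simp add: bij_betw_same_card[symmetric] card_expos)
  next
    case False
    have "?P = {}"
    proof (rule ccontr)
      assume "?P \<noteq> {}"
      then obtain \<alpha> where "\<alpha> \<in> expos (Suc s)" "\<forall>i. 0 < \<alpha> i" by auto
      moreover from this have "(\<Sum>i\<in>(UNIV::4 set). 1) \<le> sum \<alpha> UNIV" by (intro sum_mono) (auto simp: Suc_leI)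
      ultimately show False using False by (simp add: expos_def)
    qed
    then have "card ?P = 0" by (simp only: card.empty)
    moreover have "s choose 3 = 0" using False by (simp add: binomial_eq_0)
    ultimately show ?thesis by (simp only:)
  qed
  have "expos (Suc s) = {\<alpha> \<in> expos (Suc s). \<exists>i. \<alpha> i = 0} \<union> ?P"
    using gr0I by fastforce
  moreover have "card ({\<alpha> \<in> expos (Suc s). \<exists>i. \<alpha> i = 0} \<union> ?P) = card {\<alpha> \<in> expos (Suc s). \<exists>i. \<alpha> i = 0} + card ?P"
  proof (rule card_Un_disjoint)
    show "{\<alpha> \<in> expos (Suc s). \<exists>i. \<alpha> i = 0} \<inter> ?P = {}"
    proof (rule equals0I)
      fix \<alpha> assume "\<alpha> \<in> {\<alpha> \<in> expos (Suc s). \<exists>i. \<alpha> i = 0} \<inter> ?P"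
      then obtain i where "\<alpha> i = 0" "0 < \<alpha> i" by blast
      then show False by simp
    qed
  qed simp_all
  ultimately have "card (expos (Suc s)) = card {\<alpha> \<in> expos (Suc s). \<exists>i. \<alpha> i = 0} + card ?P"
    by (simp only:)
  moreover have "(Suc s + 3) choose 3 = (s choose 3) + 4 * (s choose 2) + 6 * s + 4"
    by (simp add: numeral_eq_Suc)
  moreover have "2 * (s choose 2) + s = s * s"
    by (induction s) (simp_all add: numeral_2_eq_2)
  ultimately show ?thesis by (simp add: card_expos card_P power2_eq_square)
qed

text \<open>
  This counts the basis of the continuous piecewise polynomials of degree \<open>s\<close> on
  the split.
\<close>

lemma card_expos_upto_zero_entry:
  "3 * card {\<alpha> :: 4 \<Rightarrow> nat. sum \<alpha> UNIV \<le> s \<and> (\<exists>i. \<alpha> i = 0)} = 3 + 6 * s + s * (s + 1) * (2 * s + 1)"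
proof (induction s)
  case 0
  have "{\<alpha> :: 4 \<Rightarrow> nat. sum \<alpha> UNIV \<le> 0 \<and> (\<exists>i. \<alpha> i = 0)} = {\<lambda>_. 0}" by auto
  then show ?case by simp
next
  case (Suc s)
  have fin: "finite {\<alpha> :: 4 \<Rightarrow> nat. sum \<alpha> UNIV \<le> s \<and> (\<exists>i. \<alpha> i = 0)}"
    by (rule finite_subset[of _ "\<Union>d\<le>s. expos d"])
       (auto simp: expos_def[symmetric], simp add: expos_def)
  have "{\<alpha> :: 4 \<Rightarrow> nat. sum \<alpha> UNIV \<le> Suc s \<and> (\<exists>i. \<alpha> i = 0)} =
     {\<alpha> :: 4 \<Rightarrow> nat. sum \<alpha> UNIV \<le> s \<and> (\<exists>i. \<alpha> i = 0)} \<union> {\<alpha> \<in> expos (Suc s). \<exists>i. \<alpha> i = 0}"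
    by (auto simp: expos_def)
  moreover have "card ({\<alpha> :: 4 \<Rightarrow> nat. sum \<alpha> UNIV \<le> s \<and> (\<exists>i. \<alpha> i = 0)} \<union> {\<alpha> \<in> expos (Suc s). \<exists>i. \<alpha> i = 0}) =
     card {\<alpha> :: 4 \<Rightarrow> nat. sum \<alpha> UNIV \<le> s \<and> (\<exists>i. \<alpha> i = 0)} + card {\<alpha> \<in> expos (Suc s). \<exists>i. \<alpha> i = 0}"
  proof (rule card_Un_disjoint[OF fin])
    show "{\<alpha> :: 4 \<Rightarrow> nat. sum \<alpha> UNIV \<le> s \<and> (\<exists>i. \<alpha> i = 0)} \<inter> {\<alpha> \<in> expos (Suc s). \<exists>i. \<alpha> i = 0} = {}"
      by (auto simp: expos_def)
  qed simp
  ultimately have "card {\<alpha> :: 4 \<Rightarrow> nat. sum \<alpha> UNIV \<le> Suc s \<and> (\<exists>i. \<alpha> i = 0)} =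
     card {\<alpha> :: 4 \<Rightarrow> nat. sum \<alpha> UNIV \<le> s \<and> (\<exists>i. \<alpha> i = 0)} + (2 * (s + 1)\<^sup>2 + 2)"
    by (simp only: card_expos_zero_entry)
  then show ?case using Suc.IH by (simp add: power2_eq_square algebra_simps)
qed

lemma two_times_choose_two: "2 * (Suc n choose 2) = (n + 1) * n"
  by (induction n) (simp_all add: numeral_2_eq_2)

lemma six_times_choose_three: "6 * ((n + 3) choose 3) = (n + 1) * (n + 2) * (n + 3)"
proof (induction n)
  case (Suc n)
  have "(Suc n + 3) choose 3 = ((n + 3) choose 2) + ((n + 3) choose 3)"
    by (simp add: numeral_3_eq_3 numeral_2_eq_2)
  moreover have "2 * ((n + 3) choose 2) = (n + 3) * (n + 2)"
    using two_times_choose_two[of "n + 2"] by (simp add: numeral_3_eq_3)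
  ultimately show ?case using Suc.IH by (simp add: algebra_simps)
qed simp

lemma card_increasing_pairs: "card {(i, j). i < (j :: 'a::{finite, linorder})} = CARD('a) choose 2"
proof -
  have "bij_betw (\<lambda>(i, j). {i, j}) {(i, j). i < (j :: 'a)} {B. B \<subseteq> UNIV \<and> card B = 2}"
    unfolding bij_betw_def
  proof
    show "inj_on (\<lambda>(i, j). {i, j}) {(i, j). i < (j :: 'a)}"
      by (auto simp: inj_on_def doubleton_eq_iff)
    show "(\<lambda>(i, j). {i, j}) ` {(i, j). i < (j :: 'a)} = {B. B \<subseteq> UNIV \<and> card B = 2}"
    proof (intro equalityI subsetI)
      fix B :: "'a set" assume "B \<in> {B. B \<subseteq> UNIV \<and> card B = 2}"
      then obtain i j where "B = {i, j}" "i \<noteq> j" by (auto simp: card_2_iff)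
      then show "B \<in> (\<lambda>(i, j). {i, j}) ` {(i, j). i < (j :: 'a)}"
        by (cases "i < j") (auto simp: image_iff insert_commute not_less_iff_gr_or_eq)
    qed auto
  qed
  from bij_betw_same_card[OF this] show ?thesis using n_subsets[of "UNIV :: 'a set" 2] by simp
qed

text \<open>
  The vertices of a face are listed in increasing order; every choice of three vertices has
  such a listing.
\<close>

lemma exists_sorted_triple:
  fixes B :: "'a::linorder set"
  assumes "card B = 3"
  shows "\<exists>i j k. i < j \<and> j < k \<and> B = {i, j, k}"
proof -
  define l where "l = sorted_list_of_set B"
  have "finite B" using assms by (metis card.infinite zero_neq_numeral)
  then have l: "length l = 3" "sorted l" "distinct l" "set l = B" using assms by (auto simp: l_def)
  then obtain i j k where "l = [i, j, k]" by (auto simp: numeral_3_eq_3 length_Suc_conv)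
  with l show ?thesis by (intro exI[of _ i] exI[of _ j] exI[of _ k]) auto
qed

lemma card_increasing_triples: "card {(i, j, k). i < j \<and> j < (k :: 'a::{finite, linorder})} = CARD('a) choose 3"
proof -
  let ?S = "{(i, j, k). i < j \<and> j < (k :: 'a)}"
  have "bij_betw (\<lambda>(i, j, k). {i, j, k}) ?S {B. B \<subseteq> UNIV \<and> card B = 3}"
    unfolding bij_betw_def
  proof
    have sorted: "sorted_list_of_set {i, j, k} = [i, j, k]" if "i < j" "j < k" for i j k :: 'a
    proof -
      have "sorted_list_of_set (set [i, j, k]) = [i, j, k]"
        by (rule sorted_list_of_set.idem_if_sorted_distinct) (use that in auto)
      then show ?thesis by (simp only: list.set)
    qed
    show "inj_on (\<lambda>(i, j, k). {i, j, k}) ?S"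
    proof (rule inj_onI, clarify)
      fix i j k i' j' k' :: 'a
      assume "i < j" "j < k" "i' < j'" "j' < k'" "{i, j, k} = {i', j', k'}"
      then have "[i, j, k] = [i', j', k']" using sorted by metis
      then show "i = i' \<and> (j, k) = (j', k')" by simp
    qed
    show "(\<lambda>(i, j, k). {i, j, k}) ` ?S = {B. B \<subseteq> UNIV \<and> card B = 3}"
    proof (intro equalityI subsetI)
      fix B :: "'a set" assume "B \<in> {B. B \<subseteq> UNIV \<and> card B = 3}"
      then obtain i j k where "(i, j, k) \<in> ?S" "B = {i, j, k}" using exists_sorted_triple[of B] by auto
      then show "B \<in> (\<lambda>(i, j, k). {i, j, k}) ` ?S" by force
    qed (auto simp: card_insert_if)
  qed
  from bij_betw_same_card[OF this] show ?thesis using n_subsets[of "UNIV :: 'a set" 3] by simp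
qed

section \<open>Dimensions of spaces of functions\<close>

lemma sum_fun_apply: "(\<Sum>j\<in>J. F j) y = (\<Sum>j\<in>J. F j y)" for F :: "'j \<Rightarrow> 'a \<Rightarrow> 'b::comm_monoid_add"
  by (induction J rule: infinite_finite_induct) auto

text \<open>
  A basis indexed by a finite set. Spanning and independence are stated with coefficient
  functions on the index set, which is the form in which the bases below are found;
  \<open>b\<close> is injective on \<open>J\<close> as a consequence.
\<close>

definition is_basis_family :: "'j set \<Rightarrow> ('j \<Rightarrow> 'a \<Rightarrow> 'b::real_vector) \<Rightarrow> ('a \<Rightarrow> 'b) set \<Rightarrow> bool" where
  "is_basis_family J b V \<longleftrightarrow> finite J \<and> V = {\<lambda>y. \<Sum>j\<in>J. c j *\<^sub>R b j y | c. True} \<and>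
     (\<forall>c. (\<lambda>y. \<Sum>j\<in>J. c j *\<^sub>R b j y) = (\<lambda>y. 0) \<longrightarrow> (\<forall>j\<in>J. c j = 0))"

lemma fun_dim_basis_family:
  fixes b :: "'j \<Rightarrow> 'a \<Rightarrow> 'b::real_vector"
  assumes "is_basis_family J b V"
  shows "fun_dim V = card J"
proof -
  have fin: "finite J" and V: "V = {\<lambda>y. \<Sum>j\<in>J. c j *\<^sub>R b j y | c. True}"
    and ind: "\<And>c. (\<lambda>y. \<Sum>j\<in>J. c j *\<^sub>R b j y) = (\<lambda>y. 0) \<Longrightarrow> \<forall>j\<in>J. c j = 0"
    using assms unfolding is_basis_family_def by blast+
  have inj: "inj_on b J"
  proof (rule inj_onI, rule ccontr)
    fix i j assume ij: "i \<in> J" "j \<in> J" "b i = b j" "i \<noteq> j"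
    let ?c = "\<lambda>k. (if k = i then 1 else 0) - (if k = j then 1 else 0) :: real"
    have "(\<lambda>y. \<Sum>k\<in>J. ?c k *\<^sub>R b k y) = (\<lambda>y. 0)"
      using fin ij by (simp add: scaleR_diff_left sum_subtractf if_distrib[of "\<lambda>a. a *\<^sub>R _"] cong: if_cong)
    from ind[OF this] ij show False by auto
  qed
  have comb: "(\<Sum>v\<in>b ` J. (\<lambda>y. u v *\<^sub>R v y)) = (\<lambda>y. \<Sum>j\<in>J. u (b j) *\<^sub>R b j y)" for u :: "('a \<Rightarrow> 'b) \<Rightarrow> real"
    by (rule ext) (simp add: sum_fun_apply sum.reindex[OF inj])
  have "funs.independent (b ` J)"
  proof (rule funs.independent_if_scalars_zero)
    fix u :: "('a \<Rightarrow> 'b) \<Rightarrow> real" and v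
    assume "(\<Sum>v\<in>b ` J. (\<lambda>y. u v *\<^sub>R v y)) = 0" "v \<in> b ` J"
    then have "(\<lambda>y. \<Sum>j\<in>J. u (b j) *\<^sub>R b j y) = (\<lambda>y. 0)" unfolding comb by (simp add: zero_fun_def)
    from ind[OF this] show "u v = 0" using \<open>v \<in> b ` J\<close> by auto
  qed (use fin in simp)
  moreover have "funs.span (b ` J) = V"
  proof -
    have "funs.span (b ` J) = range (\<lambda>u. \<Sum>v\<in>b ` J. (\<lambda>y. u v *\<^sub>R v y))"
      by (rule funs.span_finite) (use fin in simp)
    also have "\<dots> = V" unfolding comb V
    proof (intro equalityI subsetI)
      fix f assume "f \<in> {\<lambda>y. \<Sum>j\<in>J. c j *\<^sub>R b j y | c. True}"
      then obtain c where "f = (\<lambda>y. \<Sum>j\<in>J. c j *\<^sub>R b j y)" by blast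
      then have "f = (\<lambda>y. \<Sum>j\<in>J. (c \<circ> the_inv_into J b) (b j) *\<^sub>R b j y)"
        by (simp add: the_inv_into_f_f[OF inj])
      then show "f \<in> range (\<lambda>u y. \<Sum>j\<in>J. u (b j) *\<^sub>R b j y)" by blast
    next
      fix f assume "f \<in> range (\<lambda>u y. \<Sum>j\<in>J. u (b j) *\<^sub>R b j y)"
      then obtain u where "f = (\<lambda>y. \<Sum>j\<in>J. u (b j) *\<^sub>R b j y)" by blast
      then show "f \<in> {\<lambda>y. \<Sum>j\<in>J. c j *\<^sub>R b j y | c. True}"
        by (intro CollectI exI[of _ "\<lambda>j. u (b j)"]) simp
    qed
    finally show ?thesis .
  qed
  ultimately have "fun_dim V = card (b ` J)"
    by (metis funs.dim_eq_card_independent funs.dim_span)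
  then show ?thesis by (simp add: card_image inj)
qed

lemma is_basis_family_vec3:
  fixes b :: "'j \<Rightarrow> real ^ 3 \<Rightarrow> real"
  assumes "is_basis_family J b V"
  shows "is_basis_family (J \<times> UNIV) (\<lambda>(j, i) y. axis i (b j y)) (vec3 V)"
proof -
  have fin: "finite J" and V: "V = {\<lambda>y. \<Sum>j\<in>J. c j *\<^sub>R b j y | c. True}"
    and ind: "\<And>c. (\<lambda>y. \<Sum>j\<in>J. c j *\<^sub>R b j y) = (\<lambda>y. 0) \<Longrightarrow> \<forall>j\<in>J. c j = 0"
    using assms unfolding is_basis_family_def by blast+
  have comp: "(\<Sum>p\<in>J \<times> UNIV. c p *\<^sub>R (case p of (j, i) \<Rightarrow> \<lambda>y. axis i (b j y)) y) $ k = (\<Sum>j\<in>J. c (j, k) *\<^sub>R b j y)"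
    for c :: "'j \<times> 3 \<Rightarrow> real" and y :: "real ^ 3" and k :: 3
  proof -
    have "(\<Sum>p\<in>J \<times> UNIV. c p *\<^sub>R (case p of (j, i) \<Rightarrow> \<lambda>y. axis i (b j y)) y) =
      (\<Sum>j\<in>J. \<Sum>i\<in>UNIV. c (j, i) *\<^sub>R axis i (b j y))"
      by (simp add: sum.cartesian_product split_def)
    then show ?thesis by (simp add: axis_def if_distrib[of "\<lambda>a. _ * a"] cong: if_cong)
  qed
  show ?thesis unfolding is_basis_family_def
  proof (intro conjI allI impI)
    show "finite (J \<times> (UNIV :: 3 set))" using fin by simp
    show "vec3 V = {\<lambda>y. \<Sum>p\<in>J \<times> UNIV. c p *\<^sub>R (case p of (j, i) \<Rightarrow> \<lambda>y. axis i (b j y)) y | c. True}" (is "_ = ?R")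
    proof (intro equalityI subsetI)
      fix f assume "f \<in> vec3 V"
      then have "\<forall>k. \<exists>c. (\<lambda>y. f y $ k) = (\<lambda>y. \<Sum>j\<in>J. c j *\<^sub>R b j y)" by (auto simp: vec3_def V)
      from choice[OF this] obtain c where c: "\<forall>k. (\<lambda>y. f y $ k) = (\<lambda>y. \<Sum>j\<in>J. c k j *\<^sub>R b j y)" by blast
      have "f = (\<lambda>y. \<Sum>p\<in>J \<times> UNIV. (\<lambda>(j, k). c k j) p *\<^sub>R (case p of (j, i) \<Rightarrow> \<lambda>y. axis i (b j y)) y)"
      proof (rule ext, subst vec_eq_iff, rule allI)
        fix y k
        show "f y $ k = (\<Sum>p\<in>J \<times> UNIV. (\<lambda>(j, k). c k j) p *\<^sub>R (case p of (j, i) \<Rightarrow> \<lambda>y. axis i (b j y)) y) $ k"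
          using fun_cong[OF spec[OF c, of k], of y] by (simp only: comp prod.case)
      qed
      then show "f \<in> ?R" by blast
    next
      fix f assume "f \<in> ?R"
      then obtain c where c: "f = (\<lambda>y. \<Sum>p\<in>J \<times> UNIV. c p *\<^sub>R (case p of (j, i) \<Rightarrow> \<lambda>y. axis i (b j y)) y)" by blast
      have "(\<lambda>y. f y $ k) = (\<lambda>y. \<Sum>j\<in>J. c (j, k) *\<^sub>R b j y)" for k
        by (rule ext) (simp only: c comp)
      then have "(\<lambda>y. f y $ k) \<in> V" for k
        unfolding V by (intro CollectI exI[of _ "\<lambda>j. c (j, k)"]) simp
      then show "f \<in> vec3 V" by (simp add: vec3_def)
    qed
    fix c :: "'j \<times> 3 \<Rightarrow> real"
    assume zero: "(\<lambda>y. \<Sum>p\<in>J \<times> UNIV. c p *\<^sub>R (case p of (j, i) \<Rightarrow> \<lambda>y. axis i (b j y)) y) = (\<lambda>y. 0)"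
    show "\<forall>p\<in>J \<times> UNIV. c p = 0"
    proof
      fix p assume p: "p \<in> J \<times> (UNIV :: 3 set)"
      have "(\<Sum>j\<in>J. c (j, snd p) *\<^sub>R b j y) = 0" for y
        unfolding comp[symmetric] using fun_cong[OF zero, of y] by simp
      then have "\<forall>j\<in>J. c (j, snd p) = 0" by (intro ind) auto
      then show "c p = 0" using p by auto
    qed
  qed
qed

lemma fun_dim_vec3:
  assumes "is_basis_family J b V"
  shows "fun_dim (vec3 V) = 3 * fun_dim V"
  using fun_dim_basis_family[OF is_basis_family_vec3[OF assms]] fun_dim_basis_family[OF assms]
  by (simp add: card_cartesian_product)

text \<open>
  Rank and nullity for a map that is linear on \<open>V\<close> only. A basis of the kernel is
  extended to one of \<open>V\<close>; the images of the added vectors are a basis of the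
  image. The maps used here, such as the pointwise divergence, are not linear on all
  functions.
\<close>

lemma fun_dim_rank_nullity:
  fixes b :: "'j \<Rightarrow> 'a \<Rightarrow> 'b::real_vector" and T :: "('a \<Rightarrow> 'b) \<Rightarrow> 'c \<Rightarrow> 'd::real_vector"
  assumes V: "is_basis_family J b V"
    and add: "\<And>f g. f \<in> V \<Longrightarrow> g \<in> V \<Longrightarrow> T (\<lambda>y. f y + g y) = (\<lambda>z. T f z + T g z)"
    and scale: "\<And>f c. f \<in> V \<Longrightarrow> T (\<lambda>y. c *\<^sub>R f y) = (\<lambda>z. c *\<^sub>R T f z)"
  shows "fun_dim V = fun_dim (T ` V) + fun_dim {f \<in> V. T f = (\<lambda>z. 0)}"
proof -
  define K where "K = {f \<in> V. T f = (\<lambda>z. 0)}"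
  have finJ: "finite J" and Veq: "V = {\<lambda>y. \<Sum>j\<in>J. c j *\<^sub>R b j y | c. True}"
    using V unfolding is_basis_family_def by blast+
  have comb: "(\<lambda>y. \<Sum>j\<in>J. c j *\<^sub>R b j y) = (\<Sum>j\<in>J. (\<lambda>y. c j *\<^sub>R b j y))" for c
    by (rule ext) (simp add: sum_fun_apply)
  have Vspan: "V \<subseteq> funs.span (b ` J)"
  proof
    fix f assume "f \<in> V"
    then obtain c where f: "f = (\<Sum>j\<in>J. (\<lambda>y. c j *\<^sub>R b j y))" unfolding Veq comb by blast
    show "f \<in> funs.span (b ` J)"
      unfolding f by (intro funs.span_sum funs.span_scale funs.span_base imageI)
  qed
  have subV: "funs.subspace V"
  proof (rule funs.subspaceI)
    show "0 \<in> V" unfolding Veq zero_fun_def by (rule CollectI, rule exI[of _ "\<lambda>_. 0"]) simp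
    show "f + g \<in> V" if fg: "f \<in> V" "g \<in> V" for f g
    proof -
      obtain c d where "f = (\<lambda>y. \<Sum>j\<in>J. c j *\<^sub>R b j y)" "g = (\<lambda>y. \<Sum>j\<in>J. d j *\<^sub>R b j y)" using fg Veq by auto
      then have "f + g = (\<lambda>y. \<Sum>j\<in>J. (c j + d j) *\<^sub>R b j y)"
        by (auto simp: scaleR_add_left sum.distrib)
      then show ?thesis unfolding Veq by (intro CollectI exI[of _ "\<lambda>j. c j + d j"]) simp
    qed
    show "(\<lambda>y. a *\<^sub>R f y) \<in> V" if f: "f \<in> V" for a f
    proof -
      obtain c where "f = (\<lambda>y. \<Sum>j\<in>J. c j *\<^sub>R b j y)" using f unfolding Veq by blast
      then have "(\<lambda>y. a *\<^sub>R f y) = (\<lambda>y. \<Sum>j\<in>J. (a * c j) *\<^sub>R b j y)" by (simp add: scaleR_right.sum)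
      then show ?thesis unfolding Veq by (intro CollectI exI[of _ "\<lambda>j. a * c j"]) simp
    qed
  qed
  have T0: "T (\<lambda>y. 0) = (\<lambda>z. 0)"
    using scale[of "\<lambda>y. 0" 0] funs.subspace_0[OF subV] by (simp add: zero_fun_def)
  have plus: "f + g = (\<lambda>y. f y + g y)" for f g :: "'a \<Rightarrow> 'b" by (rule ext) simp
  have subK: "funs.subspace K"
  proof (rule funs.subspaceI)
    show "0 \<in> K" using funs.subspace_0[OF subV] T0 by (simp add: K_def zero_fun_def)
    show "f + g \<in> K" if "f \<in> K" "g \<in> K" for f g
      using that funs.subspace_add[OF subV, of f g] add[of f g] by (simp add: K_def plus)
    show "(\<lambda>y. a *\<^sub>R f y) \<in> K" if "f \<in> K" for a f
      using that funs.subspace_scale[OF subV, of f a] scale[of f a] by (simp add: K_def)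
  qed
  have Tsum: "(\<lambda>y. \<Sum>v\<in>F. u v *\<^sub>R v y) \<in> V \<and> T (\<lambda>y. \<Sum>v\<in>F. u v *\<^sub>R v y) = (\<lambda>z. \<Sum>v\<in>F. u v *\<^sub>R T v z)"
    if "finite F" "F \<subseteq> V" for F and u :: "('a \<Rightarrow> 'b) \<Rightarrow> real"
    using that
  proof (induction F)
    case empty
    then show ?case using T0 funs.subspace_0[OF subV] by (simp add: zero_fun_def)
  next
    case (insert v F)
    then have v: "(\<lambda>y. u v *\<^sub>R v y) \<in> V" using funs.subspace_scale[OF subV, of v "u v"] by simp
    have "(\<lambda>y. \<Sum>v\<in>insert v F. u v *\<^sub>R v y) = (\<lambda>y. u v *\<^sub>R v y + (\<Sum>v\<in>F. u v *\<^sub>R v y))"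
      using insert.hyps by simp
    moreover have "(\<lambda>y. u v *\<^sub>R v y + (\<Sum>v\<in>F. u v *\<^sub>R v y)) \<in> V"
      using funs.subspace_add[OF subV v] insert by (simp add: plus)
    moreover have "T (\<lambda>y. u v *\<^sub>R v y + (\<Sum>v\<in>F. u v *\<^sub>R v y)) = (\<lambda>z. u v *\<^sub>R T v z + (\<Sum>v\<in>F. u v *\<^sub>R T v z))"
      using add[OF v, of "\<lambda>y. \<Sum>v\<in>F. u v *\<^sub>R v y"] scale[of v "u v"] insert by simp
    ultimately show ?case using insert.hyps by simp
  qed
  obtain BK where BK: "BK \<subseteq> K" "funs.independent BK" "K \<subseteq> funs.span BK"
    using funs.maximal_independent_subset[of K] by blast
  obtain B where B: "BK \<subseteq> B" "B \<subseteq> V" "funs.independent B" "V \<subseteq> funs.span B"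
    using funs.maximal_independent_subset_extend[of BK V] BK(1,2) by (auto simp: K_def)
  have finB: "finite B"
    using funs.independent_span_bound[of "b ` J" B] finJ B(2,3) Vspan by auto
  have finBK: "finite BK" using finB B(1) finite_subset by blast
  have family: "is_basis_family A (\<lambda>v. v) W" if A: "finite A" "funs.independent A" "funs.span A = W" for A and W :: "('a \<Rightarrow> 'b) set"
    unfolding is_basis_family_def
  proof (intro conjI allI impI ballI)
    have eq: "(\<lambda>y. \<Sum>v\<in>A. u v *\<^sub>R v y) = (\<Sum>v\<in>A. (\<lambda>y. u v *\<^sub>R v y))" for u :: "('a \<Rightarrow> 'b) \<Rightarrow> real"
      by (rule ext) (simp add: sum_fun_apply)
    show "W = {\<lambda>y. \<Sum>v\<in>A. u v *\<^sub>R v y | u. True}"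
      unfolding eq using funs.span_finite[OF A(1)] A(3) by auto
    fix u v assume "(\<lambda>y. \<Sum>v\<in>A. u v *\<^sub>R v y) = (\<lambda>y. 0)" "v \<in> A"
    then show "u v = 0" using funs.independentD[OF A(2,1) subset_refl, of u v] by (simp add: eq zero_fun_def)
  qed (rule A(1))
  have spanBK: "funs.span BK = K" using BK subK funs.span_minimal by blast
  have spanB: "funs.span B = V" using B subV funs.span_minimal by blast
  note famB = family[OF finB B(3) spanB] and famBK = family[OF finBK BK(2) spanBK]
  let ?C = "B - BK"
  have "is_basis_family ?C T (T ` V)"
    unfolding is_basis_family_def
  proof (intro conjI allI impI ballI)
    show "finite ?C" using finB by simp
    have split: "(\<lambda>y. \<Sum>v\<in>B. u v *\<^sub>R v y) = (\<lambda>y. (\<Sum>v\<in>?C. u v *\<^sub>R v y) + (\<Sum>v\<in>BK. u v *\<^sub>R v y))" for u :: "('a \<Rightarrow> 'b) \<Rightarrow> real"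
      by (rule ext, rule sum.subset_diff[OF B(1) finB])
    show "T ` V = {\<lambda>z. \<Sum>v\<in>?C. c v *\<^sub>R T v z | c. True}"
    proof (intro equalityI subsetI)
      fix g assume "g \<in> T ` V"
      then obtain f where f: "f \<in> V" "g = T f" by blast
      then obtain u where u: "f = (\<lambda>y. \<Sum>v\<in>B. u v *\<^sub>R v y)" using famB unfolding is_basis_family_def by blast
      have "g = (\<lambda>z. (\<Sum>v\<in>B. u v *\<^sub>R T v z))" unfolding f(2) u using Tsum[OF finB B(2)] by blast
      also have "\<dots> = (\<lambda>z. (\<Sum>v\<in>?C. u v *\<^sub>R T v z))"
      proof (rule ext, rule sum.mono_neutral_right[OF finB])
        fix z show "\<forall>v\<in>B - ?C. u v *\<^sub>R T v z = 0"
        proof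
          fix v assume "v \<in> B - ?C"
          then have "T v = (\<lambda>z. 0)" using BK(1) by (auto simp: K_def)
          then show "u v *\<^sub>R T v z = 0" by simp
        qed
      qed auto
      finally show "g \<in> {\<lambda>z. \<Sum>v\<in>?C. c v *\<^sub>R T v z | c. True}" by blast
    next
      fix g assume "g \<in> {\<lambda>z. \<Sum>v\<in>?C. c v *\<^sub>R T v z | c. True}"
      then obtain c where "g = (\<lambda>z. \<Sum>v\<in>?C. c v *\<^sub>R T v z)" by blast
      moreover have "finite ?C" "?C \<subseteq> V" using finB B(2) by auto
      ultimately show "g \<in> T ` V" using Tsum[of ?C c] by (metis (no_types, lifting) imageI)
    qed
    fix c v assume zero: "(\<lambda>z. \<Sum>v\<in>?C. c v *\<^sub>R T v z) = (\<lambda>z. 0)" and v: "v \<in> ?C"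
    have "finite ?C" "?C \<subseteq> V" using finB B(2) by auto
    from Tsum[OF this, of c] have "(\<lambda>y. \<Sum>v\<in>?C. c v *\<^sub>R v y) \<in> K" using zero by (simp add: K_def)
    then obtain d where d: "(\<lambda>y. \<Sum>v\<in>?C. c v *\<^sub>R v y) = (\<lambda>y. \<Sum>v\<in>BK. d v *\<^sub>R v y)"
      using famBK unfolding is_basis_family_def by blast
    define e where "e v = (if v \<in> BK then - d v else c v)" for v
    have "(\<lambda>y. \<Sum>v\<in>B. e v *\<^sub>R v y) = (\<lambda>y. 0)"
    proof
      fix y
      have "(\<Sum>v\<in>B. e v *\<^sub>R v y) = (\<Sum>v\<in>?C. e v *\<^sub>R v y) + (\<Sum>v\<in>BK. e v *\<^sub>R v y)"
        by (rule fun_cong[OF split])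
      also have "(\<Sum>v\<in>?C. e v *\<^sub>R v y) = (\<Sum>v\<in>?C. c v *\<^sub>R v y)" by (intro sum.cong) (auto simp: e_def)
      also have "(\<Sum>v\<in>BK. e v *\<^sub>R v y) = - (\<Sum>v\<in>BK. d v *\<^sub>R v y)" by (simp add: e_def sum_negf)
      finally show "(\<Sum>v\<in>B. e v *\<^sub>R v y) = 0" using fun_cong[OF d, of y] by simp
    qed
    then have "e v = 0" using famB v unfolding is_basis_family_def by blast
    then show "c v = 0" using v by (simp add: e_def)
  qed
  then have "fun_dim (T ` V) = card ?C" by (rule fun_dim_basis_family)
  moreover have "fun_dim V = card B" "fun_dim K = card BK"
    using famB famBK by (auto intro: fun_dim_basis_family)
  moreover have "card B = card ?C + card BK"
    using B(1) finB by (metis card_Diff_subset card_mono finBK le_add_diff_inverse2)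
  ultimately show ?thesis by (simp add: K_def)
qed

text \<open>
  A functional that is not identically zero has rank one. To apply rank and nullity its value
  is read as a function on the one-point type.
\<close>

lemma fun_dim_kernel_of_functional:
  fixes b :: "'j \<Rightarrow> 'a \<Rightarrow> 'b::real_vector" and l :: "('a \<Rightarrow> 'b) \<Rightarrow> real"
  assumes V: "is_basis_family J b V"
    and add: "\<And>f g. f \<in> V \<Longrightarrow> g \<in> V \<Longrightarrow> l (\<lambda>y. f y + g y) = l f + l g"
    and scale: "\<And>f c. f \<in> V \<Longrightarrow> l (\<lambda>y. c *\<^sub>R f y) = c * l f"
    and nonzero: "f0 \<in> V" "l f0 \<noteq> 0"
  shows "fun_dim V = fun_dim {f \<in> V. l f = 0} + 1"
proof -
  let ?T = "\<lambda>f (_ :: unit). l f"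
  have "fun_dim V = fun_dim (?T ` V) + fun_dim {f \<in> V. ?T f = (\<lambda>z. 0)}"
    by (rule fun_dim_rank_nullity[OF V]) (simp_all add: add scale)
  moreover have "{f \<in> V. ?T f = (\<lambda>z. 0)} = {f \<in> V. l f = 0}" by (auto simp: fun_eq_iff)
  moreover have "fun_dim (?T ` V) = card {()}"
  proof (rule fun_dim_basis_family)
    show "is_basis_family {()} (\<lambda>_ _. 1 :: real) (?T ` V)"
      unfolding is_basis_family_def
    proof (intro conjI allI impI)
      show "?T ` V = {\<lambda>y. \<Sum>j\<in>{()}. c j *\<^sub>R 1 | c. True}"
      proof (intro equalityI subsetI)
        fix g assume "g \<in> ?T ` V"
        then obtain f where "g = ?T f" by blast
        then show "g \<in> {\<lambda>y. \<Sum>j\<in>{()}. c j *\<^sub>R 1 | c. True}"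
          by (intro CollectI exI[of _ "\<lambda>_. l f"]) simp
      next
        fix g :: "unit \<Rightarrow> real" assume "g \<in> {\<lambda>y. \<Sum>j\<in>{()}. c j *\<^sub>R 1 | c. True}"
        then obtain c where c: "g = (\<lambda>y. c ())" by auto
        have "(\<lambda>y. (c () / l f0) *\<^sub>R f0 y) \<in> V"
        proof -
          obtain d where "f0 = (\<lambda>y. \<Sum>j\<in>J. d j *\<^sub>R b j y)" using V nonzero(1) unfolding is_basis_family_def by blast
          then have "(\<lambda>y. (c () / l f0) *\<^sub>R f0 y) = (\<lambda>y. \<Sum>j\<in>J. (c () / l f0 * d j) *\<^sub>R b j y)"
            by (simp add: scaleR_right.sum)
          moreover have "V = {\<lambda>y. \<Sum>j\<in>J. c j *\<^sub>R b j y | c. True}" using V unfolding is_basis_family_def by blast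
          ultimately show ?thesis
            by (simp only:) (intro CollectI exI[of _ "\<lambda>j. c () / l f0 * d j"], simp)
        qed
        moreover have "g = ?T (\<lambda>y. (c () / l f0) *\<^sub>R f0 y)"
          unfolding c using scale[OF nonzero(1)] nonzero(2) by simp
        ultimately show "g \<in> ?T ` V" by (intro image_eqI[where x = "\<lambda>y. (c () / l f0) *\<^sub>R f0 y"])
      qed
    qed (auto simp: fun_eq_iff)
  qed
  ultimately show ?thesis by simp
qed

section \<open>Barycentric coordinates\<close>

lemma sum_delta_diff:
  fixes c :: "'a::finite \<Rightarrow> real"
  shows "(\<Sum>j\<in>UNIV. c j * ((if i = j then 1 else 0) - (if i = k then 1 else 0))) =
         c i - (if i = k then (\<Sum>j\<in>UNIV. c j) else 0)"
  by (simp add: right_diff_distrib sum_subtractf if_distrib[of "\<lambda>a. _ * a"] cong: if_cong)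

text \<open>
  The gradients of the barycentric coordinates: the vectors dual to the edge vectors. For a
  fixed base vertex the edge vectors are a basis, so a linear functional with prescribed
  values on them exists; it is represented by a vector.
\<close>

lemma nondegenerate_dual_exists:
  fixes x :: "4 \<Rightarrow> real ^ 3"
  assumes "nondegenerate x"
  shows "\<exists>g. \<forall>i j k. g i \<bullet> (x j - x k) = (if i = j then 1 else 0) - (if i = k then 1 else (0::real))"
proof -
  define D where "D j = x j - x 0" for j
  define B where "B = D ` (UNIV - {0})"
  have inj: "inj x" and aff: "\<not> affine_dependent (range x)"
    using assms by (auto simp: nondegenerate_def)
  have inj_D: "inj D" using inj by (auto simp: inj_def D_def)
  have "range x = insert (x 0) (x ` (UNIV - {0}))" by auto
  moreover have "x 0 \<notin> x ` (UNIV - {0})" using inj by (auto dest: injD)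
  ultimately have ind: "independent B"
    using aff affine_dependent_iff_dependent[of "x 0" "x ` (UNIV - {0})"]
    by (simp add: B_def D_def image_image dependent_raw_def)
  have "\<exists>g. \<forall>j k. g \<bullet> (x j - x k) = (if i = j then 1 else 0) - (if i = k then 1 else (0::real))" for i
  proof -
    obtain h where h: "linear h" "\<forall>v\<in>B. h v = (if i = 0 then - 1 else if v = D i then 1 else (0::real))"
      using linear_independent_extend[OF ind, of "\<lambda>v. if i = 0 then - 1 else if v = D i then 1 else 0"] by blast
    have hD: "h (D j) = (if i = j then 1 else 0) - (if i = 0 then 1 else 0)" for j
    proof (cases "j = 0")
      case True
      then show ?thesis using linear_0[OF h(1)] by (simp add: D_def)
    next
      case False
      then show ?thesis using h(2) inj_D by (auto simp: B_def dest: injD)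
    qed
    have "adjoint h 1 \<bullet> (x j - x k) = h (x j - x k)" for j k
      using adjoint_works[OF h(1), of "x j - x k" 1] by (simp add: inner_commute)
    moreover have "h (x j - x k) = h (D j) - h (D k)" for j k
      by (simp add: D_def linear_diff[OF h(1)])
    ultimately show ?thesis using hD by (intro exI[of _ "adjoint h 1"]) auto
  qed
  then show ?thesis by metis
qed

text \<open>
  Conversely dual vectors force affine independence: they read off the coefficients of an
  affine dependence. This is how the four cells are seen to be nondegenerate.
\<close>

lemma nondegenerateI_dual:
  fixes p :: "4 \<Rightarrow> real ^ 3"
  assumes "\<And>i j k. g i \<bullet> (p j - p k) = (if i = j then 1 else 0) - (if i = k then 1 else (0::real))"
  shows "nondegenerate p"
  unfolding nondegenerate_def
proof
  show inj: "inj p"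
  proof (rule injI, rule ccontr)
    fix i j assume "p i = p j" "i \<noteq> j"
    then show False using assms[of i i j] by simp
  qed
  show "\<not> affine_dependent (range p)"
  proof
    assume "affine_dependent (range p)"
    then obtain u where u: "sum u (range p) = 0" "\<exists>v\<in>range p. u v \<noteq> 0" "(\<Sum>v\<in>range p. u v *\<^sub>R v) = 0"
      using affine_dependent_explicit_finite[of "range p"] by auto
    have s: "(\<Sum>j\<in>UNIV. u (p j)) = 0" and t: "(\<Sum>j\<in>UNIV. u (p j) *\<^sub>R p j) = 0"
      using u(1,3) inj by (simp_all add: sum.reindex)
    have "u (p i) = 0" for i
    proof -
      have "0 = g i \<bullet> ((\<Sum>j\<in>UNIV. u (p j) *\<^sub>R p j) - (\<Sum>j\<in>UNIV. u (p j)) *\<^sub>R p 0)"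
        using s t by simp
      also have "\<dots> = g i \<bullet> (\<Sum>j\<in>UNIV. u (p j) *\<^sub>R (p j - p 0))"
        by (simp add: scaleR_diff_right sum_subtractf scaleR_left.sum)
      also have "\<dots> = (\<Sum>j\<in>UNIV. u (p j) * (g i \<bullet> (p j - p 0)))"
        by (simp add: inner_sum_right)
      also have "\<dots> = u (p i)"
        unfolding assms by (simp only: sum_delta_diff s) simp
      finally show ?thesis by simp
    qed
    with u(2) show False by auto
  qed
qed

locale tetrahedron =
  fixes x :: "4 \<Rightarrow> real ^ 3"
  assumes nondeg: "nondegenerate x"
begin

definition grad_bary :: "4 \<Rightarrow> real ^ 3" where
  "grad_bary = (SOME g. \<forall>i j k. g i \<bullet> (x j - x k) = (if i = j then 1 else 0) - (if i = k then 1 else 0))"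

definition bary :: "4 \<Rightarrow> real ^ 3 \<Rightarrow> real" where
  "bary i y = (if i = 0 then 1 else 0) + grad_bary i \<bullet> (y - x 0)"

lemma grad_bary_dual: "grad_bary i \<bullet> (x j - x k) = (if i = j then 1 else 0) - (if i = k then 1 else 0)"
  using someI_ex[OF nondegenerate_dual_exists[OF nondeg]] by (simp add: grad_bary_def)

lemma inj_x: "inj x"
  using nondeg by (simp add: nondegenerate_def)

lemma span_edge_vectors: "span ((\<lambda>j. x j - x k) ` (UNIV - {k})) = UNIV"
proof -
  let ?B = "(\<lambda>j. x j - x k) ` (UNIV - {k})"
  have "range x = insert (x k) (x ` (UNIV - {k}))" by auto
  moreover have "x k \<notin> x ` (UNIV - {k})" using inj_x by (auto dest: injD)
  ultimately have "independent ?B"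
    using nondeg affine_dependent_iff_dependent[of "x k" "x ` (UNIV - {k})"]
    by (simp add: nondegenerate_def image_image dependent_raw_def)
  moreover have "card ?B = 3"
    using inj_x by (subst card_image) (auto simp: inj_on_def inj_def card_Diff_singleton)
  ultimately have "dim ?B = DIM(real ^ 3)"
    by (simp add: dim_eq_card_independent)
  then show ?thesis by (simp only: dim_eq_full)
qed

text \<open>
  For every base vertex \<open>k\<close>, the edge vectors \<open>x j - x k\<close> and the
  gradients with index other than \<open>k\<close> are dual bases. This explicit inverse
  solves the linear systems for the leading terms below.
\<close>

lemma inner_grad_bary_expand: "v = (\<Sum>j\<in>UNIV. (grad_bary j \<bullet> v) *\<^sub>R (x j - x k))"
proof -
  have "v \<in> span ((\<lambda>j. x j - x k) ` (UNIV - {k}))" by (simp add: span_edge_vectors)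
  then show ?thesis
  proof (induction rule: span_induct_alt)
    case base
    then show ?case by simp
  next
    case (step c w z)
    then obtain l where l: "l \<noteq> k" "w = x l - x k" by auto
    have "(\<Sum>j\<in>UNIV. (grad_bary j \<bullet> w) *\<^sub>R (x j - x k)) = w"
      unfolding l grad_bary_dual using l(1)
      by (simp add: scaleR_diff_left sum_subtractf if_distrib[of "\<lambda>a. a *\<^sub>R _"] sum.delta' cong: if_cong)
    then have "(\<Sum>j\<in>UNIV. (c * (grad_bary j \<bullet> w)) *\<^sub>R (x j - x k)) = c *\<^sub>R w"
      by (simp flip: scaleR_scaleR scaleR_right.sum)
    then show ?case using step(2)
      by (simp add: inner_add_right scaleR_add_left sum.distrib)
  qed
qed

lemma grad_bary_eqI: "(\<And>j. j \<noteq> k \<Longrightarrow> grad_bary j \<bullet> v = grad_bary j \<bullet> w) \<Longrightarrow> v = w"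
proof -
  assume eq: "\<And>j. j \<noteq> k \<Longrightarrow> grad_bary j \<bullet> v = grad_bary j \<bullet> w"
  have eq2: "(grad_bary j \<bullet> v) *\<^sub>R (x j - x k) = (grad_bary j \<bullet> w) *\<^sub>R (x j - x k)" (is "?a = ?b") for j
    using eq[of j] by (cases "j = k") auto
  then show "v = w"
    by (subst inner_grad_bary_expand[of v k], subst inner_grad_bary_expand[of w k])
       (rule sum.cong[OF refl], rule eq2)
qed

lemma sum_grad_bary: "(\<Sum>j\<in>UNIV. grad_bary j) = 0"
proof -
  have "(\<Sum>j\<in>UNIV. grad_bary j) \<bullet> v = 0" for v
  proof -
    have "(\<Sum>j\<in>UNIV. grad_bary j) \<bullet> (x l - x 0) = 0" for l
      unfolding inner_sum_left grad_bary_dual by (simp add: sum_subtractf)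
    then show ?thesis
      by (subst inner_grad_bary_expand[of v 0]) (simp add: inner_sum_right)
  qed
  then show ?thesis by (metis inner_eq_zero_iff)
qed

lemma bary_diff: "bary i y - bary i y' = grad_bary i \<bullet> (y - y')"
  by (simp add: bary_def inner_diff_right)

lemma bary_vertex: "bary i (x j) = (if i = j then 1 else 0)"
  unfolding bary_def grad_bary_dual by simp

lemma sum_bary: "(\<Sum>i\<in>UNIV. bary i y) = 1"
  unfolding bary_def by (simp add: sum.distrib sum_grad_bary flip: inner_sum_left)

lemma sum_bary_x: "(\<Sum>i\<in>UNIV. bary i y *\<^sub>R x i) = y"
proof -
  have "(\<Sum>i\<in>UNIV. bary i y *\<^sub>R x i) = (\<Sum>i\<in>UNIV. bary i y *\<^sub>R x 0 + bary i y *\<^sub>R (x i - x 0))"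
    by (simp add: algebra_simps)
  also have "\<dots> = x 0 + (\<Sum>i\<in>UNIV. bary i y *\<^sub>R (x i - x 0))"
    by (simp add: sum.distrib sum_bary flip: scaleR_left.sum)
  also have "(\<Sum>i\<in>UNIV. bary i y *\<^sub>R (x i - x 0)) = (\<Sum>i\<in>UNIV. (grad_bary i \<bullet> (y - x 0)) *\<^sub>R (x i - x 0))"
    by (intro sum.cong) (auto simp: bary_def)
  also have "\<dots> = y - x 0" by (rule inner_grad_bary_expand[symmetric])
  finally show ?thesis by simp
qed

lemma bary_affine: "(\<Sum>j\<in>UNIV. t j) = 1 \<Longrightarrow> bary i (\<Sum>j\<in>UNIV. t j *\<^sub>R p j) = (\<Sum>j\<in>UNIV. t j * bary i (p j))"
  for t :: "'j::finite \<Rightarrow> real"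
proof -
  assume t: "(\<Sum>j\<in>UNIV. t j) = 1"
  have "(\<Sum>j\<in>UNIV. t j *\<^sub>R p j) - x 0 = (\<Sum>j\<in>UNIV. t j *\<^sub>R (p j - x 0))"
    using t by (simp add: scaleR_diff_right sum_subtractf flip: scaleR_left.sum)
  moreover have "(\<Sum>j\<in>UNIV. t j * (if i = 0 then 1 else 0)) = (if i = 0 then 1 else (0::real))"
    using t by simp
  ultimately show ?thesis
    by (simp add: bary_def inner_sum_right distrib_left sum.distrib)
qed

lemma bary_combination: "(\<Sum>j\<in>UNIV. t j) = 1 \<Longrightarrow> bary i (\<Sum>j\<in>UNIV. t j *\<^sub>R x j) = t i"
  by (simp add: bary_affine bary_vertex if_distrib[of "\<lambda>a. _ * a"] cong: if_cong)

lemma bary_line: "bary i (y + t *\<^sub>R (y' - y)) = (1 - t) * bary i y + t * bary i y'"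
  by (simp add: bary_def algebra_simps inner_diff_right inner_add_right)

lemma bary_convex_comb: "u + v = 1 \<Longrightarrow> bary i (u *\<^sub>R y + v *\<^sub>R y') = u * bary i y + v * bary i y'"
proof -
  assume "u + v = 1"
  then have "u *\<^sub>R y + v *\<^sub>R y' = y + v *\<^sub>R (y' - y)" and "u = 1 - v"
    by (auto simp: algebra_simps simp flip: scaleR_add_left)
  then show ?thesis by (simp only: bary_line)
qed

lemma bary_add: "bary i (y + v) = bary i y + grad_bary i \<bullet> v"
  by (simp add: bary_def inner_add_right inner_diff_right)

lemma bary_eqI:
  assumes "\<And>i. bary i y = bary i y'"
  shows "y = y'"
proof -
  have "(\<Sum>i\<in>UNIV. bary i y *\<^sub>R x i) = (\<Sum>i\<in>UNIV. bary i y' *\<^sub>R x i)"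
    by (simp only: assms)
  then show ?thesis by (simp only: sum_bary_x)
qed

lemma grad_bary_0: "grad_bary i \<noteq> 0"
proof
  assume "grad_bary i = 0"
  moreover obtain k :: 4 where "k \<noteq> i" by (metis zero_neq_one)
  ultimately show False using grad_bary_dual[of i i k] by simp
qed

lemma bary_has_derivative: "(bary i has_derivative (\<lambda>v. grad_bary i \<bullet> v)) (at y within S)"
  unfolding bary_def[abs_def] by (auto intro!: derivative_eq_intros)

lemma continuous_bary [continuous_intros]: "continuous_on S f \<Longrightarrow> continuous_on S (\<lambda>y. bary i (f y))"
  unfolding bary_def by (intro continuous_intros)

text \<open>
  Vertices, edges, faces and the tetrahedron itself are described alike by signs of
  barycentric coordinates.
\<close>

lemma convex_hull_subset_eq:
  assumes "J \<noteq> {}"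
  shows "convex hull (x ` J) = {y. (\<forall>i. 0 \<le> bary i y) \<and> (\<forall>i. i \<notin> J \<longrightarrow> bary i y = 0)}"
proof
  obtain k where k: "k \<in> J" using assms by auto
  have cvx: "convex {y. (\<forall>i. 0 \<le> bary i y) \<and> (\<forall>i. i \<notin> J \<longrightarrow> bary i y = 0)}"
    by (rule convexI) (auto simp: bary_convex_comb)
  show "convex hull (x ` J) \<subseteq> {y. (\<forall>i. 0 \<le> bary i y) \<and> (\<forall>i. i \<notin> J \<longrightarrow> bary i y = 0)}"
    by (rule hull_minimal) (auto simp: bary_vertex cvx)
  show "{y. (\<forall>i. 0 \<le> bary i y) \<and> (\<forall>i. i \<notin> J \<longrightarrow> bary i y = 0)} \<subseteq> convex hull (x ` J)"
  proof clarify
    fix y assume y: "\<forall>i. 0 \<le> bary i y" "\<forall>i. i \<notin> J \<longrightarrow> bary i y = 0"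
    have "y = (\<Sum>i\<in>J. bary i y *\<^sub>R x i)"
      by (subst sum_bary_x[of y, symmetric], rule sum.mono_neutral_right) (use y in auto)
    moreover have "(\<Sum>i\<in>J. bary i y) = 1"
      by (subst sum_bary[of y, symmetric], rule sum.mono_neutral_left) (use y in auto)
    moreover have "(\<Sum>i\<in>J. bary i y *\<^sub>R x i) \<in> convex hull (x ` J)"
      using y calculation(2) by (intro convex_sum) (auto intro: hull_inc)
    ultimately show "y \<in> convex hull (x ` J)" by simp
  qed
qed


section \<open>Polynomials in Bernstein form\<close>

definition mon :: "(4 \<Rightarrow> nat) \<Rightarrow> real ^ 3 \<Rightarrow> real" where
  "mon \<alpha> y = (\<Prod>i\<in>UNIV. bary i y ^ \<alpha> i)"

text \<open>
  Polynomials of total degree at most \<open>d\<close> on the whole space, written as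
  homogeneous polynomials of degree exactly \<open>d\<close> in the barycentric coordinates.
  This is possible because the coordinates add up to 1. The Bernstein form shows the
  restriction to a face \<open>bary i y = 0\<close>: the terms with \<open>\<alpha> i =
  0\<close>. Values may be scalars or vectors.
\<close>

definition pol :: "nat \<Rightarrow> (real ^ 3 \<Rightarrow> 'b::real_normed_vector) set" where
  "pol d = {f. \<exists>a. f = (\<lambda>y. \<Sum>\<alpha>\<in>expos d. mon \<alpha> y *\<^sub>R a \<alpha>)}"

lemma polI: "f = (\<lambda>y. \<Sum>\<alpha>\<in>expos d. mon \<alpha> y *\<^sub>R a \<alpha>) \<Longrightarrow> f \<in> pol d"
  by (auto simp: pol_def)

lemma polE: "f \<in> pol d \<Longrightarrow> (\<And>a. f = (\<lambda>y. \<Sum>\<alpha>\<in>expos d. mon \<alpha> y *\<^sub>R a \<alpha>) \<Longrightarrow> P) \<Longrightarrow> P"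
  by (auto simp: pol_def)

lemma mon_Suc: "mon (\<alpha>(i := Suc (\<alpha> i))) y = bary i y * mon \<alpha> y"
proof -
  have "mon \<beta> y = bary i y ^ \<beta> i * (\<Prod>j\<in>UNIV - {i}. bary j y ^ \<beta> j)" for \<beta>
    unfolding mon_def by (rule prod.remove) auto
  then show ?thesis by simp
qed

lemma expos_Suc_upd: "\<alpha>(i := Suc (\<alpha> i)) \<in> expos (Suc d) \<longleftrightarrow> \<alpha> \<in> expos d"
proof -
  have "sum \<beta> UNIV = \<beta> i + sum \<beta> (UNIV - {i})" for \<beta> :: "4 \<Rightarrow> nat"
    by (rule sum.remove) auto
  then show ?thesis by (simp add: expos_def)
qed

lemma expos_SucE:
  assumes "\<beta> \<in> expos (Suc d)"
  obtains i \<alpha> where "\<alpha> \<in> expos d" "\<beta> = \<alpha>(i := Suc (\<alpha> i))"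
proof -
  have "\<exists>i. \<beta> i \<noteq> 0"
  proof (rule ccontr)
    assume "\<nexists>i. \<beta> i \<noteq> 0"
    then show False using assms by (simp add: expos_def)
  qed
  then obtain i where i: "\<beta> i \<noteq> 0" by blast
  let ?\<alpha> = "\<beta>(i := \<beta> i - 1)"
  have eq: "\<beta> = ?\<alpha>(i := Suc (?\<alpha> i))" using i by auto
  then have "?\<alpha> \<in> expos d" using assms expos_Suc_upd[of ?\<alpha> i d] by simp
  then show thesis using eq by (rule that)
qed

lemma expos_pos_entry:
  assumes "\<beta> \<in> expos (Suc d)"
  obtains k where "\<beta> k > 0"
  using expos_SucE[OF assms] by (metis fun_upd_same zero_less_Suc)

lemma mon_zero: "bary i y = 0 \<Longrightarrow> 0 < \<alpha> i \<Longrightarrow> mon \<alpha> y = 0"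
  unfolding mon_def by (rule prod_zero) auto

lemma pol_mon: "\<alpha> \<in> expos d \<Longrightarrow> (\<lambda>y. mon \<alpha> y *\<^sub>R v) \<in> pol d"
  by (rule polI[where a = "\<lambda>\<beta>. if \<beta> = \<alpha> then v else 0"])
     (auto simp: if_distrib[of "\<lambda>a. _ *\<^sub>R a"] cong: if_cong)

lemma pol_add: "f \<in> pol d \<Longrightarrow> g \<in> pol d \<Longrightarrow> (\<lambda>y. f y + g y) \<in> pol d"
  by (elim polE, rule_tac a = "\<lambda>\<alpha>. a \<alpha> + aa \<alpha>" in polI) (simp add: scaleR_add_right sum.distrib)

lemma pol_zero: "(\<lambda>y. 0) \<in> pol d"
  by (rule polI[where a = "\<lambda>_. 0"]) simp

lemma pol_sum: "(\<And>i. i \<in> I \<Longrightarrow> f i \<in> pol d) \<Longrightarrow> (\<lambda>y. \<Sum>i\<in>I. f i y) \<in> pol d"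
  by (induction I rule: infinite_finite_induct) (auto intro: pol_add pol_zero)

lemma pol_linear_image:
  assumes "linear L" "f \<in> pol d"
  shows "(\<lambda>y. L (f y)) \<in> pol d"
  using assms(2)
  by (elim polE, rule_tac a = "\<lambda>\<alpha>. L (a \<alpha>)" in polI)
     (simp add: linear_sum[OF assms(1)] linear_scale[OF assms(1)])

lemma pol_scaleR: "f \<in> pol d \<Longrightarrow> (\<lambda>y. c *\<^sub>R f y) \<in> pol d"
  by (rule pol_linear_image[where L = "\<lambda>v. c *\<^sub>R v"]) (auto intro: linearI simp: algebra_simps)

lemma pol_mult_const: "f \<in> pol d \<Longrightarrow> (\<lambda>y. c * f y) \<in> pol d" for c :: real
  using pol_scaleR[of f d c] by simp

lemma pol_minus: "f \<in> pol d \<Longrightarrow> (\<lambda>y. - f y) \<in> pol d"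
  using pol_scaleR[of f d "-1"] by simp

lemma pol_diff: "f \<in> pol d \<Longrightarrow> g \<in> pol d \<Longrightarrow> (\<lambda>y. f y - g y) \<in> pol d"
  using pol_add[of f d, OF _ pol_minus[of g d]] by simp

lemma pol_bary_mult: "f \<in> pol d \<Longrightarrow> (\<lambda>y. bary i y *\<^sub>R f y) \<in> pol (Suc d)"
proof (elim polE)
  fix a assume f: "f = (\<lambda>y. \<Sum>\<alpha>\<in>expos d. mon \<alpha> y *\<^sub>R a \<alpha>)"
  have "(\<lambda>y. \<Sum>\<alpha>\<in>expos d. mon (\<alpha>(i := Suc (\<alpha> i))) y *\<^sub>R a \<alpha>) \<in> pol (Suc d)"
    by (intro pol_sum pol_mon) (simp only: expos_Suc_upd)
  then show ?thesis by (simp add: f mon_Suc scaleR_right.sum)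
qed

lemma pol_const: "(\<lambda>y. c) \<in> pol 0"
  by (rule polI[where a = "\<lambda>_. c"]) (simp add: expos_0 mon_def)

lemma pol_0E: "f \<in> pol 0 \<Longrightarrow> \<exists>c. f = (\<lambda>y. c)"
  by (elim polE) (auto simp: expos_0 mon_def)

text \<open>
  Induction along multiplication by barycentric coordinates; it replaces computations with
  monomials.
\<close>

lemma pol_induct [consumes 1, case_names const zero add bary]:
  assumes "f \<in> pol d"
    and const: "\<And>c. P 0 (\<lambda>y. c)"
    and zero: "\<And>d. P d (\<lambda>y. 0)"
    and add: "\<And>d f g. f \<in> pol d \<Longrightarrow> g \<in> pol d \<Longrightarrow> P d f \<Longrightarrow> P d g \<Longrightarrow> P d (\<lambda>y. f y + g y)"
    and bary: "\<And>d i f. f \<in> pol d \<Longrightarrow> P d f \<Longrightarrow> P (Suc d) (\<lambda>y. bary i y *\<^sub>R f y)"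
  shows "P d f"
proof -
  have mon: "P d (\<lambda>y. mon \<alpha> y *\<^sub>R c)" if "\<alpha> \<in> expos d" for \<alpha> c
    using that
  proof (induction d arbitrary: \<alpha>)
    case 0
    then show ?case using const by (simp add: expos_0 mon_def)
  next
    case (Suc d)
    then obtain i \<beta> where \<beta>: "\<beta> \<in> expos d" "\<alpha> = \<beta>(i := Suc (\<beta> i))" by (elim expos_SucE)
    have "P (Suc d) (\<lambda>y. bary i y *\<^sub>R (mon \<beta> y *\<^sub>R c))"
      by (intro bary pol_mon Suc.IH \<beta>(1))
    then show ?case by (simp only: \<beta>(2) mon_Suc scaleR_scaleR)
  qed
  obtain a where a: "f = (\<lambda>y. \<Sum>\<alpha>\<in>expos d. mon \<alpha> y *\<^sub>R a \<alpha>)" using assms(1) by (elim polE)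
  have "(\<lambda>y. \<Sum>\<alpha>\<in>A. mon \<alpha> y *\<^sub>R a \<alpha>) \<in> pol d \<and> P d (\<lambda>y. \<Sum>\<alpha>\<in>A. mon \<alpha> y *\<^sub>R a \<alpha>)"
    if "finite A" "A \<subseteq> expos d" for A
    using that
  proof (induction A)
    case empty
    then show ?case using zero pol_zero by simp
  next
    case (insert \<alpha> A)
    then show ?case by (auto intro!: add mon pol_mon pol_add)
  qed
  from this[OF finite_expos subset_refl] show ?thesis by (simp only: a)
qed

text \<open>
  Multiplication by the sum of the coordinates, which is 1, raises the degree.
\<close>

lemma pol_Suc_mono: "f \<in> pol d \<Longrightarrow> f \<in> pol (Suc d)"
proof -
  assume "f \<in> pol d"
  then have "(\<lambda>y. \<Sum>i\<in>UNIV. bary i y *\<^sub>R f y) \<in> pol (Suc d)"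
    by (intro pol_sum pol_bary_mult)
  then show ?thesis by (simp add: sum_bary flip: scaleR_left.sum)
qed

lemma pol_mono: "f \<in> pol d \<Longrightarrow> d \<le> e \<Longrightarrow> f \<in> pol e"
  by (induction e) (auto simp: le_Suc_eq intro: pol_Suc_mono)

lemma pol_scaleR_mult:
  assumes "f \<in> pol a" "g \<in> pol b"
  shows "(\<lambda>y. f y *\<^sub>R g y) \<in> pol (a + b)"
  using assms
proof (induction rule: pol_induct)
  case (add d f g)
  then show ?case by (auto simp: scaleR_add_left intro: pol_add)
next
  case (bary d i f)
  then show ?case using pol_bary_mult[of "\<lambda>y. f y *\<^sub>R g y" "d + b" i] by simp
qed (auto intro: pol_scaleR pol_zero)

lemma pol_mult: "f \<in> pol a \<Longrightarrow> g \<in> pol b \<Longrightarrow> (\<lambda>y. f y * g y) \<in> pol (a + b)" for g :: "_ \<Rightarrow> real"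
  using pol_scaleR_mult[of f a g b] by simp

lemma pol_bary_power: "(\<lambda>y. bary i y ^ k) \<in> pol k"
proof (induction k)
  case 0
  then show ?case using pol_const by simp
next
  case (Suc k)
  then show ?case using pol_bary_mult[of "\<lambda>y. bary i y ^ k" k i] by simp
qed

lemma pol_bary_power_mult: "f \<in> pol d \<Longrightarrow> (\<lambda>y. bary i y ^ k *\<^sub>R f y) \<in> pol (k + d)"
  by (rule pol_scaleR_mult[OF pol_bary_power])

lemma pol_affine: "(\<lambda>y. c + v \<bullet> y) \<in> pol 1" for c :: real
proof -
  have "(\<lambda>y. \<Sum>i\<in>UNIV. bary i y *\<^sub>R (c + v \<bullet> x i)) \<in> pol (Suc 0)"
    by (intro pol_sum pol_bary_mult pol_const)
  moreover have "(\<Sum>i\<in>UNIV. bary i y *\<^sub>R (c + v \<bullet> x i)) = c + v \<bullet> y" for y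
  proof -
    have "v \<bullet> y = v \<bullet> (\<Sum>i\<in>UNIV. bary i y *\<^sub>R x i)" by (simp only: sum_bary_x)
    then show ?thesis
      by (simp add: distrib_left sum.distrib inner_sum_right sum_bary flip: sum_distrib_right)
  qed
  ultimately show ?thesis by simp
qed

lemma pol_component_iff: "f \<in> pol d \<longleftrightarrow> (\<forall>i. (\<lambda>y. f y $ i) \<in> pol d)" for f :: "real ^ 3 \<Rightarrow> real ^ 'n"
proof
  have "linear (\<lambda>w :: real ^ 'n. w $ i)" for i by (rule linearI) auto
  then show "f \<in> pol d \<Longrightarrow> \<forall>i. (\<lambda>y. f y $ i) \<in> pol d"
    using pol_linear_image by blast
next
  assume *: "\<forall>i. (\<lambda>y. f y $ i) \<in> pol d"
  have "linear (\<lambda>c :: real. c *\<^sub>R (axis i 1 :: real ^ 'n))" for i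
    by (rule linearI) (auto simp: algebra_simps)
  then have "(\<lambda>y. (f y $ i) *\<^sub>R (axis i 1 :: real ^ 'n)) \<in> pol d" for i
    using pol_linear_image[where f = "\<lambda>y. f y $ i"] * by blast
  then have "(\<lambda>y. \<Sum>i\<in>UNIV. (f y $ i) *\<^sub>R (axis i 1 :: real ^ 'n)) \<in> pol d"
    by (intro pol_sum)
  moreover have "(\<Sum>i\<in>UNIV. (f y $ i) *\<^sub>R (axis i 1 :: real ^ 'n)) = f y" for y
    using basis_expansion[of "f y"] by (simp add: scalar_mult_eq_scaleR)
  ultimately show "f \<in> pol d" by simp
qed

lemma pol_inner: "f \<in> pol a \<Longrightarrow> (\<lambda>y. v \<bullet> f y) \<in> pol a"
  by (rule pol_linear_image[where L = "\<lambda>w. v \<bullet> w"]) (auto intro: linearI simp: inner_add_right)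

lemma pol_cross: "f \<in> pol a \<Longrightarrow> (\<lambda>y. cross3 v (f y)) \<in> pol a"
  by (rule pol_linear_image[where L = "\<lambda>w. cross3 v w"])
     (auto intro: linearI simp: cross_add_right cross_mult_right)

lemma pol_on_line: "f \<in> pol d \<Longrightarrow> \<exists>p. \<forall>t. f (y + t *\<^sub>R v) = poly p t" for f :: "real ^ 3 \<Rightarrow> real"
proof (induction rule: pol_induct)
  case (const c)
  show ?case by (rule exI[of _ "[:c:]"]) simp
next
  case (zero d)
  show ?case by (rule exI[of _ 0]) simp
next
  case (add d f g)
  then obtain p q where "\<forall>t. f (y + t *\<^sub>R v) = poly p t" "\<forall>t. g (y + t *\<^sub>R v) = poly q t" by auto
  then show ?case by (intro exI[of _ "p + q"]) simp
next
  case (bary d i f)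
  then obtain p where "\<forall>t. f (y + t *\<^sub>R v) = poly p t" by auto
  then show ?case by (intro exI[of _ "[:bary i y, grad_bary i \<bullet> v:] * p"]) (simp add: bary_add algebra_simps)
qed

lemma pol_zero_on_line_real:
  fixes f :: "real ^ 3 \<Rightarrow> real"
  assumes "f \<in> pol d" "infinite {t. f (y + t *\<^sub>R v) = 0}"
  shows "f (y + t *\<^sub>R v) = 0"
proof -
  obtain p where p: "\<forall>t. f (y + t *\<^sub>R v) = poly p t" using pol_on_line[OF assms(1)] by blast
  then have "p = 0" using assms(2) poly_roots_finite[of p] by auto
  then show ?thesis using p by simp
qed

lemma pol_zero_on_line:
  fixes f :: "real ^ 3 \<Rightarrow> 'b::real_inner"
  assumes "f \<in> pol d" "infinite {t. f (y + t *\<^sub>R v) = 0}"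
  shows "f (y + t *\<^sub>R v) = 0"
proof -
  have "w \<bullet> f (y + t *\<^sub>R v) = 0" for w
    by (rule pol_zero_on_line_real[OF pol_inner[OF assms(1)]])
       (rule infinite_super[OF _ assms(2)], auto)
  then show ?thesis by (metis inner_eq_zero_iff)
qed

text \<open>
  On a line a polynomial has only finitely many zeros or vanishes. This is the tool by which
  every identity known on a small set is extended: on an open set, on a piece of an interface,
  or off a face.
\<close>

lemma pol_zero_from_segment:
  fixes f :: "real ^ 3 \<Rightarrow> 'b::real_inner"
  assumes "f \<in> pol d" "0 < e" "\<And>t. 0 < t \<Longrightarrow> t < e \<Longrightarrow> f (y0 + t *\<^sub>R (y - y0)) = 0"
  shows "f y = 0"
proof -
  have "infinite {t. f (y0 + t *\<^sub>R (y - y0)) = 0}"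
    by (rule infinite_super[of "{0<..<e}"]) (use assms in auto)
  from pol_zero_on_line[OF assms(1) this, of 1] show ?thesis by simp
qed

end

section \<open>Bernstein coefficients and divisibility\<close>

lemma base_digits_unique:
  fixes N a b m n :: nat
  assumes "a + N * m = b + N * n" "a < N" "b < N"
  shows "a = b \<and> m = n"
proof -
  have "N > 0" using assms(2) by simp
  then show ?thesis
    using arg_cong[OF assms(1), of "\<lambda>k. k mod N"] arg_cong[OF assms(1), of "\<lambda>k. k div N"] assms(2,3)
    by simp
qed

text \<open>
  Kronecker substitution: with the powers \<open>u ^ e i\<close> for \<open>t i\<close>,
  different exponents give different powers of the single variable \<open>u\<close>, because
  the exponents are digits to a base \<open>N\<close> larger than all of them.
\<close>

lemma coeffs_zero_if_zero_on_orthant: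
  fixes a :: "(4 \<Rightarrow> nat) \<Rightarrow> real"
  assumes "finite A" and zero: "\<And>t. (\<And>i. 0 < t i) \<Longrightarrow> (\<Sum>\<alpha>\<in>A. (\<Prod>i\<in>UNIV. t i ^ \<alpha> i) * a \<alpha>) = 0"
    and "\<beta> \<in> A"
  shows "a \<beta> = 0"
proof -
  define N where "N = Suc (Max ((\<lambda>\<alpha>. Max (range \<alpha>)) ` A))"
  have N: "\<alpha> i < N" if "\<alpha> \<in> A" for \<alpha> i
  proof -
    have "\<alpha> i \<le> Max (range \<alpha>)" by simp
    also have "\<dots> \<le> Max ((\<lambda>\<alpha>. Max (range \<alpha>)) ` A)" using that assms(1) by simp
    finally show ?thesis by (simp add: N_def)
  qed
  \<comment> \<open>the exponent of \<open>u\<close> after the substitution\<close>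
  define code where "code \<alpha> = \<alpha> 1 + N * (\<alpha> 2 + N * (\<alpha> 3 + N * \<alpha> 4))" for \<alpha> :: "4 \<Rightarrow> nat"
  define e :: "4 \<Rightarrow> nat" where "e i = (if i = 1 then 1 else if i = 2 then N else if i = 3 then N * N else N * N * N)" for i
  have inj: "\<alpha> = \<alpha>'" if "\<alpha> \<in> A" "\<alpha>' \<in> A" "code \<alpha> = code \<alpha>'" for \<alpha> \<alpha>'
  proof -
    have "\<alpha> 1 = \<alpha>' 1 \<and> \<alpha> 2 + N * (\<alpha> 3 + N * \<alpha> 4) = \<alpha>' 2 + N * (\<alpha>' 3 + N * \<alpha>' 4)"
      using that N unfolding code_def by (intro base_digits_unique) auto
    moreover from this have "\<alpha> 2 = \<alpha>' 2 \<and> \<alpha> 3 + N * \<alpha> 4 = \<alpha>' 3 + N * \<alpha>' 4"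
      using that N by (intro base_digits_unique) auto
    moreover from this have "\<alpha> 3 = \<alpha>' 3 \<and> \<alpha> 4 = \<alpha>' 4"
      using that N by (intro base_digits_unique) auto
    ultimately have "\<forall>i. \<alpha> i = \<alpha>' i" by (simp add: forall_4)
    then show ?thesis by auto
  qed
  have code: "(\<Prod>i\<in>UNIV. (u ^ e i) ^ \<alpha> i) = u ^ code \<alpha>" for u :: real and \<alpha>
  proof -
    have e: "e 1 = 1" "e 2 = N" "e 3 = N * N" "e 4 = N * N * N" by (simp_all add: e_def)
    have "(\<Sum>i\<in>UNIV. e i * \<alpha> i) = code \<alpha>" by (simp only: sum_4 e code_def) (simp add: algebra_simps)
    moreover have "(\<Prod>i\<in>UNIV. (u ^ e i) ^ \<alpha> i) = u ^ (\<Sum>i\<in>UNIV. e i * \<alpha> i)"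
      by (simp only: power_sum power_mult)
    ultimately show ?thesis by simp
  qed
  define p where "p = (\<Sum>\<alpha>\<in>A. monom (a \<alpha>) (code \<alpha>))"
  have "poly p u = 0" if "0 < u" for u
    using zero[of "\<lambda>i. u ^ e i"] that by (simp add: p_def poly_sum poly_monom code mult.commute)
  then have "{0<..} \<subseteq> {u. poly p u = 0}" by auto
  then have "p = 0" using poly_roots_finite[of p] infinite_Ioi[of "0::real"] finite_subset by blast
  moreover have "coeff p (code \<beta>) = (\<Sum>\<alpha>\<in>A. if \<alpha> = \<beta> then a \<beta> else 0)"
    unfolding p_def coeff_sum coeff_monom using inj assms(3) by (intro sum.cong) auto
  ultimately show ?thesis using assms(1,3) by simp
qed

context tetrahedron
begin

text \<open>
  A polynomial that vanishes on the relative interior of the subsimplex with vertex set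
  \<open>J\<close> has no Bernstein coefficients supported in \<open>J\<close>. By homogeneity
  the condition that coordinates add up to 1 can be dropped. For \<open>J = UNIV\<close> this
  is uniqueness of the Bernstein form.
\<close>

lemma bernstein_coeff_zero:
  fixes a :: "(4 \<Rightarrow> nat) \<Rightarrow> 'b::real_inner"
  assumes "J \<noteq> {}"
    and zero: "\<And>y. (\<And>i. i \<notin> J \<Longrightarrow> bary i y = 0) \<Longrightarrow> (\<And>i. i \<in> J \<Longrightarrow> 0 < bary i y) \<Longrightarrow>
                 (\<Sum>\<alpha>\<in>expos d. mon \<alpha> y *\<^sub>R a \<alpha>) = 0"
    and \<beta>: "\<beta> \<in> expos d" "\<And>i. i \<notin> J \<Longrightarrow> \<beta> i = 0"
  shows "a \<beta> = 0"
proof -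
  let ?A = "{\<alpha> \<in> expos d. \<forall>i. i \<notin> J \<longrightarrow> \<alpha> i = 0}"
  have "w \<bullet> a \<beta> = 0" for w
  proof (rule coeffs_zero_if_zero_on_orthant[where A = ?A and a = "\<lambda>\<alpha>. w \<bullet> a \<alpha>"])
    fix t :: "4 \<Rightarrow> real" assume t: "\<And>i. 0 < t i"
    \<comment> \<open>the point with barycentric coordinates proportional to \<open>t\<close> on \<open>J\<close>\<close>
    define s where "s i = (if i \<in> J then t i else 0)" for i
    define T where "T = (\<Sum>i\<in>UNIV. s i)"
    have T: "0 < T"
    proof -
      obtain j where "j \<in> J" using assms(1) by auto
      then show ?thesis unfolding T_def using t
        by (intro sum_pos2[of _ j]) (auto simp: s_def less_imp_le)
    qed
    define y where "y = (\<Sum>i\<in>UNIV. (s i / T) *\<^sub>R x i)"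
    have bary: "bary i y = s i / T" for i
      unfolding y_def using T by (intro bary_combination) (simp add: T_def flip: sum_divide_distrib)
    have mon: "mon \<alpha> y = (\<Prod>i\<in>UNIV. s i ^ \<alpha> i) / T ^ d" if "\<alpha> \<in> expos d" for \<alpha>
    proof -
      have "mon \<alpha> y = (\<Prod>i\<in>UNIV. s i ^ \<alpha> i) / (\<Prod>i\<in>UNIV. T ^ \<alpha> i)"
        by (simp add: mon_def bary power_divide prod_dividef)
      also have "(\<Prod>i\<in>UNIV. T ^ \<alpha> i) = T ^ d" using that by (simp add: expos_def flip: power_sum)
      finally show ?thesis .
    qed
    have "0 = T ^ d * (w \<bullet> (\<Sum>\<alpha>\<in>expos d. mon \<alpha> y *\<^sub>R a \<alpha>))"
      using zero[of y] t T by (simp add: bary s_def)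
    also have "\<dots> = (\<Sum>\<alpha>\<in>expos d. (\<Prod>i\<in>UNIV. s i ^ \<alpha> i) * (w \<bullet> a \<alpha>))"
      using T by (simp add: inner_sum_right sum_distrib_left mon)
    also have "\<dots> = (\<Sum>\<alpha>\<in>?A. (\<Prod>i\<in>UNIV. s i ^ \<alpha> i) * (w \<bullet> a \<alpha>))"
    proof (rule sum.mono_neutral_right)
      show "\<forall>\<alpha>\<in>expos d - ?A. (\<Prod>i\<in>UNIV. s i ^ \<alpha> i) * (w \<bullet> a \<alpha>) = 0"
      proof
        fix \<alpha> assume "\<alpha> \<in> expos d - ?A"
        then obtain i where "i \<notin> J" "\<alpha> i \<noteq> 0" by blast
        then have "(\<Prod>i\<in>UNIV. s i ^ \<alpha> i) = 0" by (intro prod_zero) (auto simp: s_def)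
        then show "(\<Prod>i\<in>UNIV. s i ^ \<alpha> i) * (w \<bullet> a \<alpha>) = 0" by simp
      qed
    qed auto
    also have "\<dots> = (\<Sum>\<alpha>\<in>?A. (\<Prod>i\<in>UNIV. t i ^ \<alpha> i) * (w \<bullet> a \<alpha>))"
    proof (rule sum.cong[OF refl])
      fix \<alpha> assume "\<alpha> \<in> ?A"
      then have "(\<Prod>i\<in>UNIV. s i ^ \<alpha> i) = (\<Prod>i\<in>UNIV. t i ^ \<alpha> i)"
        by (intro prod.cong) (auto simp: s_def)
      then show "(\<Prod>i\<in>UNIV. s i ^ \<alpha> i) * (w \<bullet> a \<alpha>) = (\<Prod>i\<in>UNIV. t i ^ \<alpha> i) * (w \<bullet> a \<alpha>)" by simp
    qed
    finally show "(\<Sum>\<alpha>\<in>?A. (\<Prod>i\<in>UNIV. t i ^ \<alpha> i) * (w \<bullet> a \<alpha>)) = 0" by simp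
  qed (use \<beta> in auto)
  from this[of "a \<beta>"] show ?thesis by simp
qed

text \<open>
  If only exponents with \<open>\<alpha> i > 0\<close> occur, a factor \<open>bary i\<close>
  splits off termwise.
\<close>

lemma pol_factor:
  assumes "\<And>\<alpha>. \<alpha> \<in> expos (Suc d) \<Longrightarrow> \<alpha> i = 0 \<Longrightarrow> a \<alpha> = 0"
  obtains q where "q \<in> pol d" "\<And>y. (\<Sum>\<alpha>\<in>expos (Suc d). mon \<alpha> y *\<^sub>R a \<alpha>) = bary i y *\<^sub>R q y"
proof -
  define q where "q = (\<lambda>y. \<Sum>\<alpha>\<in>{\<alpha> \<in> expos (Suc d). 0 < \<alpha> i}. mon (\<alpha>(i := \<alpha> i - 1)) y *\<^sub>R a \<alpha>)"
  have down: "\<alpha>(i := \<alpha> i - 1) \<in> expos d" "mon \<alpha> y = bary i y * mon (\<alpha>(i := \<alpha> i - 1)) y"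
    if "\<alpha> \<in> expos (Suc d)" "0 < \<alpha> i" for \<alpha> y
  proof -
    let ?\<beta> = "\<alpha>(i := \<alpha> i - 1)"
    have eq: "\<alpha> = ?\<beta>(i := Suc (?\<beta> i))" using that by auto
    show "?\<beta> \<in> expos d" using that(1) eq expos_Suc_upd[of ?\<beta> i d] by simp
    show "mon \<alpha> y = bary i y * mon ?\<beta> y" by (subst eq) (rule mon_Suc)
  qed
  have "(\<Sum>\<alpha>\<in>expos (Suc d). mon \<alpha> y *\<^sub>R a \<alpha>) = (\<Sum>\<alpha>\<in>{\<alpha> \<in> expos (Suc d). 0 < \<alpha> i}. mon \<alpha> y *\<^sub>R a \<alpha>)" for y
    by (rule sum.mono_neutral_right) (use assms in auto)
  also have "\<dots> y = bary i y *\<^sub>R q y" for y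
    unfolding q_def scaleR_right.sum by (rule sum.cong) (auto simp: down(2))
  finally have "(\<Sum>\<alpha>\<in>expos (Suc d). mon \<alpha> y *\<^sub>R a \<alpha>) = bary i y *\<^sub>R q y" for y .
  moreover have "q \<in> pol d" unfolding q_def by (intro pol_sum pol_mon down) auto
  ultimately show thesis using that by blast
qed

lemma UNIV_minus_nonempty: "UNIV - {i} \<noteq> {}" "UNIV - {i, j} \<noteq> {}" for i j :: 4
proof -
  have "card {i, j} \<le> 2" by (simp add: card_insert_if)
  then have "{i, j} \<noteq> UNIV" by auto
  then show "UNIV - {i, j} \<noteq> {}" "UNIV - {i} \<noteq> {}" by auto
qed

lemma pol_divisible:
  fixes f :: "real ^ 3 \<Rightarrow> 'b::real_inner"
  assumes "f \<in> pol (Suc d)" "\<And>y. bary i y = 0 \<Longrightarrow> f y = 0"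
  obtains q where "q \<in> pol d" "f = (\<lambda>y. bary i y *\<^sub>R q y)"
proof -
  obtain a where a: "f = (\<lambda>y. \<Sum>\<alpha>\<in>expos (Suc d). mon \<alpha> y *\<^sub>R a \<alpha>)" using assms(1) by (elim polE)
  have "a \<alpha> = 0" if "\<alpha> \<in> expos (Suc d)" "\<alpha> i = 0" for \<alpha>
    by (rule bernstein_coeff_zero[where J = "UNIV - {i}" and d = "Suc d"]) (use that assms(2) a UNIV_minus_nonempty in auto)
  then show thesis using that by (elim pol_factor[of d i a]) (auto simp: a)
qed

lemma pol_divisible_family:
  fixes P :: "4 \<Rightarrow> real ^ 3 \<Rightarrow> 'b::real_inner"
  assumes "\<And>i. P i \<in> pol (Suc d)" "\<And>i y. bary i y = 0 \<Longrightarrow> P i y = 0"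
  obtains Q where "\<And>i. Q i \<in> pol d" "\<And>i. P i = (\<lambda>y. bary i y *\<^sub>R Q i y)"
proof -
  have "\<forall>i. \<exists>q. q \<in> pol d \<and> P i = (\<lambda>y. bary i y *\<^sub>R q y)"
  proof
    fix i
    obtain q where "q \<in> pol d" "P i = (\<lambda>y. bary i y *\<^sub>R q y)" using pol_divisible[OF assms] by blast
    then show "\<exists>q. q \<in> pol d \<and> P i = (\<lambda>y. bary i y *\<^sub>R q y)" by blast
  qed
  then show thesis
    using that choice[of "\<lambda>i q. q \<in> pol d \<and> P i = (\<lambda>y. bary i y *\<^sub>R q y)"] by blast
qed

end

section \<open>Cartesian monomials\<close>

definition deg_le_exponents :: "nat \<Rightarrow> (nat ^ 3) set" where
  "deg_le_exponents d = {\<alpha>. (\<Sum>i\<in>UNIV. \<alpha> $ i) \<le> d}"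

definition cart_mon :: "nat ^ 3 \<Rightarrow> real ^ 3 \<Rightarrow> real" where
  "cart_mon \<alpha> y = (\<Prod>i\<in>UNIV. (y $ i) ^ (\<alpha> $ i))"

definition cart_pol :: "nat \<Rightarrow> (real ^ 3 \<Rightarrow> real) set" where
  "cart_pol d = {f. \<exists>c. f = (\<lambda>y. \<Sum>\<alpha>\<in>deg_le_exponents d. c \<alpha> * cart_mon \<alpha> y)}"

lemma finite_deg_le_exponents: "finite (deg_le_exponents d)"
proof (rule finite_subset)
  show "deg_le_exponents d \<subseteq> vec_lambda ` (PiE UNIV (\<lambda>_. {..d}))"
  proof
    fix \<alpha> :: "nat ^ 3" assume "\<alpha> \<in> deg_le_exponents d"
    then have "\<alpha> $ i \<le> d" for i
      using member_le_sum[of i UNIV "\<lambda>i. \<alpha> $ i"] by (simp add: deg_le_exponents_def)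
    then have "vec_nth \<alpha> \<in> PiE UNIV (\<lambda>_. {..d})" by auto
    then show "\<alpha> \<in> vec_lambda ` (PiE UNIV (\<lambda>_. {..d}))" by (metis image_eqI vec_nth_inverse)
  qed
qed (simp add: finite_PiE)

lemma cart_pol_mon: "\<alpha> \<in> deg_le_exponents d \<Longrightarrow> (\<lambda>y. c * cart_mon \<alpha> y) \<in> cart_pol d"
  unfolding cart_pol_def
  by (intro CollectI exI[of _ "\<lambda>\<beta>. if \<beta> = \<alpha> then c else 0"])
     (simp add: finite_deg_le_exponents if_distrib[of "\<lambda>a. a * _"] cong: if_cong)

lemma cart_pol_add: "f \<in> cart_pol d \<Longrightarrow> g \<in> cart_pol d \<Longrightarrow> (\<lambda>y. f y + g y) \<in> cart_pol d"
proof -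
  assume "f \<in> cart_pol d" "g \<in> cart_pol d"
  then obtain a b where "f = (\<lambda>y. \<Sum>\<alpha>\<in>deg_le_exponents d. a \<alpha> * cart_mon \<alpha> y)" "g = (\<lambda>y. \<Sum>\<alpha>\<in>deg_le_exponents d. b \<alpha> * cart_mon \<alpha> y)"
    by (auto simp: cart_pol_def)
  then show ?thesis unfolding cart_pol_def
    by (intro CollectI exI[of _ "\<lambda>\<alpha>. a \<alpha> + b \<alpha>"]) (simp add: distrib_right sum.distrib)
qed

lemma cart_pol_zero: "(\<lambda>y. 0) \<in> cart_pol d"
  unfolding cart_pol_def by (intro CollectI exI[of _ "\<lambda>_. 0"]) simp

lemma cart_pol_sum: "(\<And>i. i \<in> I \<Longrightarrow> f i \<in> cart_pol d) \<Longrightarrow> (\<lambda>y. \<Sum>i\<in>I. f i y) \<in> cart_pol d"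
  by (induction I rule: infinite_finite_induct) (auto intro: cart_pol_add cart_pol_zero)

lemma cart_pol_scale: "f \<in> cart_pol d \<Longrightarrow> (\<lambda>y. b * f y) \<in> cart_pol d"
  unfolding cart_pol_def by (clarify, rule_tac x = "\<lambda>\<alpha>. b * c \<alpha>" in exI) (simp add: sum_distrib_left mult.assoc)

lemma cart_pol_Suc_mono: "f \<in> cart_pol d \<Longrightarrow> f \<in> cart_pol (Suc d)"
proof -
  assume "f \<in> cart_pol d"
  then obtain a where "f = (\<lambda>y. \<Sum>\<alpha>\<in>deg_le_exponents d. a \<alpha> * cart_mon \<alpha> y)"
    by (auto simp: cart_pol_def)
  then show ?thesis by (simp only:) (intro cart_pol_sum cart_pol_mon, simp add: deg_le_exponents_def)
qed

lemma cart_pol_coordinate_mult: "f \<in> cart_pol d \<Longrightarrow> (\<lambda>y. y $ j * f y) \<in> cart_pol (Suc d)"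
proof -
  assume "f \<in> cart_pol d"
  then obtain a where a: "f = (\<lambda>y. \<Sum>\<alpha>\<in>deg_le_exponents d. a \<alpha> * cart_mon \<alpha> y)"
    by (auto simp: cart_pol_def)
  have mon: "y $ j * cart_mon \<alpha> y = cart_mon (\<alpha> + axis j 1) y" for y \<alpha>
  proof -
    have rem: "cart_mon \<beta> y = (y $ j) ^ (\<beta> $ j) * (\<Prod>i\<in>UNIV - {j}. (y $ i) ^ (\<beta> $ i))" for \<beta>
      unfolding cart_mon_def by (rule prod.remove) auto
    show ?thesis by (simp add: rem axis_def)
  qed
  have "(\<Sum>i\<in>UNIV. (axis j (1::nat)) $ i) = 1" for j :: 3 by (simp add: axis_def)
  then have mem: "\<alpha> \<in> deg_le_exponents d \<Longrightarrow> \<alpha> + axis j 1 \<in> deg_le_exponents (Suc d)" for \<alpha>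
    by (simp add: deg_le_exponents_def sum.distrib)
  have "(\<lambda>y. \<Sum>\<alpha>\<in>deg_le_exponents d. a \<alpha> * cart_mon (\<alpha> + axis j 1) y) \<in> cart_pol (Suc d)"
    by (intro cart_pol_sum cart_pol_mon mem)
  moreover have "y $ j * f y = (\<Sum>\<alpha>\<in>deg_le_exponents d. a \<alpha> * cart_mon (\<alpha> + axis j 1) y)" for y
    by (simp add: a sum_distrib_left mult.left_commute mon del: One_nat_def)
  ultimately show ?thesis by simp
qed

lemma inner_coordinates: "v \<bullet> y = (\<Sum>j\<in>UNIV. v $ j * y $ j)" for v y :: "real ^ 3"
  by (simp add: inner_vec_def)

context tetrahedron
begin

lemma pol_prod:
  "finite I \<Longrightarrow> (\<And>i. i \<in> I \<Longrightarrow> f i \<in> pol (e i)) \<Longrightarrow> (\<lambda>y. \<Prod>i\<in>I. f i y :: real) \<in> pol (\<Sum>i\<in>I. e i)"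
  by (induction I rule: finite_induct) (auto intro: pol_mult pol_const)

lemma pol_coordinate_power: "(\<lambda>y. (y $ j) ^ k) \<in> pol k"
proof -
  have 1: "(\<lambda>y. y $ j) \<in> pol 1"
    using pol_affine[of 0 "axis j 1"] by (simp add: inner_axis_axis inner_commute[of "axis j 1"] inner_axis)
  have "(\<lambda>y. \<Prod>i<k. y $ j) \<in> pol (\<Sum>i<k. 1)"
    by (intro pol_prod 1) auto
  then show ?thesis by simp
qed

text \<open>
  Both spaces are closed under the operations that build the other: monomials in the
  coordinates are products of affine functions, and multiplying by \<open>bary i\<close>
  raises the Cartesian degree by one.
\<close>

lemma pol_eq_cart_pol: "pol d = cart_pol d"
proof
  show "cart_pol d \<subseteq> pol d"
  proof
    fix f assume "f \<in> cart_pol d"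
    then obtain a where a: "f = (\<lambda>y. \<Sum>\<alpha>\<in>deg_le_exponents d. a \<alpha> * cart_mon \<alpha> y)"
      by (auto simp: cart_pol_def)
    have "cart_mon \<alpha> \<in> pol d" if "\<alpha> \<in> deg_le_exponents d" for \<alpha>
    proof -
      have "(\<lambda>y. \<Prod>i\<in>UNIV. (y $ i) ^ (\<alpha> $ i)) \<in> pol (\<Sum>i\<in>UNIV. \<alpha> $ i)"
        by (intro pol_prod pol_coordinate_power) auto
      then show ?thesis using that
        by (auto simp: deg_le_exponents_def cart_mon_def[abs_def] intro: pol_mono)
    qed
    then show "f \<in> pol d" unfolding a by (intro pol_sum pol_mult_const)
  qed
  show "pol d \<subseteq> cart_pol d"
  proof
    fix f :: "real ^ 3 \<Rightarrow> real" assume "f \<in> pol d"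
    then show "f \<in> cart_pol d"
    proof (induction rule: pol_induct)
      case (const c)
      have "(\<lambda>y. c * cart_mon 0 y) \<in> cart_pol 0" by (rule cart_pol_mon) (simp add: deg_le_exponents_def)
      then show ?case by (simp add: cart_mon_def)
    next
      case (bary d i f)
      define b where "b = (if i = 0 then 1 else 0) - grad_bary i \<bullet> x 0"
      have "(\<lambda>y. b * f y + (\<Sum>j\<in>UNIV. grad_bary i $ j * (y $ j * f y))) \<in> cart_pol (Suc d)"
        by (intro cart_pol_add cart_pol_sum cart_pol_scale cart_pol_coordinate_mult cart_pol_Suc_mono bary)
      moreover have "b * f y + (\<Sum>j\<in>UNIV. grad_bary i $ j * (y $ j * f y)) = bary i y * f y" for y
        by (simp add: b_def bary_def inner_diff_right distrib_right inner_coordinates[of "grad_bary i" y] sum_distrib_left sum_distrib_right algebra_simps)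
      ultimately show ?case by simp
    qed (auto intro: cart_pol_add cart_pol_zero)
  qed
qed

lemma PolyOn_iff: "f \<in> PolyOn (int d) S \<longleftrightarrow> (\<forall>y. y \<notin> S \<longrightarrow> f y = 0) \<and> (\<exists>p\<in>pol d. \<forall>y\<in>S. f y = p y)"
proof -
  have "(\<lambda>y. \<Sum>\<alpha> | int (\<Sum>i\<in>UNIV. \<alpha> $ i) \<le> int d. c \<alpha> * (\<Prod>i\<in>UNIV. (y $ i) ^ (\<alpha> $ i))) =
        (\<lambda>y. \<Sum>\<alpha>\<in>deg_le_exponents d. c \<alpha> * cart_mon \<alpha> y)" for c
    by (simp only: deg_le_exponents_def cart_mon_def zle_int)
  then show ?thesis
    unfolding PolyOn_def pol_eq_cart_pol cart_pol_def by (auto simp: fun_eq_iff)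
qed

section \<open>Derivatives of polynomials\<close>

text \<open>
  Existence of the derivative, and the fact that it lowers the degree, proved together by
  induction. The last part is stated separately because \<open>d - 1\<close> is
  \<open>0\<close> for \<open>d = 0\<close>.
\<close>

lemma pol_deriv_aux:
  "f \<in> pol d \<Longrightarrow> \<exists>f'. (\<forall>y. (f has_derivative f' y) (at y)) \<and> (\<forall>v. (\<lambda>y. f' y v) \<in> pol (d - 1)) \<and> (d = 0 \<longrightarrow> f' = (\<lambda>y v. 0))"
proof (induction rule: pol_induct)
  case (const c)
  show ?case by (rule exI[of _ "\<lambda>y v. 0"]) (auto intro: pol_zero)
next
  case (zero d)
  show ?case by (rule exI[of _ "\<lambda>y v. 0"]) (auto intro: pol_zero)
next
  case (add d f g)
  obtain f' where "(\<forall>y. (f has_derivative f' y) (at y)) \<and> (\<forall>v. (\<lambda>y. f' y v) \<in> pol (d - 1)) \<and> (d = 0 \<longrightarrow> f' = (\<lambda>y v. 0))"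
    using add(3) by (rule exE)
  moreover obtain g' where "(\<forall>y. (g has_derivative g' y) (at y)) \<and> (\<forall>v. (\<lambda>y. g' y v) \<in> pol (d - 1)) \<and> (d = 0 \<longrightarrow> g' = (\<lambda>y v. 0))"
    using add(4) by (rule exE)
  ultimately show ?case by (intro exI[of _ "\<lambda>y v. f' y v + g' y v"]) (auto intro: has_derivative_add pol_add)
next
  case (bary d i f)
  obtain f' where F: "(\<forall>y. (f has_derivative f' y) (at y)) \<and> (\<forall>v. (\<lambda>y. f' y v) \<in> pol (d - 1)) \<and> (d = 0 \<longrightarrow> f' = (\<lambda>y v. 0))"
    using bary(2) by (rule exE)
  note f' = conjunct1[OF F] conjunct1[OF conjunct2[OF F]] conjunct2[OF conjunct2[OF F]]
  have "((\<lambda>y. bary i y *\<^sub>R f y) has_derivative (\<lambda>v. bary i y *\<^sub>R f' y v + (grad_bary i \<bullet> v) *\<^sub>R f y)) (at y)" for y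
    by (rule has_derivative_scaleR[OF bary_has_derivative]) (use f' in auto)
  moreover have "(\<lambda>y. bary i y *\<^sub>R f' y v + (grad_bary i \<bullet> v) *\<^sub>R f y) \<in> pol (Suc d - 1)" for v
  proof (cases d)
    case 0
    then show ?thesis using f'(3) bary(1) by (auto intro!: pol_scaleR)
  next
    case (Suc k)
    then have "(\<lambda>y. bary i y *\<^sub>R f' y v) \<in> pol d" using f'(2) by (auto intro!: pol_bary_mult)
    then show ?thesis using bary(1) by (auto intro!: pol_scaleR pol_add)
  qed
  ultimately show ?case by (intro exI[of _ "\<lambda>y v. bary i y *\<^sub>R f' y v + (grad_bary i \<bullet> v) *\<^sub>R f y"]) auto
qed

lemma pol_deriv:
  assumes "f \<in> pol d"
  shows "(f has_derivative frechet_derivative f (at y)) (at y)"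
    and "(\<lambda>y. frechet_derivative f (at y) v) \<in> pol (d - 1)"
    and "d = 0 \<Longrightarrow> frechet_derivative f (at y) v = 0"
proof -
  obtain f' where f': "(\<forall>y. (f has_derivative f' y) (at y)) \<and> (\<forall>v. (\<lambda>y. f' y v) \<in> pol (d - 1)) \<and> (d = 0 \<longrightarrow> f' = (\<lambda>y v. 0))"
    using pol_deriv_aux[OF assms] by (rule exE)
  then have eq: "frechet_derivative f (at y) = f' y" for y by (metis frechet_derivative_at)
  show "(f has_derivative frechet_derivative f (at y)) (at y)"
    "(\<lambda>y. frechet_derivative f (at y) v) \<in> pol (d - 1)"
    "d = 0 \<Longrightarrow> frechet_derivative f (at y) v = 0"
    using f' by (simp_all add: eq)
qed

lemma pol_continuous: "f \<in> pol d \<Longrightarrow> continuous_on S f"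
  by (intro continuous_at_imp_continuous_on ballI) (rule has_derivative_continuous[OF pol_deriv(1)])

lemma frechet_derivative_eq: "(f has_derivative f') (at y) \<Longrightarrow> frechet_derivative f (at y) = f'"
  by (metis frechet_derivative_at)

text \<open>
  Schwarz for polynomials: multiplication by an affine function preserves the symmetry.
\<close>

lemma pol_second_deriv_sym:
  assumes "f \<in> pol d"
  shows "frechet_derivative (\<lambda>y. frechet_derivative f (at y) u) (at y) v =
         frechet_derivative (\<lambda>y. frechet_derivative f (at y) v) (at y) u"
  using assms
proof (induction arbitrary: y u v rule: pol_induct)
  case (add d f g)
  have 1: "frechet_derivative (\<lambda>y. f y + g y) (at y) w = frechet_derivative f (at y) w + frechet_derivative g (at y) w" for w y
    using frechet_derivative_eq[OF has_derivative_add[OF pol_deriv(1)[OF add(1)] pol_deriv(1)[OF add(2)]]] by simp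
  have 2: "frechet_derivative (\<lambda>y. frechet_derivative f (at y) w + frechet_derivative g (at y) w) (at y) z =
     frechet_derivative (\<lambda>y. frechet_derivative f (at y) w) (at y) z + frechet_derivative (\<lambda>y. frechet_derivative g (at y) w) (at y) z" for w z y
    using frechet_derivative_eq[OF has_derivative_add[OF pol_deriv(1)[OF pol_deriv(2)[OF add(1)]] pol_deriv(1)[OF pol_deriv(2)[OF add(2)]]]] by simp
  show ?case by (simp add: 1 2 add.IH)
next
  case (bary d i f)
  have 1: "frechet_derivative (\<lambda>y. bary i y *\<^sub>R f y) (at y) w =
     bary i y *\<^sub>R frechet_derivative f (at y) w + (grad_bary i \<bullet> w) *\<^sub>R f y" for y w
    using frechet_derivative_eq[OF has_derivative_scaleR[OF bary_has_derivative pol_deriv(1)[OF bary(1)]]] by simp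
  have 2: "frechet_derivative (\<lambda>y. bary i y *\<^sub>R frechet_derivative f (at y) w + (grad_bary i \<bullet> w) *\<^sub>R f y) (at y) z =
     bary i y *\<^sub>R frechet_derivative (\<lambda>y. frechet_derivative f (at y) w) (at y) z +
     (grad_bary i \<bullet> z) *\<^sub>R frechet_derivative f (at y) w + (grad_bary i \<bullet> w) *\<^sub>R frechet_derivative f (at y) z" for y w z
    using frechet_derivative_eq[OF has_derivative_add[OF has_derivative_scaleR[OF bary_has_derivative pol_deriv(1)[OF pol_deriv(2)[OF bary(1)]]]
       has_derivative_scaleR_right[OF pol_deriv(1)[OF bary(1)]]]] by simp
  show ?case by (simp add: 1 2 bary.IH)
qed simp_all

end

section \<open>Divergence and curl\<close>

lemma pt_div_eq:
  assumes "(w has_derivative w') (at y)"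
  shows "pt_div w y = (\<Sum>j\<in>UNIV. axis j 1 \<bullet> w' (axis j 1))"
proof -
  have "frechet_derivative w (at y) = w'" using assms by (metis frechet_derivative_at)
  then show ?thesis
    by (simp add: pt_div_def jacobian_def matrix_def trace_def inner_axis inner_commute[of "axis _ _"])
qed

text \<open>
  Written with the operators \<open>axis j 1 \<bullet>\<close> and \<open>cross3 (axis j
  1)\<close> applied to partial derivatives, divergence and curl have the same product rule,
  and the divergence of a curl is an alternating sum.
\<close>

lemma pt_curl_eq:
  assumes "(w has_derivative w') (at y)"
  shows "pt_curl w y = (\<Sum>j\<in>UNIV. cross3 (axis j 1) (w' (axis j 1)))"
proof -
  have "frechet_derivative w (at y) = w'" using assms by (metis frechet_derivative_at)
  then show ?thesis
    by (simp add: pt_curl_def jacobian_def matrix_def Let_def sum_3 vec_eq_iff forall_3 cross3_simps axis_def)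
qed

lemma sum_axis_inner: "(\<Sum>j\<in>UNIV. (g \<bullet> axis j 1) *\<^sub>R axis j 1) = g" for g :: "real ^ 3"
  using basis_expansion[of g] by (simp add: inner_axis scalar_mult_eq_scaleR)

lemma pt_div_scaleR:
  assumes "(f has_derivative (\<lambda>v. g \<bullet> v)) (at y)" "(w has_derivative w') (at y)"
  shows "pt_div (\<lambda>y. f y *\<^sub>R w y) y = g \<bullet> w y + f y * pt_div w y"
proof -
  have "((\<lambda>y. f y *\<^sub>R w y) has_derivative (\<lambda>v. f y *\<^sub>R w' v + (g \<bullet> v) *\<^sub>R w y)) (at y)"
    by (rule has_derivative_scaleR[OF assms])
  then have "pt_div (\<lambda>y. f y *\<^sub>R w y) y = (\<Sum>j\<in>UNIV. axis j 1 \<bullet> (f y *\<^sub>R w' (axis j 1) + (g \<bullet> axis j 1) *\<^sub>R w y))"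
    by (rule pt_div_eq)
  also have "\<dots> = f y * (\<Sum>j\<in>UNIV. axis j 1 \<bullet> w' (axis j 1)) + (\<Sum>j\<in>UNIV. (g \<bullet> axis j 1) *\<^sub>R axis j 1) \<bullet> w y"
    by (simp add: inner_add_right sum.distrib sum_distrib_left inner_sum_left)
  finally show ?thesis by (simp add: pt_div_eq[OF assms(2)] sum_axis_inner)
qed

lemma pt_curl_scaleR:
  assumes "(f has_derivative (\<lambda>v. g \<bullet> v)) (at y)" "(w has_derivative w') (at y)"
  shows "pt_curl (\<lambda>y. f y *\<^sub>R w y) y = cross3 g (w y) + f y *\<^sub>R pt_curl w y"
proof -
  have "((\<lambda>y. f y *\<^sub>R w y) has_derivative (\<lambda>v. f y *\<^sub>R w' v + (g \<bullet> v) *\<^sub>R w y)) (at y)"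
    by (rule has_derivative_scaleR[OF assms])
  then have "pt_curl (\<lambda>y. f y *\<^sub>R w y) y = (\<Sum>j\<in>UNIV. cross3 (axis j 1) (f y *\<^sub>R w' (axis j 1) + (g \<bullet> axis j 1) *\<^sub>R w y))"
    by (rule pt_curl_eq)
  also have "\<dots> = f y *\<^sub>R (\<Sum>j\<in>UNIV. cross3 (axis j 1) (w' (axis j 1))) + cross3 (\<Sum>j\<in>UNIV. (g \<bullet> axis j 1) *\<^sub>R axis j 1) (w y)"
    by (simp add: sum_3 cross_add_right cross_add_left cross_mult_left cross_mult_right algebra_simps)
  finally show ?thesis by (simp add: pt_curl_eq[OF assms(2)] sum_axis_inner)
qed

context tetrahedron
begin

lemma pt_div_pol:
  assumes "w \<in> pol d"
  shows "pt_div w = (\<lambda>y. \<Sum>j\<in>UNIV. axis j 1 \<bullet> frechet_derivative w (at y) (axis j 1))"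
  using pt_div_eq[OF pol_deriv(1)[OF assms]] by auto

lemma pt_curl_pol:
  assumes "w \<in> pol d"
  shows "pt_curl w = (\<lambda>y. \<Sum>j\<in>UNIV. cross3 (axis j 1) (frechet_derivative w (at y) (axis j 1)))"
  using pt_curl_eq[OF pol_deriv(1)[OF assms]] by auto

lemma pol_pt_div: "w \<in> pol d \<Longrightarrow> pt_div w \<in> pol (d - 1)"
  by (simp only: pt_div_pol) (intro pol_sum pol_inner pol_deriv(2))

lemma pol_pt_curl: "w \<in> pol d \<Longrightarrow> pt_curl w \<in> pol (d - 1)"
  by (simp only: pt_curl_pol) (intro pol_sum pol_cross pol_deriv(2))

lemma pt_div_add:
  assumes "v \<in> pol d" "w \<in> pol e"
  shows "pt_div (\<lambda>y. v y + w y) y = pt_div v y + pt_div w y"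
  using pt_div_eq[OF has_derivative_add[OF pol_deriv(1)[OF assms(1), of y] pol_deriv(1)[OF assms(2)]]]
  by (simp add: pt_div_pol[OF assms(1)] pt_div_pol[OF assms(2)] inner_add_right sum.distrib)

lemma pt_div_diff:
  assumes "v \<in> pol d" "w \<in> pol e"
  shows "pt_div (\<lambda>y. v y - w y) y = pt_div v y - pt_div w y"
  using pt_div_eq[OF has_derivative_diff[OF pol_deriv(1)[OF assms(1), of y] pol_deriv(1)[OF assms(2)]]]
  by (simp add: pt_div_pol[OF assms(1)] pt_div_pol[OF assms(2)] inner_diff_right sum_subtractf)

lemma pt_curl_add:
  assumes "v \<in> pol d" "w \<in> pol e"
  shows "pt_curl (\<lambda>y. v y + w y) y = pt_curl v y + pt_curl w y"
  using pt_curl_eq[OF has_derivative_add[OF pol_deriv(1)[OF assms(1), of y] pol_deriv(1)[OF assms(2)]]]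
  by (simp add: pt_curl_pol[OF assms(1)] pt_curl_pol[OF assms(2)] cross_add_right sum.distrib)

lemma bary_power_has_derivative:
  "((\<lambda>y. bary i y ^ Suc k) has_derivative (\<lambda>v. (((1 + real k) * bary i y ^ k) *\<^sub>R grad_bary i) \<bullet> v)) (at y)"
  by (rule has_derivative_eq_rhs[OF has_derivative_power[OF bary_has_derivative]]) (auto simp: fun_eq_iff)

text \<open>
  The two leading-order formulas on which everything rests. To lowest order in \<open>bary
  i\<close> the divergence of \<open>bary i ^ Suc k *\<^sub>R w\<close> is \<open>bary i ^
  k\<close> times the inner product of \<open>w\<close> with a multiple of the gradient, and
  the curl is \<open>bary i ^ k\<close> times the cross product with it.
\<close>

lemma pt_div_bary_power:
  assumes "w \<in> pol d"
  shows "pt_div (\<lambda>y. bary i y ^ Suc k *\<^sub>R w y) y =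
         bary i y ^ k * ((1 + real k) * (grad_bary i \<bullet> w y) + bary i y * pt_div w y)"
  using pt_div_scaleR[OF bary_power_has_derivative pol_deriv(1)[OF assms], of i k y]
  by (simp add: algebra_simps)

lemma pt_curl_bary_power:
  assumes "w \<in> pol d"
  shows "pt_curl (\<lambda>y. bary i y ^ Suc k *\<^sub>R w y) y =
         bary i y ^ k *\<^sub>R ((1 + real k) *\<^sub>R cross3 (grad_bary i) (w y) + bary i y *\<^sub>R pt_curl w y)"
  using pt_curl_scaleR[OF bary_power_has_derivative pol_deriv(1)[OF assms], of i k y]
  by (simp add: algebra_simps cross_mult_left cross_add_left)

text \<open>
  Second derivatives are symmetric and the triple product is antisymmetric, so the double sum
  equals its negative.
\<close>

lemma pt_div_curl:
  assumes "w \<in> pol d"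
  shows "pt_div (pt_curl w) y = 0"
proof -
  let ?D = "\<lambda>j y. frechet_derivative w (at y) (axis j 1)"
  let ?DD = "\<lambda>j k. frechet_derivative (?D j) (at y) (axis k 1)"
  have lin: "bounded_linear (\<lambda>v. cross3 (axis j 1) v)" for j
    by (intro linear_conv_bounded_linear[THEN iffD1] linearI) (simp_all add: cross_add_right cross_mult_right)
  have "(pt_curl w has_derivative (\<lambda>v. \<Sum>j\<in>UNIV. cross3 (axis j 1) (frechet_derivative (?D j) (at y) v))) (at y)"
    unfolding pt_curl_pol[OF assms]
    by (intro has_derivative_sum bounded_linear.has_derivative[OF lin] pol_deriv(1)[OF pol_deriv(2)[OF assms]])
  then have eq: "pt_div (pt_curl w) y = (\<Sum>k\<in>UNIV. \<Sum>j\<in>UNIV. axis k 1 \<bullet> cross3 (axis j 1) (?DD j k))"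
    (is "_ = ?S") by (simp add: pt_div_eq inner_sum_right)
  have "?S = (\<Sum>k\<in>UNIV. \<Sum>j\<in>UNIV. - (axis j 1 \<bullet> cross3 (axis k 1) (?DD k j)))"
  proof (intro sum.cong refl)
    fix k j :: 3
    have anti: "u \<bullet> cross3 v a = - (v \<bullet> cross3 u a)" for u v a
      by (simp add: cross3_simps)
    show "axis k 1 \<bullet> cross3 (axis j 1) (?DD j k) = - (axis j 1 \<bullet> cross3 (axis k 1) (?DD k j))"
      using anti[of "axis k 1" "axis j 1" "?DD j k"] pol_second_deriv_sym[OF assms, of "axis j 1" y "axis k 1"]
      by simp
  qed
  also have "\<dots> = - (\<Sum>j\<in>UNIV. \<Sum>k\<in>UNIV. axis j 1 \<bullet> cross3 (axis k 1) (?DD k j))"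
    by (subst sum.swap) (simp add: sum_negf)
  finally show ?thesis unfolding eq by simp
qed

section \<open>Solving for the leading term\<close>

lemma pol_family_coeffs:
  assumes "\<And>i. P i \<in> pol d"
  obtains a where "\<And>i. P i = (\<lambda>y. \<Sum>\<alpha>\<in>expos d. mon \<alpha> y *\<^sub>R a i \<alpha>)"
proof -
  have "\<forall>i. \<exists>a. P i = (\<lambda>y. \<Sum>\<alpha>\<in>expos d. mon \<alpha> y *\<^sub>R a \<alpha>)" using assms by (auto simp: pol_def)
  then have "\<exists>a. \<forall>i. P i = (\<lambda>y. \<Sum>\<alpha>\<in>expos d. mon \<alpha> y *\<^sub>R a i \<alpha>)" by (rule choice)
  then show thesis using that by (elim exE) (rule that, erule spec)
qed

text \<open>
  One polynomial field \<open>w\<close> on all of the tetrahedron matches four given scalars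
  \<open>P i\<close> on the four faces at once. Coefficientwise this asks for \<open>W
  \<alpha>\<close> with given inner products with those gradients for which \<open>\<alpha> i
  = 0\<close>. Since the degree is positive some entry \<open>\<alpha> k\<close> is positive,
  so gradient \<open>k\<close> is not among them, and the others are linearly independent.
\<close>

lemma div_step:
  assumes "\<And>i. P i \<in> pol (Suc s)"
  obtains w Q where "w \<in> pol (Suc s)" "\<And>i. Q i \<in> pol s"
    "\<And>i y. P i y = grad_bary i \<bullet> w y + bary i y * Q i y"
proof -
  obtain a where a: "\<And>i. P i = (\<lambda>y. \<Sum>\<alpha>\<in>expos (Suc s). mon \<alpha> y *\<^sub>R a i \<alpha>)"
    using pol_family_coeffs[of P "Suc s", OF assms] by blast
  have "\<forall>\<alpha>. \<exists>k. \<alpha> \<in> expos (Suc s) \<longrightarrow> 0 < \<alpha> k" using expos_pos_entry by metis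
  then obtain \<kappa> where \<kappa>: "\<And>\<alpha>. \<alpha> \<in> expos (Suc s) \<Longrightarrow> 0 < \<alpha> (\<kappa> \<alpha>)" by metis
  \<comment> \<open>the base vertex \<open>\<kappa> \<alpha>\<close> is one with a positive exponent\<close>
  define W where "W \<alpha> = (\<Sum>j\<in>UNIV. a j \<alpha> *\<^sub>R (x j - x (\<kappa> \<alpha>)))" for \<alpha>
  have W: "grad_bary i \<bullet> W \<alpha> = a i \<alpha>" if "\<alpha> \<in> expos (Suc s)" "\<alpha> i = 0" for i \<alpha>
  proof -
    have "i \<noteq> \<kappa> \<alpha>" using \<kappa>[OF that(1)] that(2) by auto
    then show ?thesis
      unfolding W_def inner_sum_right inner_scaleR_right grad_bary_dual sum_delta_diff by simp
  qed
  define w where "w = (\<lambda>y. \<Sum>\<alpha>\<in>expos (Suc s). mon \<alpha> y *\<^sub>R W \<alpha>)"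
  have w: "w \<in> pol (Suc s)" unfolding w_def by (rule polI) simp
  have "\<exists>q\<in>pol s. \<forall>y. P i y = grad_bary i \<bullet> w y + bary i y * q y" for i
  proof -
    obtain q where q: "q \<in> pol s" "\<And>y. (\<Sum>\<alpha>\<in>expos (Suc s). mon \<alpha> y *\<^sub>R (a i \<alpha> - grad_bary i \<bullet> W \<alpha>)) = bary i y *\<^sub>R q y"
      by (rule pol_factor[of s i "\<lambda>\<alpha>. a i \<alpha> - grad_bary i \<bullet> W \<alpha>"]) (auto simp: W)
    have "P i y - grad_bary i \<bullet> w y = bary i y *\<^sub>R q y" for y
      using q(2)[of y] by (simp add: a w_def inner_sum_right right_diff_distrib sum_subtractf)
    then show ?thesis using q(1) by (intro bexI[of _ q]) (auto simp: algebra_simps)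
  qed
  then obtain Q where "\<And>i. Q i \<in> pol s" "\<And>i y. P i y = grad_bary i \<bullet> w y + bary i y * Q i y" by metis
  with w that show thesis by blast
qed

text \<open>
  In degree 0 all four gradients occur. They have the single linear relation that their sum is
  0, hence the condition on \<open>c\<close>.
\<close>

lemma grad_bary_inner_solve:
  assumes "(\<Sum>i\<in>UNIV. c i) = 0"
  shows "grad_bary i \<bullet> (\<Sum>j\<in>UNIV. c j *\<^sub>R (x j - x 0)) = c i"
  by (simp only: inner_sum_right inner_scaleR_right grad_bary_dual sum_delta_diff) (simp add: assms)

text \<open>
  The condition \<open>cross3 g\<^sub>i w = e\<^sub>i\<close> forces \<open>g\<^sub>i
  \<bullet> e\<^sub>i = 0\<close> and antisymmetry of \<open>g\<^sub>j \<bullet>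
  e\<^sub>i\<close>, and these are sufficient. Missing \<open>e\<^sub>i\<close> are filled in
  so that antisymmetry persists. The solution comes from the identity that \<open>d\<^sub>j
  \<times> (g\<^sub>j \<times> w)\<close>, summed over dual bases, is \<open>-2 w\<close>.
\<close>

lemma grad_bary_cross_solve_proper:
  assumes k: "k \<notin> I"
    and diag: "\<And>i. i \<in> I \<Longrightarrow> grad_bary i \<bullet> e i = 0"
    and anti: "\<And>i j. i \<in> I \<Longrightarrow> j \<in> I \<Longrightarrow> grad_bary j \<bullet> e i = - (grad_bary i \<bullet> e j)"
  obtains w where "\<And>i. i \<in> I \<Longrightarrow> cross3 (grad_bary i) w = e i"
proof -
  \<comment> \<open>the intended value of \<open>g\<^sub>j \<bullet> e\<^sub>i\<close>; entries with neither index in \<open>I\<close> are free and set to 0\<close>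
  define m where "m i j = (if i \<in> I then grad_bary j \<bullet> e i else if j \<in> I then - (grad_bary i \<bullet> e j) else 0)" for i j
  have m: "m j i = - m i j" for i j
  proof (cases "i = j")
    case True
    then show ?thesis using diag[of i] by (auto simp: m_def)
  next
    case False
    then show ?thesis using anti[of i j] by (auto simp: m_def)
  qed
  define d where "d j = x j - x k" for j
  define e' where "e' i = (\<Sum>j\<in>UNIV. m i j *\<^sub>R d j)" for i
  have gd: "grad_bary i \<bullet> d j = (if i = j then 1 else 0)" if "i \<noteq> k" for i j
    using that by (simp add: d_def grad_bary_dual)
  have ge: "grad_bary j \<bullet> e' i = m i j" if "j \<noteq> k" for i j
    using that by (simp add: e'_def inner_sum_right gd if_distrib[of "\<lambda>a. _ * a"] cong: if_cong)
  define w where "w = - (1 / 2) *\<^sub>R (\<Sum>j\<in>UNIV. cross3 (d j) (e' j))"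
  have cross: "cross3 a (cross3 b c) = (a \<bullet> c) *\<^sub>R b - (a \<bullet> b) *\<^sub>R c" for a b c :: "real ^ 3"
    by (rule Lagrange)
  have lin: "linear (cross3 a)" for a :: "real ^ 3"
    by (rule linearI) (simp_all add: cross_add_right cross_mult_right)
  have "cross3 (grad_bary i) w = e i" if i: "i \<in> I" for i
  proof -
    have ik: "i \<noteq> k" using i k by auto
    have "(\<Sum>j\<in>UNIV. cross3 (grad_bary i) (cross3 (d j) (e' j))) = (\<Sum>j\<in>UNIV. (grad_bary i \<bullet> e' j) *\<^sub>R d j) - (\<Sum>j\<in>UNIV. (grad_bary i \<bullet> d j) *\<^sub>R e' j)"
      by (simp add: cross sum_subtractf)
    also have "(\<Sum>j\<in>UNIV. (grad_bary i \<bullet> e' j) *\<^sub>R d j) = - e' i"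
      by (simp only: ge[OF ik] e'_def[of i] m[of _ i] scaleR_minus_left sum_negf)
    also have "(\<Sum>j\<in>UNIV. (grad_bary i \<bullet> d j) *\<^sub>R e' j) = e' i"
      by (simp add: gd[OF ik] if_distrib[of "\<lambda>a. a *\<^sub>R _"] cong: if_cong)
    finally have "cross3 (grad_bary i) w = e' i"
      by (simp add: w_def linear_scale[OF lin] linear_sum[OF lin] linear_neg[OF lin] flip: scaleR_add_left)
    also have "e' i = (\<Sum>j\<in>UNIV. (grad_bary j \<bullet> e i) *\<^sub>R (x j - x k))"
      using i by (simp add: e'_def m_def d_def)
    also have "\<dots> = e i" by (rule inner_grad_bary_expand[symmetric])
    finally show ?thesis .
  qed
  then show thesis using that by blast
qed

text \<open>
  For all four indices the solution for three of them works for the fourth, because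
  antisymmetry determines the inner products of \<open>e 0\<close> with the other gradients.
\<close>

lemma grad_bary_cross_solve:
  assumes diag: "\<And>i. i \<in> I \<Longrightarrow> grad_bary i \<bullet> e i = 0"
    and anti: "\<And>i j. i \<in> I \<Longrightarrow> j \<in> I \<Longrightarrow> grad_bary j \<bullet> e i = - (grad_bary i \<bullet> e j)"
  obtains w where "\<And>i. i \<in> I \<Longrightarrow> cross3 (grad_bary i) w = e i"
proof (cases "I = UNIV")
  case False
  then obtain k where "k \<notin> I" by auto
  from grad_bary_cross_solve_proper[OF this diag anti] that show thesis by blast
next
  case True
  obtain w where w: "\<And>i. i \<in> UNIV - {0} \<Longrightarrow> cross3 (grad_bary i) w = e i"
  proof (rule grad_bary_cross_solve_proper[of 0 "UNIV - {0}" e])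
    show "grad_bary i \<bullet> e i = 0" for i using diag True by blast
    show "grad_bary j \<bullet> e i = - (grad_bary i \<bullet> e j)" for i j using anti True by blast
  qed auto
  have "cross3 (grad_bary 0) w = e 0"
  proof (rule grad_bary_eqI)
    fix j :: 4 assume "j \<noteq> 0"
    then have "e j = cross3 (grad_bary j) w" using w by simp
    then have "grad_bary j \<bullet> e 0 = - (grad_bary 0 \<bullet> cross3 (grad_bary j) w)" using anti[of 0 j] True by simp
    also have "\<dots> = grad_bary j \<bullet> cross3 (grad_bary 0) w" by (simp add: cross3_simps)
    finally show "grad_bary j \<bullet> cross3 (grad_bary 0) w = grad_bary j \<bullet> e 0" by simp
  qed
  then have "cross3 (grad_bary i) w = e i" for i using w[of i] by (cases "i = 0") auto
  then show thesis by (rule that)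
qed

text \<open>
  The analogue of \<open>div_step\<close> for the curl: one polynomial field \<open>w\<close>
  whose cross products with the four gradients match \<open>E i\<close> on the four faces.
  Tangency on the faces and continuity of the normal component across interfaces are exactly
  the solvability conditions, coefficient by coefficient: the normal of the interface between
  cells \<open>i\<close> and \<open>j\<close> is the difference of the two gradients.
\<close>

lemma curl_step:
  assumes E: "\<And>i. E i \<in> pol s"
    and normal: "\<And>i j y. bary i y = bary j y \<Longrightarrow> (grad_bary i - grad_bary j) \<bullet> (E i y - E j y) = 0"
    and face: "\<And>i y. bary i y = 0 \<Longrightarrow> grad_bary i \<bullet> E i y = 0"
  obtains w a where "w \<in> pol s"
    "\<And>i y. E i y - cross3 (grad_bary i) (w y) = (\<Sum>\<alpha>\<in>expos s. mon \<alpha> y *\<^sub>R a i \<alpha>)"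
    "\<And>i \<alpha>. \<alpha> \<in> expos s \<Longrightarrow> \<alpha> i = 0 \<Longrightarrow> a i \<alpha> = 0"
proof -
  obtain e where e: "\<And>i. E i = (\<lambda>y. \<Sum>\<alpha>\<in>expos s. mon \<alpha> y *\<^sub>R e i \<alpha>)"
    using pol_family_coeffs[of E s, OF E] by blast
  have "\<exists>w. \<forall>i. \<alpha> i = 0 \<longrightarrow> cross3 (grad_bary i) w = e i \<alpha>" if \<alpha>: "\<alpha> \<in> expos s" for \<alpha>
  proof -
    have diag: "grad_bary i \<bullet> e i \<alpha> = 0" if "\<alpha> i = 0" for i
    proof (rule bernstein_coeff_zero[where J = "UNIV - {i}" and d = s and a = "\<lambda>\<alpha>. grad_bary i \<bullet> e i \<alpha>"])
      fix y assume "\<And>j. j \<notin> UNIV - {i} \<Longrightarrow> bary j y = 0"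
      then show "(\<Sum>\<alpha>\<in>expos s. mon \<alpha> y *\<^sub>R (grad_bary i \<bullet> e i \<alpha>)) = 0"
        using face[of i y] by (simp add: e inner_sum_right)
    qed (use \<alpha> that UNIV_minus_nonempty in auto)
    have anti: "grad_bary j \<bullet> e i \<alpha> = - (grad_bary i \<bullet> e j \<alpha>)" if ij: "\<alpha> i = 0" "\<alpha> j = 0" for i j
    proof -
      have "(grad_bary i - grad_bary j) \<bullet> (e i \<alpha> - e j \<alpha>) = 0"
      proof (rule bernstein_coeff_zero[where J = "UNIV - {i, j}" and d = s and a = "\<lambda>\<alpha>. (grad_bary i - grad_bary j) \<bullet> (e i \<alpha> - e j \<alpha>)"])
        fix y assume "\<And>l. l \<notin> UNIV - {i, j} \<Longrightarrow> bary l y = 0"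
        then have "bary i y = bary j y" by simp
        from normal[OF this]
        show "(\<Sum>\<alpha>\<in>expos s. mon \<alpha> y *\<^sub>R ((grad_bary i - grad_bary j) \<bullet> (e i \<alpha> - e j \<alpha>))) = 0"
          by (simp add: e inner_sum_right inner_diff_right right_diff_distrib sum_subtractf)
      qed (use \<alpha> ij UNIV_minus_nonempty in auto)
      then show ?thesis using diag[OF ij(1)] diag[OF ij(2)] by (simp add: inner_diff_left inner_diff_right)
    qed
    obtain w where "\<And>i. i \<in> {i. \<alpha> i = 0} \<Longrightarrow> cross3 (grad_bary i) w = e i \<alpha>"
    proof (rule grad_bary_cross_solve[of "{i. \<alpha> i = 0}" "\<lambda>i. e i \<alpha>"])
      show "grad_bary i \<bullet> e i \<alpha> = 0" if "i \<in> {i. \<alpha> i = 0}" for i using diag that by blast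
      show "grad_bary j \<bullet> e i \<alpha> = - (grad_bary i \<bullet> e j \<alpha>)" if "i \<in> {i. \<alpha> i = 0}" "j \<in> {i. \<alpha> i = 0}" for i j
        using anti that by blast
    qed blast
    then show ?thesis by blast
  qed
  then obtain W where W: "\<And>\<alpha> i. \<alpha> \<in> expos s \<Longrightarrow> \<alpha> i = 0 \<Longrightarrow> cross3 (grad_bary i) (W \<alpha>) = e i \<alpha>" by metis
  have lin: "linear (cross3 a)" for a :: "real ^ 3"
    by (rule linearI) (simp_all add: cross_add_right cross_mult_right)
  show thesis
  proof (rule that[of "\<lambda>y. \<Sum>\<alpha>\<in>expos s. mon \<alpha> y *\<^sub>R W \<alpha>" "\<lambda>i \<alpha>. e i \<alpha> - cross3 (grad_bary i) (W \<alpha>)"])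
    show "E i y - cross3 (grad_bary i) (\<Sum>\<alpha>\<in>expos s. mon \<alpha> y *\<^sub>R W \<alpha>) =
      (\<Sum>\<alpha>\<in>expos s. mon \<alpha> y *\<^sub>R (e i \<alpha> - cross3 (grad_bary i) (W \<alpha>)))" for i y
      by (simp add: e linear_sum[OF lin] linear_scale[OF lin] scaleR_diff_right sum_subtractf)
    show "(\<lambda>y. \<Sum>\<alpha>\<in>expos s. mon \<alpha> y *\<^sub>R W \<alpha>) \<in> pol s" by (rule polI) simp
    show "e i \<alpha> - cross3 (grad_bary i) (W \<alpha>) = 0" if "\<alpha> \<in> expos s" "\<alpha> i = 0" for i \<alpha>
      by (simp add: W that)
  qed
qed

section \<open>Vector potentials of divergence-free fields\<close>

lemma pol_zero_off_face:
  fixes f :: "real ^ 3 \<Rightarrow> 'b::real_inner"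
  assumes "f \<in> pol d" "\<And>y. bary i y \<noteq> 0 \<Longrightarrow> f y = 0"
  shows "f y = 0"
proof (cases "bary i y = 0")
  case True
  show ?thesis
    by (rule pol_zero_from_segment[OF assms(1), of 1 "x i"])
       (use assms(2) True in \<open>auto simp: bary_line bary_vertex\<close>)
qed (use assms(2) in auto)

lemma bary_barycenter: "bary i (barycenter x) = 1 / 4"
proof -
  have "barycenter x = (\<Sum>j\<in>UNIV. (1 / 4) *\<^sub>R x j)" by (simp add: barycenter_def scaleR_right.sum)
  then show ?thesis using bary_combination[of "\<lambda>_. 1 / 4" i] by simp
qed

text \<open>
  The line from the barycenter stays on the hyperplane where the two coordinates agree and
  leaves the set where they vanish.
\<close>

lemma pol_zero_off_interface:
  fixes f :: "real ^ 3 \<Rightarrow> 'b::real_inner"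
  assumes "f \<in> pol d" "\<And>y. bary i y = bary j y \<Longrightarrow> bary i y \<noteq> 0 \<Longrightarrow> f y = 0" "bary i y = bary j y"
  shows "f y = 0"
proof (cases "bary i y = 0")
  case True
  show ?thesis
    by (rule pol_zero_from_segment[OF assms(1), of 1 "barycenter x"])
       (use assms(2,3) True in \<open>auto simp: bary_line bary_barycenter\<close>)
qed (use assms(2,3) in auto)

text \<open>
  Four polynomials, one for each cell. The cells \<open>i\<close> and \<open>j\<close> meet on
  the hyperplane where their coordinates agree, so this is continuity across the interfaces,
  extended to the full hyperplanes.
\<close>

definition compat :: "(4 \<Rightarrow> real ^ 3 \<Rightarrow> 'b) \<Rightarrow> bool" where
  "compat P \<longleftrightarrow> (\<forall>i j y. bary i y = bary j y \<longrightarrow> P i y = P j y)"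

lemma compatI: "(\<And>i j y. bary i y = bary j y \<Longrightarrow> P i y = P j y) \<Longrightarrow> compat P"
  unfolding compat_def by blast

lemma compatD: "compat P \<Longrightarrow> bary i y = bary j y \<Longrightarrow> P i y = P j y"
  unfolding compat_def by blast

text \<open>
  The first argument of \<open>h\<close> may be \<open>bary i y\<close>, which is itself a
  compatible family.
\<close>

lemma compat_combine:
  assumes "compat P" "compat Q"
  shows "compat (\<lambda>i y. h (bary i y) y (P i y) (Q i y))"
proof (rule compatI)
  fix i j y assume "bary i y = bary j y"
  with compatD[OF assms(1) this] compatD[OF assms(2) this]
  show "h (bary i y) y (P i y) (Q i y) = h (bary j y) y (P j y) (Q j y)" by simp
qed

text \<open>
  The field with pieces \<open>bary i ^ Suc k *\<^sub>R E i\<close> is divergence-free by the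
  last assumption, and has continuous normal component by the second. Subtracting the curl of
  \<open>bary i ^ Suc (Suc k) *\<^sub>R u\<close>, with \<open>u\<close> from
  \<open>curl_step\<close>, removes the leading term; the remainder is of the same kind with
  one more power of \<open>bary i\<close> and a degree less. Tangential components of the
  remainder are discontinuous, which is why only normal continuity is assumed.
\<close>

lemma curl_potential_pieces:
  assumes "\<And>i. E i \<in> pol s"
    and "\<And>i j y. bary i y = bary j y \<Longrightarrow> (grad_bary i - grad_bary j) \<bullet> (E i y - E j y) = 0"
    and "\<And>i y. (1 + real k) * (grad_bary i \<bullet> E i y) + bary i y * pt_div (E i) y = 0"
  shows "\<exists>v. (\<forall>i. v i \<in> pol (k + 2 + s)) \<and> compat v \<and> (\<forall>i y. bary i y = 0 \<longrightarrow> v i y = 0) \<and>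
             (\<forall>i y. pt_curl (v i) y = bary i y ^ Suc k *\<^sub>R E i y)"
  using assms
proof (induction s arbitrary: k E)
  case 0
  have face: "grad_bary i \<bullet> E i y = 0" if "bary i y = 0" for i y
    using 0(3)[of i y] that by (simp add: add_nonneg_eq_0_iff)
  obtain w a where w: "w \<in> pol 0"
    "\<And>i y. E i y - cross3 (grad_bary i) (w y) = (\<Sum>\<alpha>\<in>expos 0. mon \<alpha> y *\<^sub>R a i \<alpha>)"
    "\<And>i \<alpha>. \<alpha> \<in> expos 0 \<Longrightarrow> \<alpha> i = 0 \<Longrightarrow> a i \<alpha> = 0"
    by (rule curl_step[of E 0]) (use 0 face in auto)
  have Ew: "E i y = cross3 (grad_bary i) (w y)" for i y
    using w(2)[of i y] w(3)[of "\<lambda>_. 0" i] by (simp add: expos_0)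
  \<comment> \<open>the factor cancels the exponent that differentiation of \<open>bary i ^ Suc (Suc k)\<close> brings down\<close>
  define u where "u = (\<lambda>y. (1 / (2 + real k)) *\<^sub>R w y)"
  have u: "u \<in> pol 0" unfolding u_def by (rule pol_scaleR[OF w(1)])
  have uw: "(2 + real k) *\<^sub>R cross3 g (u y) = cross3 g (w y)" for g y
    by (simp add: u_def cross_mult_right)
  have cu: "pt_curl u y = 0" for y
    by (simp add: pt_curl_pol[OF u] pol_deriv(3)[OF u])
  have "(\<lambda>y. bary i y ^ Suc (Suc k) *\<^sub>R u y) \<in> pol (k + 2 + 0)" for i
    using pol_bary_power_mult[OF u, of i "Suc (Suc k)"] by simp
  moreover have "pt_curl (\<lambda>y. bary i y ^ Suc (Suc k) *\<^sub>R u y) y = bary i y ^ Suc k *\<^sub>R E i y" for i y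
    unfolding pt_curl_bary_power[OF u] using uw[of "grad_bary i" y] by (simp add: cu Ew)
  ultimately show ?case
    by (intro exI[of _ "\<lambda>i y. bary i y ^ Suc (Suc k) *\<^sub>R u y"]) (auto simp: compat_def)
next
  case (Suc s)
  have face: "grad_bary i \<bullet> E i y = 0" if "bary i y = 0" for i y
    using Suc.prems(3)[of i y] that by (simp add: add_nonneg_eq_0_iff)
  obtain w a where w: "w \<in> pol (Suc s)"
    "\<And>i y. E i y - cross3 (grad_bary i) (w y) = (\<Sum>\<alpha>\<in>expos (Suc s). mon \<alpha> y *\<^sub>R a i \<alpha>)"
    "\<And>i \<alpha>. \<alpha> \<in> expos (Suc s) \<Longrightarrow> \<alpha> i = 0 \<Longrightarrow> a i \<alpha> = 0"
    by (rule curl_step[of E "Suc s"]) (use Suc.prems face in auto)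
  have "\<exists>q. q \<in> pol s \<and> (\<forall>y. E i y = cross3 (grad_bary i) (w y) + bary i y *\<^sub>R q y)" for i
    by (rule pol_factor[of s i "a i"]) (use w(2,3) in \<open>auto simp: algebra_simps\<close>)
  then obtain F where F: "\<And>i. F i \<in> pol s" "\<And>i y. E i y = cross3 (grad_bary i) (w y) + bary i y *\<^sub>R F i y" by metis
  \<comment> \<open>the factor cancels the exponent that differentiation of \<open>bary i ^ Suc (Suc k)\<close> brings down\<close>
  define u where "u = (\<lambda>y. (1 / (2 + real k)) *\<^sub>R w y)"
  have u: "u \<in> pol (Suc s)" unfolding u_def by (rule pol_scaleR[OF w(1)])
  have uw: "(2 + real k) *\<^sub>R cross3 g (u y) = cross3 g (w y)" for g y
    by (simp add: u_def cross_mult_right)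
  define E' where "E' i = (\<lambda>y. F i y - pt_curl u y)" for i
  have E': "E' i \<in> pol s" for i
    unfolding E'_def using pol_pt_curl[OF u] by (intro pol_diff F) simp
  have split: "bary i y ^ Suc k *\<^sub>R E i y = pt_curl (\<lambda>y. bary i y ^ Suc (Suc k) *\<^sub>R u y) y + bary i y ^ Suc (Suc k) *\<^sub>R E' i y" for i y
    unfolding pt_curl_bary_power[OF u] F(2) E'_def using uw[of "grad_bary i" y]
    by (simp add: algebra_simps)
  have pu: "(\<lambda>y. bary i y ^ Suc (Suc k) *\<^sub>R u y) \<in> pol (k + 2 + Suc s)" for i
    using pol_bary_power_mult[OF u, of i "Suc (Suc k)"] by simp
  have pE: "(\<lambda>y. bary i y ^ Suc (Suc k) *\<^sub>R E' i y) \<in> pol (Suc (Suc k) + s)" for i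
    by (rule pol_bary_power_mult[OF E'])
  have D: "(1 + real (Suc k)) * (grad_bary i \<bullet> E' i y) + bary i y * pt_div (E' i) y = 0" for i y
  proof (rule pol_zero_off_face[of _ "Suc s"])
    show "(\<lambda>y. (1 + real (Suc k)) * (grad_bary i \<bullet> E' i y) + bary i y * pt_div (E' i) y) \<in> pol (Suc s)"
    proof (rule pol_add)
      show "(\<lambda>y. (1 + real (Suc k)) * (grad_bary i \<bullet> E' i y)) \<in> pol (Suc s)"
        by (intro pol_mult_const pol_inner pol_Suc_mono[OF E'])
      have "pt_div (E' i) \<in> pol s" using pol_mono[OF pol_pt_div[OF E'[of i]], of s] by simp
      from pol_bary_mult[OF this] show "(\<lambda>y. bary i y * pt_div (E' i) y) \<in> pol (Suc s)" by simp
    qed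
    fix y assume "bary i y \<noteq> 0"
    moreover have "bary i y ^ Suc k * ((1 + real (Suc k)) * (grad_bary i \<bullet> E' i y) + bary i y * pt_div (E' i) y) =
        pt_div (\<lambda>y. bary i y ^ Suc (Suc k) *\<^sub>R E' i y) y"
      by (simp only: pt_div_bary_power[OF E'])
    moreover have "pt_div (\<lambda>y. bary i y ^ Suc (Suc k) *\<^sub>R E' i y) y =
      pt_div (\<lambda>y. bary i y ^ Suc k *\<^sub>R E i y) y"
      unfolding split using pt_div_add[OF pol_pt_curl[OF pu[of i]] pE[of i], of y] pt_div_curl[OF pu[of i], of y] by simp
    moreover have "\<dots> = 0"
      using pt_div_bary_power[OF Suc.prems(1)[of i], of i k y] Suc.prems(3)[of i y] by simp
    ultimately show "(1 + real (Suc k)) * (grad_bary i \<bullet> E' i y) + bary i y * pt_div (E' i) y = 0" by simp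
  qed
  have N: "(grad_bary i - grad_bary j) \<bullet> (E' i y - E' j y) = 0" if "bary i y = bary j y" for i j y
  proof (rule pol_zero_off_interface[OF _ _ that])
    show "(\<lambda>y. (grad_bary i - grad_bary j) \<bullet> (E' i y - E' j y)) \<in> pol s"
      by (intro pol_inner pol_diff E')
    fix y assume y: "bary i y = bary j y" "bary i y \<noteq> 0"
    have "bary i y *\<^sub>R (E' i y - E' j y) = (E i y - E j y) - cross3 (grad_bary i - grad_bary j) (w y)"
      by (simp add: E'_def F(2) y(1) Cross3.left_diff_distrib algebra_simps)
    then have "bary i y * ((grad_bary i - grad_bary j) \<bullet> (E' i y - E' j y)) =
      (grad_bary i - grad_bary j) \<bullet> (E i y - E j y) - (grad_bary i - grad_bary j) \<bullet> cross3 (grad_bary i - grad_bary j) (w y)"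
      by (metis inner_diff_right inner_scaleR_right)
    also have "\<dots> = 0" using Suc.prems(2)[OF y(1)] by (simp add: dot_cross_self)
    finally show "(grad_bary i - grad_bary j) \<bullet> (E' i y - E' j y) = 0" using y(2) by simp
  qed
  obtain v where v: "\<And>i. v i \<in> pol (Suc k + 2 + s)" "compat v" "\<And>i y. bary i y = 0 \<Longrightarrow> v i y = 0"
    "\<And>i y. pt_curl (v i) y = bary i y ^ Suc (Suc k) *\<^sub>R E' i y"
    using Suc.IH[OF E' N D] by blast
  have "pt_curl (\<lambda>y. bary i y ^ Suc (Suc k) *\<^sub>R u y + v i y) y = bary i y ^ Suc k *\<^sub>R E i y" for i y
    unfolding split pt_curl_add[OF pu v(1)] v(4) by simp
  moreover have "(\<lambda>y. bary i y ^ Suc (Suc k) *\<^sub>R u y + v i y) \<in> pol (k + 2 + Suc s)" for i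
    using v(1)[of i] pu[of i] by (intro pol_add) auto
  moreover have "compat (\<lambda>i y. bary i y ^ Suc (Suc k) *\<^sub>R u y + v i y)"
    by (rule compat_combine[OF v(2) v(2), where h = "\<lambda>b y p _. b ^ Suc (Suc k) *\<^sub>R u y + p"])
  moreover have "bary i y ^ Suc (Suc k) *\<^sub>R u y + v i y = 0" if "bary i y = 0" for i y
    using v(3)[OF that] that by simp
  ultimately show ?case
    by (intro exI[of _ "\<lambda>i y. bary i y ^ Suc (Suc k) *\<^sub>R u y + v i y"]) blast
qed

end

section \<open>The cells of the Alfeld split\<close>

lemma open_segment_start:
  fixes c y :: "'a::real_normed_vector"
  assumes "open S" "c \<in> S"
  obtains e where "0 < e" "\<And>t. 0 < t \<Longrightarrow> t < e \<Longrightarrow> c + t *\<^sub>R (y - c) \<in> S"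
proof -
  have "isCont (\<lambda>t. c + t *\<^sub>R (y - c)) 0" by (intro continuous_intros)
  then have "((\<lambda>t. c + t *\<^sub>R (y - c)) \<longlongrightarrow> c) (at (0::real))" by (simp add: isCont_def)
  then have "eventually (\<lambda>t. c + t *\<^sub>R (y - c) \<in> S) (at (0::real))"
    using assms by (rule topological_tendstoD)
  then obtain e where "0 < e" "\<And>t::real. t \<noteq> 0 \<Longrightarrow> dist t 0 < e \<Longrightarrow> c + t *\<^sub>R (y - c) \<in> S"
    by (auto simp: eventually_at)
  then show thesis by (intro that[of e]) auto
qed

context tetrahedron
begin

lemma tetra_eq: "tetra x = {y. \<forall>i. 0 \<le> bary i y}"
  using convex_hull_subset_eq[of UNIV] by (simp add: tetra_def)

lemma sub_vertex_bary: "bary j ((x(i := barycenter x)) a) = (if a = i then 1 / 4 else if j = a then 1 else 0)"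
  by (simp add: bary_barycenter bary_vertex)

text \<open>
  The coordinates of cell \<open>i\<close> are \<open>4 * bary i\<close> and the differences
  \<open>bary j - bary i\<close>; their gradients are the dual vectors.
\<close>

lemma sub_nondegenerate: "nondegenerate (x(i := barycenter x))"
proof (rule nondegenerateI_dual)
  fix j a b
  let ?p = "x(i := barycenter x)"
  let ?g = "if j = i then 4 *\<^sub>R grad_bary i else grad_bary j - grad_bary i"
  have "?g \<bullet> (?p a - ?p b) = (if j = i then 4 * (bary i (?p a) - bary i (?p b))
      else (bary j (?p a) - bary j (?p b)) - (bary i (?p a) - bary i (?p b)))"
    by (simp only: bary_diff) (simp add: inner_diff_left)
  also have "\<dots> = (if j = a then 1 else 0) - (if j = b then 1 else 0)"
    unfolding sub_vertex_bary by auto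
  finally show "(if j = i then 4 *\<^sub>R grad_bary i else grad_bary j - grad_bary i) \<bullet> (?p a - ?p b) =
      (if j = a then 1 else 0) - (if j = b then 1 else 0)" .
qed

lemma sub_bary: "tetrahedron.bary (x(i := barycenter x)) j y = (if j = i then 4 * bary i y else bary j y - bary i y)"
proof -
  interpret sub: tetrahedron "x(i := barycenter x)" by unfold_locales (rule sub_nondegenerate)
  let ?p = "x(i := barycenter x)"
  have *: "bary l y = sub.bary i y / 4 + (if l = i then 0 else sub.bary l y)" for l
  proof -
    have "bary l y = bary l (\<Sum>a\<in>UNIV. sub.bary a y *\<^sub>R ?p a)" by (simp only: sub.sum_bary_x)
    also have "\<dots> = (\<Sum>a\<in>UNIV. sub.bary a y * bary l (?p a))"
      by (rule bary_affine) (rule sub.sum_bary)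
    also have "\<dots> = (\<Sum>a\<in>UNIV. (if a = i then sub.bary i y / 4 else 0) + (if a = l then (if l = i then 0 else sub.bary l y) else 0))"
      unfolding sub_vertex_bary by (intro sum.cong) auto
    finally show ?thesis by (simp add: sum.distrib)
  qed
  show ?thesis using *[of i] *[of j] by auto
qed

text \<open>
  The cell \<open>i\<close> is the part of the tetrahedron on which the coordinate
  \<open>i\<close> is the smallest one. So the minimum of the coordinates is the piecewise
  linear hat function, up to a factor 4, and equals \<open>bary i\<close> on cell
  \<open>i\<close>.
\<close>

lemma alfeld_eq: "alfeld x i = {y. 0 \<le> bary i y \<and> (\<forall>j. bary i y \<le> bary j y)}"
proof -
  interpret sub: tetrahedron "x(i := barycenter x)" by unfold_locales (rule sub_nondegenerate)
  show ?thesis unfolding alfeld_def sub.tetra_eq sub_bary by auto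
qed

lemma alfeld_subset: "alfeld x i \<subseteq> tetra x"
  unfolding alfeld_eq tetra_eq by (auto intro: order_trans)

lemma min_bary: "\<exists>i. \<forall>j. bary i y \<le> bary j y"
proof -
  let ?m = "Min (range (\<lambda>i. bary i y))"
  have "?m \<in> range (\<lambda>i. bary i y)" by (rule Min_in) auto
  then obtain i where i: "?m = bary i y" by (rule rangeE)
  have "?m \<le> bary j y" for j by (rule Min_le) auto
  then show ?thesis using i by metis
qed

lemma tetra_cover: "y \<in> tetra x \<Longrightarrow> \<exists>i. y \<in> alfeld x i"
  using min_bary[of y] by (auto simp: tetra_eq alfeld_eq)

lemma compact_tetra: "compact (tetra p)"
  unfolding tetra_def by (intro finite_imp_compact_convex_hull) auto

lemma convex_tetra: "convex (tetra p)"
  unfolding tetra_def by (rule convex_convex_hull)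

lemma closed_alfeld: "closed (alfeld x i)" and compact_alfeld: "compact (alfeld x i)" and convex_alfeld: "convex (alfeld x i)"
  unfolding alfeld_def by (auto intro: compact_imp_closed compact_tetra convex_tetra)

definition open_cell :: "4 \<Rightarrow> (real ^ 3) set" where
  "open_cell i = {y. 0 < bary i y \<and> (\<forall>j. j \<noteq> i \<longrightarrow> bary i y < bary j y)}"

lemma open_open_cell: "open (open_cell i)"
proof -
  have "open_cell i = {y. 0 < bary i y} \<inter> (\<Inter>j\<in>UNIV - {i}. {y. bary i y < bary j y})"
    by (auto simp: open_cell_def)
  also have "open \<dots>"
    by (intro open_Int open_INT ballI open_Collect_less continuous_intros) auto
  finally show ?thesis .
qed

lemma open_cell_subset: "open_cell i \<subseteq> alfeld x i"
proof
  fix y assume y: "y \<in> open_cell i"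
  have "bary i y \<le> bary j y" for j using y by (cases "j = i") (auto simp: open_cell_def less_imp_le)
  then show "y \<in> alfeld x i" using y by (auto simp: open_cell_def alfeld_eq)
qed

lemma open_cell_interior: "open_cell i \<subseteq> interior (alfeld x i)"
  by (rule interior_maximal[OF open_cell_subset open_open_cell])

lemma point_with_bary: "(\<Sum>i\<in>UNIV. t i) = 1 \<Longrightarrow> \<exists>y. \<forall>i. bary i y = t i"
  using bary_combination by blast

lemma open_cell_nonempty: "\<exists>c. c \<in> open_cell i"
proof -
  have "(\<Sum>j\<in>UNIV. if j = i then 1 / 16 else 5 / 16 :: real) = (\<Sum>j\<in>UNIV. 5 / 16 + (if j = i then - 1 / 4 else 0))"
    by (intro sum.cong) auto
  also have "\<dots> = 1" by (simp add: sum.distrib)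
  finally obtain c where "\<And>j. bary j c = (if j = i then 1 / 16 else 5 / 16)"
    using point_with_bary by blast
  then have "c \<in> open_cell i" by (simp add: open_cell_def)
  then show ?thesis by blast
qed

lemma closure_interior_alfeld: "closure (interior (alfeld x i)) = alfeld x i"
  using convex_closure_interior[OF convex_alfeld[of i]] open_cell_nonempty[of i] open_cell_interior[of i] closed_alfeld[of i]
  by auto

lemma open_cell_disjoint: "y \<in> open_cell i \<Longrightarrow> y \<in> open_cell j \<Longrightarrow> i = j"
  unfolding open_cell_def by (metis (mono_tags, lifting) mem_Collect_eq order.asym)

lemma interior_tetra: "interior (tetra x) = {y. \<forall>i. 0 < bary i y}"
proof
  show "interior (tetra x) \<subseteq> {y. \<forall>i. 0 < bary i y}"
  proof (intro subsetI CollectI allI)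
    fix y i assume y: "y \<in> interior (tetra x)"
    \<comment> \<open>moving away from the vertex opposite to a face through \<open>y\<close> leaves the tetrahedron\<close>
    obtain e where e: "0 < e" "\<And>t. 0 < t \<Longrightarrow> t < e \<Longrightarrow> y + t *\<^sub>R ((y + (y - x i)) - y) \<in> interior (tetra x)"
      using open_segment_start[OF open_interior y] by blast
    have "y + (e / 2) *\<^sub>R ((y + (y - x i)) - y) \<in> tetra x"
      using e(1) e(2)[of "e / 2"] interior_subset by auto
    then have "0 \<le> bary i y + (e / 2) * (bary i y - 1)"
      by (simp add: tetra_eq bary_add flip: bary_diff) (drule spec[of _ i], simp add: bary_vertex)
    then have "e / 2 \<le> bary i y * (1 + e / 2)" by (simp add: algebra_simps)
    then show "0 < bary i y" using e(1) by (smt (verit) mult_nonpos_nonneg half_gt_zero)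
  qed
  have "open {y. \<forall>i. 0 < bary i y}"
  proof -
    have "{y. \<forall>i. 0 < bary i y} = (\<Inter>i\<in>UNIV. {y. 0 < bary i y})" by auto
    also have "open \<dots>" by (intro open_INT ballI open_Collect_less continuous_intros) auto
    finally show ?thesis .
  qed
  then show "{y. \<forall>i. 0 < bary i y} \<subseteq> interior (tetra x)"
    by (intro interior_maximal) (auto simp: tetra_eq less_imp_le)
qed

lemma frontier_tetra: "frontier (tetra x) = {y \<in> tetra x. \<exists>i. bary i y = 0}"
proof -
  have "bary i y = 0 \<longleftrightarrow> \<not> 0 < bary i y" if "y \<in> tetra x" for i y
  proof -
    have "0 \<le> bary i y" using that by (simp add: tetra_eq)
    then show ?thesis by linarith
  qed
  then show ?thesis
    unfolding frontier_def interior_tetra closure_closed[OF compact_imp_closed[OF compact_tetra]] by blast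
qed

section \<open>Polynomials vanishing on cells and interfaces\<close>

text \<open>
  The common pattern: \<open>S\<close> is an open neighbourhood of \<open>c\<close>, and
  \<open>H\<close> contains the line through \<open>c\<close> and \<open>y\<close>.
\<close>

lemma pol_zero_relative:
  fixes f :: "real ^ 3 \<Rightarrow> 'b::real_inner"
  assumes "f \<in> pol d" "open S" "c \<in> S" "\<And>t. c + t *\<^sub>R (y - c) \<in> H" "\<And>z. z \<in> S \<Longrightarrow> z \<in> H \<Longrightarrow> f z = 0"
  shows "f y = 0"
proof -
  obtain e where e: "0 < e" "\<And>t. 0 < t \<Longrightarrow> t < e \<Longrightarrow> c + t *\<^sub>R (y - c) \<in> S"
    using open_segment_start[OF assms(2,3)] by blast
  show ?thesis
  proof (rule pol_zero_from_segment[OF assms(1) e(1)])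
    fix t :: real assume "0 < t" "t < e"
    then show "f (c + t *\<^sub>R (y - c)) = 0" by (intro assms(5) e(2) assms(4))
  qed
qed

lemma pol_zero_on_open:
  fixes f :: "real ^ 3 \<Rightarrow> 'b::real_inner"
  assumes "f \<in> pol d" "open S" "c \<in> S" "\<And>z. z \<in> S \<Longrightarrow> f z = 0"
  shows "f y = 0"
  by (rule pol_zero_relative[OF assms(1,2,3), where H = UNIV]) (auto simp: assms(4))

lemma pol_zero_on_cell:
  fixes f :: "real ^ 3 \<Rightarrow> 'b::real_inner"
  assumes "f \<in> pol d" "\<And>z. z \<in> open_cell i \<Longrightarrow> f z = 0"
  shows "f y = 0"
  using open_cell_nonempty[of i] pol_zero_on_open[OF assms(1) open_open_cell _ assms(2)] by blast

lemma pol_zero_on_interface: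
  fixes f :: "real ^ 3 \<Rightarrow> 'b::real_inner"
  assumes "f \<in> pol d" "\<And>z. z \<in> alfeld x i \<Longrightarrow> z \<in> alfeld x j \<Longrightarrow> f z = 0" "bary i y = bary j y"
  shows "f y = 0"
proof (cases "i = j")
  case True
  then show ?thesis using pol_zero_on_cell[OF assms(1), of i] assms(2) open_cell_subset by blast
next
  case False
  let ?S = "\<Inter>l\<in>UNIV - {i, j}. {y. 0 < bary i y} \<inter> {y. bary i y < bary l y}"
  have "(\<Sum>l\<in>UNIV. if l = i \<or> l = j then 1 / 8 else 3 / 8 :: real) =
     (\<Sum>l\<in>UNIV. 3 / 8 + ((if l = i then - 1 / 4 else 0) + (if l = j then - 1 / 4 else 0)))"
    using False by (intro sum.cong) auto
  also have "\<dots> = 1" by (simp add: sum.distrib)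
  finally obtain c where c: "\<And>l. bary l c = (if l = i \<or> l = j then 1 / 8 else 3 / 8)"
    using point_with_bary by blast
  show ?thesis
  proof (rule pol_zero_relative[OF assms(1), of ?S c y "{y. bary i y = bary j y}"])
    show "open ?S" by (intro open_INT ballI open_Int open_Collect_less continuous_intros) auto
    show "c \<in> ?S" by (auto simp: c)
    show "c + t *\<^sub>R (y - c) \<in> {y. bary i y = bary j y}" for t using assms(3) by (simp add: bary_line c)
    fix z assume z: "z \<in> ?S" "z \<in> {y. bary i y = bary j y}"
    have "0 < bary i z" using z(1) UNIV_minus_nonempty(2)[of i j] by blast
    moreover have "bary i z \<le> bary l z" for l
    proof (cases "l = i \<or> l = j")
      case True
      then show ?thesis using z(2) by auto
    next
      case False
      then have "l \<in> UNIV - {i, j}" by auto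
      then have "bary i z < bary l z" using z(1) by blast
      then show ?thesis by simp
    qed
    ultimately show "f z = 0" using z(2) by (intro assms(2)) (auto simp: alfeld_eq)
  qed
qed

lemma pol_zero_on_face:
  fixes f :: "real ^ 3 \<Rightarrow> 'b::real_inner"
  assumes "f \<in> pol d" "\<And>z. z \<in> tetra x \<Longrightarrow> bary i z = 0 \<Longrightarrow> f z = 0" "bary i y = 0"
  shows "f y = 0"
proof -
  let ?S = "\<Inter>l\<in>UNIV - {i}. {y. 0 < bary l y}"
  have "(\<Sum>l\<in>UNIV. if l = i then 0 else 1 / 3 :: real) = (\<Sum>l\<in>UNIV. 1 / 3 + (if l = i then - 1 / 3 else 0))"
    by (intro sum.cong) auto
  also have "\<dots> = 1" by (simp add: sum.distrib)
  finally obtain c where c: "\<And>l. bary l c = (if l = i then 0 else 1 / 3)"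
    using point_with_bary by blast
  show ?thesis
  proof (rule pol_zero_relative[OF assms(1), of ?S c y "{y. bary i y = 0}"])
    show "open ?S" by (intro open_INT ballI open_Collect_less continuous_intros) auto
    show "c \<in> ?S" by (auto simp: c)
    show "c + t *\<^sub>R (y - c) \<in> {y. bary i y = 0}" for t using assms(3) by (simp add: bary_line c)
    fix z assume z: "z \<in> ?S" "z \<in> {y. bary i y = 0}"
    then have "0 \<le> bary l z" for l by (cases "l = i") (auto simp: less_imp_le)
    then show "f z = 0" using z(2) by (intro assms(2)) (auto simp: tetra_eq)
  qed
qed

section \<open>Continuous piecewise polynomials\<close>

text \<open>
  The function with pieces \<open>P\<close>. The choice of a cell containing \<open>y\<close>
  does not matter for compatible pieces; for other pieces it still gives a function that
  depends linearly on them.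
\<close>

definition glue :: "(4 \<Rightarrow> real ^ 3 \<Rightarrow> 'b) \<Rightarrow> real ^ 3 \<Rightarrow> 'b::zero" where
  "glue P y = (if y \<in> tetra x then P (SOME i. y \<in> alfeld x i) y else 0)"

lemma glue_outside: "y \<notin> tetra x \<Longrightarrow> glue P y = 0"
  by (simp add: glue_def)

lemma bary_eq_if_in_both: "y \<in> alfeld x i \<Longrightarrow> y \<in> alfeld x j \<Longrightarrow> bary i y = bary j y"
  by (auto simp: alfeld_eq intro: antisym)

lemma glue_eq: "compat P \<Longrightarrow> y \<in> alfeld x i \<Longrightarrow> glue P y = P i y"
proof -
  assume P: "compat P" and y: "y \<in> alfeld x i"
  have "y \<in> alfeld x (SOME i. y \<in> alfeld x i)" using y by (rule someI)
  then have "bary (SOME i. y \<in> alfeld x i) y = bary i y" using y by (rule bary_eq_if_in_both)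
  from compatD[OF P this] have "P (SOME i. y \<in> alfeld x i) y = P i y" .
  moreover have "y \<in> tetra x" using y alfeld_subset by blast
  ultimately show ?thesis by (simp only: glue_def if_True)
qed

lemma glue_eqI:
  assumes "compat P" "\<And>y i. y \<in> alfeld x i \<Longrightarrow> f y = P i y" "\<And>y. y \<notin> tetra x \<Longrightarrow> f y = 0"
  shows "f = glue P"
proof
  fix y show "f y = glue P y"
  proof (cases "y \<in> tetra x")
    case True
    then obtain i where "y \<in> alfeld x i" using tetra_cover by blast
    then show ?thesis using assms(1,2) glue_eq by metis
  next
    case False
    then show ?thesis using assms(3) glue_outside by metis
  qed
qed

lemma glue_linear:
  "glue (\<lambda>i y. P i y + Q i y) = (\<lambda>y. glue P y + glue Q y :: 'b::real_vector)"
  "glue (\<lambda>i y. P i y - Q i y) = (\<lambda>y. glue P y - glue Q y :: 'b)"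
  "glue (\<lambda>i y. c *\<^sub>R P i y) = (\<lambda>y. c *\<^sub>R glue P y :: 'b)"
  by (auto simp: glue_def fun_eq_iff)

lemma glue_C0:
  assumes "compat P" "\<And>i. P i \<in> pol d"
  shows "glue P \<in> C0 (tetra x)"
proof -
  have "continuous_on (\<Union>i\<in>UNIV. alfeld x i) (glue P)"
  proof (rule continuous_on_closed_Union)
    fix i
    show "continuous_on (alfeld x i) (glue P)"
      using pol_continuous[OF assms(2)] by (rule continuous_on_eq) (simp add: glue_eq[OF assms(1)])
  qed (auto simp: closed_alfeld)
  moreover have "(\<Union>i\<in>UNIV. alfeld x i) = tetra x" using alfeld_subset tetra_cover by blast
  ultimately show ?thesis by (auto simp: C0_def glue_outside)
qed

text \<open>
  Polynomials that agree on an interface triangle agree on its hyperplane, so the pieces of a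
  continuous function are compatible.
\<close>

lemma M0_iff: "f \<in> M0 (int d) x \<longleftrightarrow> (\<exists>P. (\<forall>i. P i \<in> pol d) \<and> compat P \<and> f = glue P)"
proof
  assume f: "f \<in> M0 (int d) x"
  have "\<forall>i. \<exists>p. p \<in> pol d \<and> (\<forall>y\<in>alfeld x i. f y = p y)"
  proof
    fix i
    obtain p where "p \<in> PolyOn (int d) (alfeld x i)" "\<forall>y\<in>alfeld x i. f y = p y"
      using f by (auto simp: M0_def)
    then show "\<exists>p. p \<in> pol d \<and> (\<forall>y\<in>alfeld x i. f y = p y)" unfolding PolyOn_iff by auto
  qed
  then obtain P where P: "\<And>i. P i \<in> pol d" "\<And>i y. y \<in> alfeld x i \<Longrightarrow> f y = P i y"
    using choice[of "\<lambda>i p. p \<in> pol d \<and> (\<forall>y\<in>alfeld x i. f y = p y)"] by blast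
  have "compat P"
  proof (rule compatI)
    fix i j y assume y: "bary i y = bary j y"
    have "P i y - P j y = 0"
    proof (rule pol_zero_on_interface[where i = i and j = j and f = "\<lambda>y. P i y - P j y" and d = d])
      fix z assume "z \<in> alfeld x i" "z \<in> alfeld x j"
      then show "P i z - P j z = 0" by (simp flip: P(2))
    qed (use y in \<open>auto intro: pol_diff P\<close>)
    then show "P i y = P j y" by simp
  qed
  moreover from this have "f = glue P"
    by (rule glue_eqI) (use P(2) f in \<open>auto simp: M0_def C0_def\<close>)
  ultimately show "\<exists>P. (\<forall>i. P i \<in> pol d) \<and> compat P \<and> f = glue P" using P(1) by blast
next
  assume "\<exists>P. (\<forall>i. P i \<in> pol d) \<and> compat P \<and> f = glue P"
  then obtain P where P: "\<And>i. P i \<in> pol d" "compat P" "f = glue P" by blast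
  have "\<exists>p\<in>PolyOn (int d) (alfeld x i). \<forall>y\<in>alfeld x i. f y = p y" for i
  proof (rule bexI[of _ "\<lambda>y. if y \<in> alfeld x i then P i y else 0"])
    show "(\<lambda>y. if y \<in> alfeld x i then P i y else 0) \<in> PolyOn (int d) (alfeld x i)"
      unfolding PolyOn_iff using P(1)[of i] by auto
  qed (simp add: P(3) glue_eq[OF P(2)])
  then show "f \<in> M0 (int d) x" using glue_C0[OF P(2,1)] by (simp add: M0_def P(3))
qed

lemma vec3_M0_iff: "f \<in> vec3 (M0 (int d) x) \<longleftrightarrow> (\<exists>P. (\<forall>i. P i \<in> pol d) \<and> compat P \<and> f = glue P)"
proof
  assume "f \<in> vec3 (M0 (int d) x)"
  then have "\<forall>c. \<exists>P. (\<forall>i. P i \<in> pol d) \<and> compat P \<and> (\<lambda>y. f y $ c) = glue P"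
    unfolding vec3_def M0_iff by simp
  then obtain P where P: "\<And>c i. P c i \<in> pol d" "\<And>c. compat (P c)" "\<And>c. (\<lambda>y. f y $ c) = glue (P c)"
    using choice[of "\<lambda>c P. (\<forall>i. P i \<in> pol d) \<and> compat P \<and> (\<lambda>y. f y $ c) = glue P"] by blast
  let ?P = "\<lambda>i y. \<chi> c. P c i y"
  have "compat ?P"
  proof (rule compatI)
    fix i j y assume "bary i y = bary j y"
    then have "P c i y = P c j y" for c by (rule compatD[OF P(2)])
    then show "(\<chi> c. P c i y) = (\<chi> c. P c j y)" by simp
  qed
  moreover have "?P i \<in> pol d" for i unfolding pol_component_iff by (simp add: P(1))
  moreover have "f = glue ?P"
  proof
    fix y
    have "f y $ c = glue ?P y $ c" for c
      using fun_cong[OF P(3)[of c], of y] by (simp add: glue_def)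
    then show "f y = glue ?P y" by (simp add: vec_eq_iff)
  qed
  ultimately show "\<exists>P. (\<forall>i. P i \<in> pol d) \<and> compat P \<and> f = glue P"
    by (intro exI[of _ ?P] conjI allI)
next
  assume "\<exists>P. (\<forall>i. P i \<in> pol d) \<and> compat P \<and> f = glue P"
  then obtain P where P: "\<And>i. P i \<in> pol d" "compat P" "f = glue P" by blast
  have "(\<lambda>y. f y $ c) \<in> M0 (int d) x" for c
    unfolding M0_iff
  proof (intro exI[of _ "\<lambda>i y. P i y $ c"] conjI allI)
    show "(\<lambda>y. P i y $ c) \<in> pol d" for i using P(1)[of i] by (simp add: pol_component_iff)
    show "compat (\<lambda>i y. P i y $ c)"
      by (rule compat_combine[OF P(2) P(2), where h = "\<lambda>_ _ p _. p $ c"])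
    show "(\<lambda>y. f y $ c) = glue (\<lambda>i y. P i y $ c)" by (auto simp: P(3) glue_def)
  qed
  then show "f \<in> vec3 (M0 (int d) x)" by (simp add: vec3_def)
qed

lemma C0_repr_glueI:
  assumes "\<And>i. Q i \<in> pol d" "\<And>i y. y \<in> interior (alfeld x i) \<Longrightarrow> h y = Q i y" "compat Q"
  shows "C0_repr x h (glue Q)"
  unfolding C0_repr_def
proof (intro conjI allI ballI glue_C0[OF assms(3,1)])
  fix i y assume y: "y \<in> interior (alfeld x i)"
  then have "y \<in> alfeld x i" using interior_subset by blast
  then show "glue Q y = h y" using glue_eq[OF assms(3)] assms(2)[OF y] by simp
qed

text \<open>
  Interiors of the cells are dense, so the continuous representative is determined by its
  polynomial pieces, and these agree on interfaces.
\<close>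

lemma C0_repr_glueD:
  fixes Q :: "4 \<Rightarrow> real ^ 3 \<Rightarrow> 'b::real_inner"
  assumes "\<And>i. Q i \<in> pol d" "\<And>i y. y \<in> interior (alfeld x i) \<Longrightarrow> h y = Q i y" "C0_repr x h g"
  shows "compat Q" and "g = glue Q"
proof -
  have cont: "continuous_on (tetra x) g" and out: "\<And>y. y \<notin> tetra x \<Longrightarrow> g y = 0"
    and int: "\<And>i y. y \<in> interior (alfeld x i) \<Longrightarrow> g y = h y"
    using assms(3) by (auto simp: C0_repr_def C0_def)
  have g: "g y = Q i y" if y: "y \<in> alfeld x i" for i y
  proof -
    have "g y - Q i y = 0"
    proof (rule continuous_constant_on_closure[where S = "interior (alfeld x i)" and f = "\<lambda>y. g y - Q i y"])
      show "continuous_on (closure (interior (alfeld x i))) (\<lambda>y. g y - Q i y)"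
        unfolding closure_interior_alfeld
        by (intro continuous_intros continuous_on_subset[OF cont alfeld_subset] pol_continuous[OF assms(1)])
    qed (use y in \<open>auto simp: closure_interior_alfeld int assms(2)\<close>)
    then show ?thesis by simp
  qed
  show "compat Q"
  proof (rule compatI)
    fix i j y assume y: "bary i y = bary j y"
    have "Q i y - Q j y = 0"
    proof (rule pol_zero_on_interface[where i = i and j = j and f = "\<lambda>y. Q i y - Q j y" and d = d])
      fix z assume "z \<in> alfeld x i" "z \<in> alfeld x j"
      then show "Q i z - Q j z = 0" by (simp flip: g)
    qed (use y in \<open>auto intro: pol_diff assms(1)\<close>)
    then show "Q i y = Q j y" by simp
  qed
  then show "g = glue Q" by (rule glue_eqI) (use g out in auto)
qed

lemma glue_has_derivative:
  assumes "compat P" "P i \<in> pol d" "y \<in> interior (alfeld x i)"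
  shows "(glue P has_derivative frechet_derivative (P i) (at y)) (at y)"
proof (rule has_derivative_transform_within_open[OF pol_deriv(1)[OF assms(2)] open_interior assms(3)])
  fix z assume "z \<in> interior (alfeld x i)"
  then have "z \<in> alfeld x i" using interior_subset by blast
  then show "P i z = glue P z" using glue_eq[OF assms(1)] by simp
qed

lemma pt_div_glue: "compat P \<Longrightarrow> P i \<in> pol d \<Longrightarrow> y \<in> interior (alfeld x i) \<Longrightarrow> pt_div (glue P) y = pt_div (P i) y"
  by (subst pt_div_eq[OF glue_has_derivative]) (simp_all add: pt_div_pol)

lemma pt_curl_glue: "compat P \<Longrightarrow> P i \<in> pol d \<Longrightarrow> y \<in> interior (alfeld x i) \<Longrightarrow> pt_curl (glue P) y = pt_curl (P i) y"
  by (subst pt_curl_eq[OF glue_has_derivative]) (simp_all add: pt_curl_pol)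

lemma C0_repr_div_iff:
  assumes "compat P" "\<And>i. P i \<in> pol d"
  shows "C0_repr x (pt_div (glue P)) g \<longleftrightarrow> compat (\<lambda>i. pt_div (P i)) \<and> g = glue (\<lambda>i. pt_div (P i))"
  using C0_repr_glueI[of "\<lambda>i. pt_div (P i)" "d - 1" "pt_div (glue P)"]
    C0_repr_glueD[of "\<lambda>i. pt_div (P i)" "d - 1" "pt_div (glue P)" g]
    pol_pt_div[OF assms(2)] pt_div_glue[OF assms] by metis

lemma C0_repr_curl_iff:
  assumes "compat P" "\<And>i. P i \<in> pol d"
  shows "C0_repr x (pt_curl (glue P)) g \<longleftrightarrow> compat (\<lambda>i. pt_curl (P i)) \<and> g = glue (\<lambda>i. pt_curl (P i))"
  using C0_repr_glueI[of "\<lambda>i. pt_curl (P i)" "d - 1" "pt_curl (glue P)"]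
    C0_repr_glueD[of "\<lambda>i. pt_curl (P i)" "d - 1" "pt_curl (glue P)" g]
    pol_pt_curl[OF assms(2)] pt_curl_glue[OF assms] by metis

text \<open>
  From here on divergence, curl and the spaces are expressed by pieces alone.
\<close>

lemma div_T_glue:
  assumes "compat P" "\<And>i. P i \<in> pol d" "compat (\<lambda>i. pt_div (P i))"
  shows "div_T x (glue P) = glue (\<lambda>i. pt_div (P i))"
  unfolding div_T_def C0_repr_div_iff[OF assms(1,2)] using assms(3) by simp

lemma curl_T_glue:
  assumes "compat P" "\<And>i. P i \<in> pol d" "compat (\<lambda>i. pt_curl (P i))"
  shows "curl_T x (glue P) = glue (\<lambda>i. pt_curl (P i))"
  unfolding curl_T_def C0_repr_curl_iff[OF assms(1,2)] using assms(3) by simp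

lemma M2_iff: "\<omega> \<in> M2 (int d) x \<longleftrightarrow>
   (\<exists>P. (\<forall>i. P i \<in> pol d) \<and> compat P \<and> compat (\<lambda>i. pt_div (P i)) \<and> \<omega> = glue P)"
  unfolding M2_def mem_Collect_eq vec3_M0_iff using C0_repr_div_iff by metis

lemma M1_iff: "\<omega> \<in> M1 (int d) x \<longleftrightarrow>
   (\<exists>P. (\<forall>i. P i \<in> pol d) \<and> compat P \<and> compat (\<lambda>i. pt_curl (P i)) \<and> \<omega> = glue P)"
  unfolding M1_def mem_Collect_eq vec3_M0_iff using C0_repr_curl_iff by metis

lemma glue_zero_frontier:
  fixes P :: "4 \<Rightarrow> real ^ 3 \<Rightarrow> 'b::real_inner"
  assumes "compat P" "\<And>i. P i \<in> pol d"
  shows "(\<forall>y\<in>frontier (tetra x). glue P y = 0) \<longleftrightarrow> (\<forall>i y. bary i y = 0 \<longrightarrow> P i y = 0)"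
proof -
  have cell: "y \<in> alfeld x i" if "y \<in> tetra x" "bary i y = 0" for y i
    using that by (auto simp: tetra_eq alfeld_eq)
  show ?thesis
  proof
    assume *: "\<forall>y\<in>frontier (tetra x). glue P y = 0"
    show "\<forall>i y. bary i y = 0 \<longrightarrow> P i y = 0"
    proof (intro allI impI)
      fix i y assume "bary i y = 0"
      then show "P i y = 0"
      proof (rule pol_zero_on_face[OF assms(2), rotated])
        fix z assume z: "z \<in> tetra x" "bary i z = 0"
        then have "glue P z = 0" using * by (auto simp: frontier_tetra)
        then show "P i z = 0" using glue_eq[OF assms(1) cell[OF z]] by simp
      qed
    qed
  next
    assume "\<forall>i y. bary i y = 0 \<longrightarrow> P i y = 0"
    then show "\<forall>y\<in>frontier (tetra x). glue P y = 0"
      using glue_eq[OF assms(1) cell] by (auto simp: frontier_tetra)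
  qed
qed

end

section \<open>The divergence theorem on the Alfeld split\<close>

lemma AE_lborel_not_in:
  fixes N :: "'a::euclidean_space set"
  assumes "N \<in> sets borel" "negligible N"
  shows "AE y in lborel. y \<notin> N"
proof (rule AE_not_in)
  have "N \<in> null_sets (completion lborel)" using assms(2) by (simp add: negligible_iff_null_sets)
  then show "N \<in> null_sets lborel" using assms(1) null_sets_completion_iff[of N lborel] by simp
qed

lemma AE_zero_on_open:
  fixes S :: "'a::euclidean_space set"
  assumes "open S" "AE y in lborel. y \<notin> S"
  shows "S = {}"
proof (rule ccontr)
  assume "S \<noteq> {}"
  then have "\<not> negligible S" using assms(1) open_not_negligible by blast
  moreover have "S \<in> null_sets lborel"
    using assms AE_iff_null_sets[of S lborel] by auto
  then have "negligible S"
    using assms(1) null_sets_completion_iff[of S lborel] by (simp add: negligible_iff_null_sets)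
  ultimately show False by simp
qed

lemma lborel_integral_translate:
  fixes f :: "'a::euclidean_space \<Rightarrow> real"
  assumes "f \<in> borel_measurable borel"
  shows "(LINT y|lborel. f (y + a)) = (LINT y|lborel. f y)"
proof -
  have "(LINT y|lborel. f y) = (LINT y|distr lborel borel ((+) a). f y)"
    by (simp add: lborel_distr_plus)
  also have "\<dots> = (LINT y|lborel. f (a + y))"
    by (rule integral_distr) (use assms in auto)
  finally show ?thesis by (simp add: add.commute)
qed

lemma lborel_integrable_translate:
  fixes f :: "'a::euclidean_space \<Rightarrow> real"
  assumes "integrable lborel f"
  shows "integrable lborel (\<lambda>y. f (y + a))"
proof -
  have "integrable (distr lborel borel ((+) a)) f" using assms by (simp add: lborel_distr_plus)
  then have "integrable lborel (\<lambda>y. f (a + y))"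
    by (subst (asm) integrable_distr_eq) (use assms in auto)
  then show ?thesis by (simp add: add.commute)
qed

text \<open>
  Translation invariance of the Lebesgue measure gives all difference quotients integral 0.
  They are bounded by the Lipschitz constant on a common compact set, so dominated convergence
  applies. For piecewise
  polynomials the null set is that of the interfaces.
\<close>

lemma integral_derivative_zero:
  fixes f f' :: "'a::euclidean_space \<Rightarrow> real" and K :: "'a set" and v :: 'a
  assumes lip: "\<And>y y'. \<bar>f y - f y'\<bar> \<le> L * norm (y - y')"
    and supp: "compact K" "\<And>y. y \<notin> K \<Longrightarrow> f y = 0"
    and deriv: "AE y in lborel. ((\<lambda>t. f (y + t *\<^sub>R v)) has_real_derivative f' y) (at 0)"
    and meas: "f' \<in> borel_measurable lborel"
  shows "(LINT y|lborel. f' y) = 0"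
proof -
  have cont: "continuous_on UNIV f"
  proof (rule lipschitz_on_continuous_on)
    show "lipschitz_on \<bar>L\<bar> UNIV f"
    proof (rule lipschitz_onI)
      fix y y' :: 'a
      have "L * norm (y - y') \<le> \<bar>L\<bar> * norm (y - y')" by (intro mult_right_mono) auto
      then show "dist (f y) (f y') \<le> \<bar>L\<bar> * dist y y'" using lip[of y y'] by (simp add: dist_norm)
    qed simp
  qed
  then have meas_f: "f \<in> borel_measurable borel" by (rule borel_measurable_continuous_onI)
  have "integrable lborel (\<lambda>y. indicator K y *\<^sub>R f y)"
    using supp(1) by (rule borel_integrable_compact) (rule continuous_on_subset[OF cont], simp)
  moreover have "(\<lambda>y. indicator K y *\<^sub>R f y) = f"
  proof
    fix y show "indicator K y *\<^sub>R f y = f y" by (cases "y \<in> K") (auto simp: supp(2))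
  qed
  ultimately have int_f: "integrable lborel f" by simp
  \<comment> \<open>step sizes tending to 0\<close>
  define h where "h n = inverse (real (Suc n))" for n
  have h: "0 < h n" "h n \<le> 1" for n by (auto simp: h_def inverse_le_1_iff)
  define s where "s n y = (f (y + h n *\<^sub>R v) - f y) / h n" for n y
  have "(LINT y|lborel. s n y) = 0" for n
    unfolding s_def using lborel_integrable_translate[OF int_f, of "h n *\<^sub>R v"] int_f
    by (simp add: lborel_integral_translate[OF meas_f])
  moreover obtain R where R: "\<And>y. y \<in> K \<Longrightarrow> norm y \<le> R" using compact_imp_bounded[OF supp(1)] by (auto simp: bounded_iff)
  let ?w = "\<lambda>y. indicator (cball 0 (R + norm v)) y *\<^sub>R (\<bar>L\<bar> * norm v)"
  have "(\<lambda>n. LINT y|lborel. s n y) \<longlonglongrightarrow> (LINT y|lborel. f' y)"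
  proof (rule integral_dominated_convergence[where w = ?w])
    show "integrable lborel ?w" by (rule borel_integrable_compact) auto
    show "AE y in lborel. (\<lambda>n. s n y) \<longlonglongrightarrow> f' y"
      using deriv
    proof eventually_elim
      case (elim y)
      then have lim: "((\<lambda>t. (f (y + t *\<^sub>R v) - f y) / t) \<longlongrightarrow> f' y) (at 0)"
        by (simp add: DERIV_def)
      have "filterlim h (at 0) sequentially"
        unfolding filterlim_at using h(1) LIMSEQ_inverse_real_of_nat
        by (auto simp: h_def[abs_def] less_imp_neq[symmetric])
      from filterlim_compose[OF lim this] show ?case by (simp add: s_def)
    qed
    show "AE y in lborel. norm (s n y) \<le> ?w y" for n
    proof (rule AE_I2)
      fix y
      show "norm (s n y) \<le> ?w y"
      proof (cases "y \<in> cball 0 (R + norm v)")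
        case True
        have "\<bar>f (y + h n *\<^sub>R v) - f y\<bar> \<le> L * norm (h n *\<^sub>R v)" using lip[of "y + h n *\<^sub>R v" y] by simp
        also have "\<dots> \<le> \<bar>L\<bar> * (h n * norm v)" using h(1)[of n] by (auto intro!: mult_right_mono)
        finally have "\<bar>f (y + h n *\<^sub>R v) - f y\<bar> \<le> (\<bar>L\<bar> * norm v) * h n" by (simp add: algebra_simps)
        then show ?thesis using True h(1)[of n] by (simp add: s_def abs_divide pos_divide_le_eq)
      next
        case False
        have "norm (h n *\<^sub>R v) \<le> norm v" using h[of n] by (simp add: mult_left_le_one_le)
        moreover have "R + norm v < norm y" using False by simp
        ultimately have "R < norm (y + h n *\<^sub>R v)" "R < norm y"
          using norm_diff_ineq[of y "h n *\<^sub>R v"] norm_ge_zero[of v] by linarith+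
        then have "f (y + h n *\<^sub>R v) = 0" "f y = 0" using R supp(2) by (meson not_le)+
        then show ?thesis by (simp add: s_def)
      qed
    qed
    show "s n \<in> borel_measurable lborel" for n
      unfolding s_def using meas_f by measurable
  qed (rule meas)
  ultimately show ?thesis by (simp add: LIMSEQ_const_iff)
qed

context tetrahedron
begin

text \<open>
  A piecewise function without continuity: the piece \<open>Q i\<close> on the open cell
  \<open>i\<close>, and 0 off the open cells.
\<close>

definition pw :: "(4 \<Rightarrow> real ^ 3 \<Rightarrow> real) \<Rightarrow> real ^ 3 \<Rightarrow> real" where
  "pw Q y = (\<Sum>i\<in>UNIV. indicat_real (open_cell i) y * Q i y)"

lemma pw_cell: "y \<in> open_cell i \<Longrightarrow> pw Q y = Q i y"
proof -
  assume y: "y \<in> open_cell i"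
  have "indicat_real (open_cell j) y * Q j y = (if j = i then Q i y else 0)" for j
  proof (cases "j = i")
    case False
    then have "y \<notin> open_cell j" using open_cell_disjoint[OF y] by blast
    then show ?thesis using False by simp
  qed (use y in simp)
  then show ?thesis by (simp add: pw_def)
qed

lemma pw_outside: "(\<And>i. y \<notin> open_cell i) \<Longrightarrow> pw Q y = 0"
  by (simp add: pw_def)

lemma set_integrable_pol:
  fixes f :: "real ^ 3 \<Rightarrow> 'b::{banach, second_countable_topology}"
  assumes "f \<in> pol d"
  shows "set_integrable lborel (open_cell i) f"
proof (rule set_integrable_subset)
  show "set_integrable lborel (alfeld x i) f"
    unfolding set_integrable_def
    by (rule borel_integrable_compact[OF compact_alfeld pol_continuous[OF assms]])
  show "open_cell i \<in> sets lborel" using open_open_cell by simp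
qed (rule open_cell_subset)

lemma pw_integrable: "(\<And>i. Q i \<in> pol d) \<Longrightarrow> integrable lborel (pw Q)"
  unfolding pw_def[abs_def] using set_integrable_pol[of "Q _" d]
  by (intro Bochner_Integration.integrable_sum) (simp add: set_integrable_def)

lemma integral_pw: "(\<And>i. Q i \<in> pol d) \<Longrightarrow> (LINT y|lborel. pw Q y) = (\<Sum>i\<in>UNIV. LINT y:open_cell i|lborel. Q i y)"
  unfolding pw_def set_lebesgue_integral_def using set_integrable_pol[of "Q _" d]
  by (subst Bochner_Integration.integral_sum) (auto simp: set_integrable_def)

definition skeleton :: "(real ^ 3) set" where
  "skeleton = (\<Union>i. {y. bary i y = 0}) \<union> (\<Union>i. \<Union>j\<in>UNIV - {i}. {y. bary i y = bary j y})"

lemma AE_not_skeleton: "AE y in lborel. y \<notin> skeleton"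
proof (rule AE_lborel_not_in)
  have "closed skeleton" unfolding skeleton_def
    by (intro closed_Un closed_UN ballI closed_Collect_eq continuous_intros) auto
  then show "skeleton \<in> sets borel" by simp
  have 1: "negligible {y. bary i y = 0}" for i
  proof -
    have "{y. bary i y = 0} = {y. grad_bary i \<bullet> y = grad_bary i \<bullet> x 0 - (if i = 0 then 1 else 0)}"
      by (auto simp: bary_def inner_diff_right)
    then show ?thesis using negligible_hyperplane[of "grad_bary i"] grad_bary_0[of i] by simp
  qed
  have 2: "negligible {y. bary i y = bary j y}" if "j \<in> UNIV - {i}" for i j
  proof -
    have "{y. bary i y = bary j y} = {y. (grad_bary i - grad_bary j) \<bullet> y =
        (grad_bary i - grad_bary j) \<bullet> x 0 + (if j = 0 then 1 else 0) - (if i = 0 then 1 else 0)}"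
      by (auto simp: bary_def inner_diff_right inner_diff_left)
    moreover have "grad_bary i - grad_bary j \<noteq> 0"
      using grad_bary_dual[of i i j] grad_bary_dual[of j i j] that by auto
    ultimately show ?thesis using negligible_hyperplane[of "grad_bary i - grad_bary j"] by simp
  qed
  have 3: "negligible (\<Union>j\<in>UNIV - {i}. {y. bary i y = bary j y})" for i
    by (intro negligible_Union finite_imageI) (auto intro: 2)
  show "negligible skeleton" unfolding skeleton_def
    by (intro negligible_Un negligible_Union finite_imageI) (auto intro: 1 3)
qed

lemma not_skeleton_cases:
  assumes "y \<notin> skeleton"
  obtains i where "y \<in> open_cell i" | i where "bary i y < 0"
proof (cases "y \<in> tetra x")
  case True
  then obtain i where i: "y \<in> alfeld x i" using tetra_cover by blast
  have "bary i y \<noteq> 0" "\<And>j. j \<noteq> i \<Longrightarrow> bary i y \<noteq> bary j y" using assms by (auto simp: skeleton_def)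
  then have "y \<in> open_cell i" using i by (auto simp: open_cell_def alfeld_eq order_le_less)
  then show thesis by (rule that)
next
  case False
  then show thesis using that by (auto simp: tetra_eq not_le)
qed

lemma glue_integrable:
  fixes P :: "4 \<Rightarrow> real ^ 3 \<Rightarrow> 'b::{banach, second_countable_topology}"
  assumes "compat P" "\<And>i. P i \<in> pol d"
  shows "set_integrable lborel (tetra x) (glue P)"
  unfolding set_integrable_def using glue_C0[OF assms]
  by (intro borel_integrable_compact compact_tetra) (simp add: C0_def)

lemma integral_glue_eq_pw:
  assumes "compat Q" "\<And>i. Q i \<in> pol d"
  shows "(LINT y:tetra x|lborel. glue Q y) = (LINT y|lborel. pw Q y)"
  unfolding set_lebesgue_integral_def
proof (rule integral_cong_AE)
  show "(\<lambda>y. indicat_real (tetra x) y *\<^sub>R glue Q y) \<in> borel_measurable lborel"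
    using glue_integrable[OF assms] unfolding set_integrable_def by (rule borel_measurable_integrable)
  show "pw Q \<in> borel_measurable lborel" using pw_integrable[OF assms(2)] by (rule borel_measurable_integrable)
  show "AE y in lborel. indicat_real (tetra x) y *\<^sub>R glue Q y = pw Q y"
    using AE_not_skeleton
  proof eventually_elim
    case (elim y)
    then show ?case
    proof (rule not_skeleton_cases)
      fix i assume y: "y \<in> open_cell i"
      then have "y \<in> alfeld x i" "y \<in> tetra x" using open_cell_subset alfeld_subset by blast+
      then show ?thesis using glue_eq[OF assms(1)] pw_cell[OF y] by simp
    next
      fix i assume "bary i y < 0"
      then have "y \<notin> tetra x" by (auto simp: tetra_eq not_le)
      moreover from this have "pw Q y = 0" using open_cell_subset alfeld_subset by (intro pw_outside) blast
      ultimately show ?thesis by simp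
    qed
  qed
qed

lemma pol_lipschitz:
  fixes f :: "real ^ 3 \<Rightarrow> real"
  assumes "f \<in> pol d"
  shows "\<exists>L\<ge>0. lipschitz_on L (tetra x) f"
  using assms
proof (induction rule: pol_induct)
  case (const c)
  show ?case by (rule exI[of _ 0]) (auto intro: lipschitz_onI)
next
  case (zero d)
  show ?case by (rule exI[of _ 0]) (auto intro: lipschitz_onI)
next
  case (add d f g)
  then obtain L M where "0 \<le> L" "lipschitz_on L (tetra x) f" "0 \<le> M" "lipschitz_on M (tetra x) g" by blast
  then show ?case by (intro exI[of _ "L + M"]) (auto intro: lipschitz_on_add)
next
  case (bary d i f)
  then obtain L where L: "0 \<le> L" "lipschitz_on L (tetra x) f" by blast
  have "bounded (f ` tetra x)"
    by (intro compact_imp_bounded compact_continuous_image pol_continuous[OF bary(1)] compact_tetra)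
  then obtain B where B: "0 < B" "\<And>y. y \<in> tetra x \<Longrightarrow> \<bar>f y\<bar> \<le> B" by (auto simp: bounded_pos)
  have b1: "\<bar>bary i y\<bar> \<le> 1" if "y \<in> tetra x" for y
  proof -
    have "bary i y \<le> (\<Sum>j\<in>UNIV. bary j y)" using that by (intro member_le_sum) (auto simp: tetra_eq)
    then show ?thesis using that by (simp add: sum_bary tetra_eq)
  qed
  have "lipschitz_on (L + B * norm (grad_bary i)) (tetra x) (\<lambda>y. bary i y *\<^sub>R f y)"
  proof (rule lipschitz_onI)
    fix y y' assume y: "y \<in> tetra x" "y' \<in> tetra x"
    have "bary i y * f y - bary i y' * f y' = bary i y * (f y - f y') + f y' * (bary i y - bary i y')"
      by (simp add: algebra_simps)
    also have "\<bar>\<dots>\<bar> \<le> \<bar>bary i y\<bar> * \<bar>f y - f y'\<bar> + \<bar>f y'\<bar> * \<bar>bary i y - bary i y'\<bar>"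
      by (rule order_trans[OF abs_triangle_ineq]) (simp add: abs_mult)
    also have "\<dots> \<le> 1 * (L * dist y y') + B * (norm (grad_bary i) * dist y y')"
      using y L(2) b1 B
      by (intro add_mono mult_mono) (auto simp: lipschitz_on_def dist_real_def bary_diff dist_norm Cauchy_Schwarz_ineq2 less_imp_le)
    finally show "dist (bary i y *\<^sub>R f y) (bary i y' *\<^sub>R f y') \<le> (L + B * norm (grad_bary i)) * dist y y'"
      by (simp add: dist_real_def algebra_simps)
  qed (use L B in auto)
  then show ?case using L(1) B(1) by (intro exI[of _ "L + B * norm (grad_bary i)"]) auto
qed

text \<open>
  On each line the tetrahedron cuts the parameter interval into closed sets on which the
  function is a Lipschitz polynomial or 0, and continuity joins them.
\<close>

lemma glue_lipschitz:
  fixes P :: "4 \<Rightarrow> real ^ 3 \<Rightarrow> real"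
  assumes P: "compat P" "\<And>i. P i \<in> pol d" and zero: "\<And>i y. bary i y = 0 \<Longrightarrow> P i y = 0"
  obtains L where "\<And>y y'. \<bar>glue P y - glue P y'\<bar> \<le> L * norm (y - y')"
proof -
  have "\<forall>i. \<exists>L. 0 \<le> L \<and> lipschitz_on L (tetra x) (P i)" using pol_lipschitz[OF P(2)] by blast
  then obtain L where L: "\<And>i. 0 \<le> L i" "\<And>i. lipschitz_on (L i) (tetra x) (P i)"
    using choice[of "\<lambda>i L. 0 \<le> L \<and> lipschitz_on L (tetra x) (P i)"] by blast
  define M where "M = (\<Sum>i\<in>UNIV. L i)"
  have M: "0 \<le> M" "L i \<le> M" for i unfolding M_def using L(1) by (auto intro: sum_nonneg member_le_sum)
  have z: "glue P y = 0" if "bary i y \<le> 0" for i y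
  proof (cases "y \<in> tetra x")
    case True
    then have "y \<in> alfeld x i" and "bary i y = 0" using that by (auto simp: tetra_eq alfeld_eq intro: antisym order_trans)
    then show ?thesis using glue_eq[OF P(1)] zero by simp
  qed (rule glue_outside)
  have "\<bar>glue P y - glue P y'\<bar> \<le> M * norm (y - y')" for y y'
  proof -
    let ?l = "\<lambda>t. y + t *\<^sub>R (y' - y)"
    \<comment> \<open>\<open>None\<close> stands for the closed complement, where the function is 0\<close>
    define U where "U k = (case k of None \<Rightarrow> \<Union>i. {t. bary i (?l t) \<le> 0} | Some i \<Rightarrow> ?l -` alfeld x i)" for k
    have "lipschitz_on (M * norm (y' - y)) {0..1} (\<lambda>t. glue P (?l t))"
    proof (rule lipschitz_on_closed_Union[where I = UNIV and U = U])
      show "0 \<le> M * norm (y' - y)" using M by simp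
      show "closed (U k)" for k
        unfolding U_def
        by (cases k) (auto intro!: closed_UN closed_Collect_le continuous_intros closed_vimage closed_alfeld)
      show "{0..1} \<subseteq> (\<Union>k\<in>UNIV. U k)"
      proof
        fix t assume "t \<in> {0..1::real}"
        show "t \<in> (\<Union>k\<in>UNIV. U k)"
        proof (cases "?l t \<in> tetra x")
          case True
          then obtain i where "?l t \<in> alfeld x i" using tetra_cover by blast
          then have "t \<in> U (Some i)" by (simp add: U_def)
          then show ?thesis by blast
        next
          case False
          then obtain i where "\<not> 0 \<le> bary i (?l t)" by (auto simp: tetra_eq)
          then have "t \<in> U None" by (auto simp: U_def intro!: exI[of _ i])
          then show ?thesis by blast
        qed
      qed
      show "lipschitz_on (M * norm (y' - y)) (U k) (\<lambda>t. glue P (?l t))" for k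
      proof (rule lipschitz_onI)
        fix s t assume st: "s \<in> U k" "t \<in> U k"
        show "dist (glue P (?l s)) (glue P (?l t)) \<le> M * norm (y' - y) * dist s t"
        proof (cases k)
          case None
          then have "glue P (?l s) = 0" "glue P (?l t) = 0" using st z by (auto simp: U_def)
          then show ?thesis using M by simp
        next
          case (Some i)
          then have c: "?l s \<in> alfeld x i" "?l t \<in> alfeld x i" using st by (auto simp: U_def)
          then have "?l s \<in> tetra x" "?l t \<in> tetra x" using alfeld_subset by blast+
          then have "dist (P i (?l s)) (P i (?l t)) \<le> L i * dist (?l s) (?l t)"
            by (rule lipschitz_onD[OF L(2)])
          also have "\<dots> \<le> M * dist (?l s) (?l t)" by (intro mult_right_mono M) auto
          also have "dist (?l s) (?l t) = norm (y' - y) * dist s t"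
            by (simp add: dist_norm abs_minus_commute flip: scaleR_diff_left)
          finally show ?thesis using glue_eq[OF P(1)] c by (simp add: mult.assoc)
        qed
      qed (use M in simp)
    qed auto
    from lipschitz_onD[OF this, of 0 1] show ?thesis by (simp add: dist_norm norm_minus_commute)
  qed
  then show thesis by (rule that)
qed

lemma integral_directional_derivative:
  fixes P :: "4 \<Rightarrow> real ^ 3 \<Rightarrow> real"
  assumes P: "compat P" "\<And>i. P i \<in> pol d" and zero: "\<And>i y. bary i y = 0 \<Longrightarrow> P i y = 0"
  shows "(LINT y|lborel. pw (\<lambda>i y. frechet_derivative (P i) (at y) v) y) = 0"
proof -
  obtain L where L: "\<And>y y'. \<bar>glue P y - glue P y'\<bar> \<le> L * norm (y - y')"
    using glue_lipschitz[OF P zero] by blast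
  show ?thesis
  proof (rule integral_derivative_zero[where f = "glue P" and K = "tetra x" and v = v, OF L compact_tetra glue_outside])
    show "pw (\<lambda>i y. frechet_derivative (P i) (at y) v) \<in> borel_measurable lborel"
      by (intro borel_measurable_integrable pw_integrable[where d = "d - 1"] pol_deriv(2)[OF P(2)])
    have line: "((\<lambda>t. g (y + t *\<^sub>R v)) has_real_derivative g' v) (at 0)"
      if "(g has_derivative g') (at y)" for g :: "real ^ 3 \<Rightarrow> real" and g' y
    proof -
      have "((\<lambda>t. y + t *\<^sub>R v) has_derivative (\<lambda>t. t *\<^sub>R v)) (at 0)"
        by (auto intro!: derivative_eq_intros)
      moreover have "(g has_derivative g') (at (y + 0 *\<^sub>R v))" using that by simp
      ultimately have "((\<lambda>t. g (y + t *\<^sub>R v)) has_derivative (\<lambda>t. g' (t *\<^sub>R v))) (at 0)"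
        by (rule has_derivative_compose)
      moreover have "(\<lambda>t. g' (t *\<^sub>R v)) = (*) (g' v)"
        using linear_scale[OF has_derivative_linear[OF that]] by (auto simp: mult.commute)
      ultimately show ?thesis by (simp only: has_field_derivative_def)
    qed
    show "AE y in lborel. ((\<lambda>t. glue P (y + t *\<^sub>R v)) has_real_derivative
        pw (\<lambda>i y. frechet_derivative (P i) (at y) v) y) (at 0)"
      using AE_not_skeleton
    proof eventually_elim
      case (elim y)
      then show ?case
      proof (rule not_skeleton_cases)
        fix i assume y: "y \<in> open_cell i"
        then have "y \<in> interior (alfeld x i)" using open_cell_interior by blast
        from line[OF glue_has_derivative[OF P(1,2) this]] show ?thesis by (simp add: pw_cell[OF y])
      next
        fix i assume y: "bary i y < 0"
        have "(glue P has_derivative (\<lambda>_. 0)) (at y)"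
        proof (rule has_derivative_transform_within_open[of "\<lambda>_. 0" _ _ _ "{y. bary i y < 0}"])
          show "open {y. bary i y < 0}" by (intro open_Collect_less continuous_intros)
          fix z assume "z \<in> {y. bary i y < 0}"
          then have "z \<notin> tetra x" by (auto simp: tetra_eq not_le)
          then show "0 = glue P z" by (simp add: glue_outside)
        qed (use y in auto)
        from line[OF this] have "((\<lambda>t. glue P (y + t *\<^sub>R v)) has_real_derivative 0) (at 0)" .
        moreover have "y \<notin> tetra x" using y by (auto simp: tetra_eq not_le)
        then have "y \<notin> open_cell j" for j using open_cell_subset alfeld_subset by blast
        ultimately show ?thesis by (simp add: pw_outside)
      qed
    qed
  qed
qed

lemma integral_divergence:
  fixes P :: "4 \<Rightarrow> real ^ 3 \<Rightarrow> real ^ 3"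
  assumes P: "compat P" "\<And>i. P i \<in> pol d" and zero: "\<And>i y. bary i y = 0 \<Longrightarrow> P i y = 0"
  shows "(LINT y|lborel. pw (\<lambda>i. pt_div (P i)) y) = 0"
proof -
  let ?p = "\<lambda>j i y. axis j 1 \<bullet> P i y"
  have p: "?p j i \<in> pol d" for i j by (rule pol_inner[OF P(2)])
  have fd: "frechet_derivative (?p j i) (at y) v = axis j 1 \<bullet> frechet_derivative (P i) (at y) v" for i j y v
    using frechet_derivative_eq[OF has_derivative_inner_right[OF pol_deriv(1)[OF P(2)[of i], of y]], of "axis j 1"] by simp
  have int: "integrable lborel (pw (\<lambda>i y. frechet_derivative (?p j i) (at y) (axis j 1)))" for j
    by (intro pw_integrable[where d = "d - 1"] pol_deriv(2)[OF p])
  have "pw (\<lambda>i. pt_div (P i)) = (\<lambda>y. \<Sum>j\<in>UNIV. pw (\<lambda>i y. frechet_derivative (?p j i) (at y) (axis j 1)) y)"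
  proof
    fix y
    show "pw (\<lambda>i. pt_div (P i)) y = (\<Sum>j\<in>UNIV. pw (\<lambda>i y. frechet_derivative (?p j i) (at y) (axis j 1)) y)"
      unfolding pw_def pt_div_pol[OF P(2)] fd by (subst sum.swap) (simp add: sum_distrib_left)
  qed
  then have "(LINT y|lborel. pw (\<lambda>i. pt_div (P i)) y) =
      (\<Sum>j\<in>UNIV. LINT y|lborel. pw (\<lambda>i y. frechet_derivative (?p j i) (at y) (axis j 1)) y)"
    by (simp only: Bochner_Integration.integral_sum[OF int])
  also have "\<dots> = 0"
  proof (rule sum.neutral, rule ballI, rule integral_directional_derivative[OF _ p])
    fix j :: 3
    show "compat (?p j)"
      by (rule compat_combine[OF P(1) P(1), where h = "\<lambda>_ _ p _. axis j 1 \<bullet> p"])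
  qed (simp add: zero)
  finally show ?thesis .
qed

section \<open>Definiteness, and exactness in terms of pieces\<close>

lemma glue_L2_zero:
  fixes P :: "4 \<Rightarrow> real ^ 3 \<Rightarrow> 'b::euclidean_space"
  assumes P: "compat P" "\<And>i. P i \<in> pol d" and zero: "(LINT y:tetra x|lborel. glue P y \<bullet> glue P y) = 0"
  shows "P i y = 0"
proof (rule pol_zero_on_cell[OF P(2)])
  fix z assume z: "z \<in> open_cell i"
  have cont: "continuous_on (tetra x) (glue P)" using glue_C0[OF P] by (simp add: C0_def)
  let ?g = "\<lambda>y. indicat_real (tetra x) y *\<^sub>R (glue P y \<bullet> glue P y)"
  have "integrable lborel ?g"
    by (intro borel_integrable_compact compact_tetra continuous_intros cont)
  then have "AE y in lborel. ?g y = 0"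
    using zero integral_nonneg_eq_0_iff_AE[of lborel ?g] by (simp add: set_lebesgue_integral_def)
  then have "AE y in lborel. y \<notin> {y \<in> open_cell i. P i y \<noteq> 0}"
  proof eventually_elim
    case (elim y)
    show ?case
    proof
      assume "y \<in> {y \<in> open_cell i. P i y \<noteq> 0}"
      then have "y \<in> alfeld x i" "y \<in> tetra x" "P i y \<noteq> 0" using open_cell_subset alfeld_subset by blast+
      then show False using elim glue_eq[OF P(1)] by simp
    qed
  qed
  moreover have "open {y \<in> open_cell i. P i y \<noteq> 0}"
  proof -
    have "{y \<in> open_cell i. P i y \<noteq> 0} = open_cell i \<inter> {y. P i y \<noteq> 0}" by auto
    also have "open \<dots>"
      by (intro open_Int open_open_cell open_Collect_neq pol_continuous[OF P(2)] continuous_on_const)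
    finally show ?thesis .
  qed
  ultimately have "{y \<in> open_cell i. P i y \<noteq> 0} = {}" by (rule AE_zero_on_open[rotated])
  then show "P i z = 0" using z by blast
qed


text \<open>
  Exactness: fields with zero boundary values and zero divergence have a vector potential that
  vanishes on the boundary and has one degree more. Vanishing on the boundary splits off the
  first factor \<open>bary i\<close>; continuity gives the normal continuity that the
  construction starts from.
\<close>

lemma curl_potential:
  assumes P: "compat P" "\<And>i. P i \<in> pol (Suc n)" and zero: "\<And>i y. bary i y = 0 \<Longrightarrow> P i y = 0"
    and div: "\<And>i y. pt_div (P i) y = 0"
  obtains V where "\<And>i. V i \<in> pol (Suc (Suc n))" "compat V" "\<And>i y. bary i y = 0 \<Longrightarrow> V i y = 0"
    "\<And>i. pt_curl (V i) = P i"
proof -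
  obtain E where E: "\<And>i. E i \<in> pol n" "\<And>i. P i = (\<lambda>y. bary i y *\<^sub>R E i y)"
    using pol_divisible_family[of P n, OF P(2) zero] by blast
  have N: "(grad_bary i - grad_bary j) \<bullet> (E i y - E j y) = 0" if "bary i y = bary j y" for i j y
  proof -
    have "E i y - E j y = 0"
    proof (rule pol_zero_off_interface[OF pol_diff[OF E(1) E(1)] _ that])
      fix y assume y: "bary i y = bary j y" "bary i y \<noteq> 0"
      from compatD[OF P(1) y(1)] have "bary i y *\<^sub>R E i y = bary i y *\<^sub>R E j y" by (simp add: E(2) y(1))
      then show "E i y - E j y = 0" using y(2) by simp
    qed
    then show ?thesis by simp
  qed
  have D: "(1 + real 0) * (grad_bary i \<bullet> E i y) + bary i y * pt_div (E i) y = 0" for i y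
    using div[of i y] pt_div_bary_power[OF E(1), of i 0 i y] by (simp add: E(2))
  obtain V where V: "\<And>i. V i \<in> pol (0 + 2 + n)" "compat V" "\<And>i y. bary i y = 0 \<Longrightarrow> V i y = 0"
    "\<And>i y. pt_curl (V i) y = bary i y ^ Suc 0 *\<^sub>R E i y"
    using curl_potential_pieces[OF E(1) N D] by blast
  show thesis
  proof (rule that[OF _ V(2,3)])
    show "V i \<in> pol (Suc (Suc n))" for i using V(1)[of i] by simp
    show "pt_curl (V i) = P i" for i by (rule ext) (simp add: V(4) E(2))
  qed
qed

lemma pw_add: "pw (\<lambda>i y. P i y + Q i y) y = pw P y + pw Q y"
  by (simp only: pw_def distrib_left sum.distrib)

lemma pw_scale: "pw (\<lambda>i y. c * P i y) y = c * pw P y"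
  by (simp only: pw_def sum_distrib_left mult.left_commute)

lemma integral_open_cell_bary_power_pos: "0 < (LINT y:open_cell i|lborel. bary i y ^ k)"
proof -
  let ?g = "\<lambda>y. indicat_real (open_cell i) y *\<^sub>R bary i y ^ k"
  have int: "integrable lborel ?g"
    using set_integrable_pol[OF pol_bary_power] by (simp add: set_integrable_def)
  have nonneg: "AE y in lborel. 0 \<le> ?g y" by (rule AE_I2) (auto simp: indicator_def open_cell_def)
  have "(LINT y|lborel. ?g y) \<noteq> 0"
  proof
    assume "(LINT y|lborel. ?g y) = 0"
    then have "AE y in lborel. ?g y = 0" using integral_nonneg_eq_0_iff_AE[OF int nonneg] by simp
    then have "AE y in lborel. y \<notin> open_cell i"
    proof eventually_elim
      case (elim y)
      show ?case
      proof
        assume y: "y \<in> open_cell i"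
        then have "bary i y ^ k = 0" using elim by simp
        moreover have "0 < bary i y" using y by (simp add: open_cell_def)
        ultimately show False by simp
      qed
    qed
    then have "open_cell i = {}" by (rule AE_zero_on_open[OF open_open_cell])
    then show False using open_cell_nonempty[of i] by simp
  qed
  moreover have "0 \<le> (LINT y|lborel. ?g y)" using nonneg by (rule integral_nonneg_AE)
  ultimately show ?thesis by (simp add: set_lebesgue_integral_def)
qed

lemma integral_pw_divergence_bary_power:
  assumes "w \<in> pol s"
  shows "(LINT y|lborel. pw (\<lambda>i. pt_div (\<lambda>y. bary i y ^ Suc k *\<^sub>R w y)) y) = 0"
proof (rule integral_divergence)
  show "compat (\<lambda>i y. bary i y ^ Suc k *\<^sub>R w y)" by (rule compatI) simp
  show "(\<lambda>y. bary i y ^ Suc k *\<^sub>R w y) \<in> pol (Suc k + s)" for i by (rule pol_bary_power_mult[OF assms])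
qed simp

text \<open>
  By the divergence theorem for constant \<open>w\<close>, tested with the edge vector
  \<open>x i - x j\<close>, which has inner product 0 with the other two gradients.
\<close>

lemma integral_open_cell_bary_power_eq: "(LINT y:open_cell i|lborel. bary i y ^ k) = (LINT y:open_cell j|lborel. bary j y ^ k)"
proof -
  let ?I = "\<lambda>i. LINT y:open_cell i|lborel. bary i y ^ k"
  let ?w = "\<lambda>y :: real ^ 3. x i - x j"
  have w: "?w \<in> pol 0" by (rule pol_const)
  have dw: "pt_div ?w y = 0" for y
    using pt_div_eq[OF has_derivative_const, of "x i - x j" y] by simp
  have eq: "pt_div (\<lambda>y. bary l y ^ Suc k *\<^sub>R ?w y) y = ((1 + real k) * (grad_bary l \<bullet> (x i - x j))) * bary l y ^ k" for l y
    unfolding pt_div_bary_power[OF w] dw by simp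
  have "0 = (LINT y|lborel. pw (\<lambda>l. pt_div (\<lambda>y. bary l y ^ Suc k *\<^sub>R ?w y)) y)"
    by (rule integral_pw_divergence_bary_power[OF w, symmetric])
  also have "\<dots> = (\<Sum>l\<in>UNIV. LINT y:open_cell l|lborel. ((1 + real k) * (grad_bary l \<bullet> (x i - x j))) * bary l y ^ k)"
    unfolding eq by (rule integral_pw[where d = k]) (intro pol_mult_const pol_bary_power)
  also have "\<dots> = (\<Sum>l\<in>UNIV. (1 + real k) * (?I l * ((if l = i then 1 else 0) - (if l = j then 1 else 0))))"
    by (intro sum.cong) (simp_all add: grad_bary_dual)
  also have "\<dots> = (1 + real k) * (?I i - ?I j)"
    by (simp add: right_diff_distrib sum_subtractf if_distrib[of "\<lambda>a. _ * a"] cong: if_cong flip: sum_distrib_left)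
  finally show ?thesis by (simp add: add_nonneg_eq_0_iff)
qed

text \<open>
  As for the curl, \<open>div_step\<close> removes the leading term
  and leaves one more power of \<open>bary i\<close>. The mean value is preserved by the
  divergence theorem; in degree 0 it is the solvability condition of
  \<open>grad_bary_inner_solve\<close>, because the four integrals of \<open>bary i ^ k\<close>
  are equal.
\<close>

lemma div_potential_pieces:
  assumes "\<And>i. p i \<in> pol s" "(LINT y|lborel. pw (\<lambda>i y. bary i y ^ k * p i y) y) = 0"
  shows "\<exists>V. (\<forall>i. V i \<in> pol (Suc k + s)) \<and> compat V \<and> (\<forall>i y. bary i y = 0 \<longrightarrow> V i y = 0) \<and>
             (\<forall>i y. pt_div (V i) y = bary i y ^ k * p i y)"
  using assms
proof (induction s arbitrary: k p)
  case 0
  have "\<forall>i. \<exists>c. p i = (\<lambda>y. c)" using 0(1) pol_0E by blast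
  then obtain c where c: "\<And>i. p i = (\<lambda>y. c i)" using choice[of "\<lambda>i c. p i = (\<lambda>y. c)"] by blast
  let ?I = "LINT y:open_cell 0|lborel. bary 0 y ^ k"
  have "0 = (\<Sum>i\<in>UNIV. LINT y:open_cell i|lborel. bary i y ^ k * p i y)"
  proof (subst integral_pw[where d = k, symmetric])
    show "(\<lambda>y. bary i y ^ k * p i y) \<in> pol k" for i
      using pol_mult[OF pol_bary_power 0(1)] by simp
  qed (simp add: 0(2))
  also have "\<dots> = (\<Sum>i\<in>UNIV. ?I * c i)"
  proof (rule sum.cong[OF refl])
    fix i
    have "(LINT y:open_cell i|lborel. bary i y ^ k * p i y) = (LINT y:open_cell i|lborel. bary i y ^ k) * c i"
      by (simp add: c)
    then show "(LINT y:open_cell i|lborel. bary i y ^ k * p i y) = ?I * c i"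
      by (simp only: integral_open_cell_bary_power_eq[of i k 0])
  qed
  finally have "(\<Sum>i\<in>UNIV. c i) = 0"
    using integral_open_cell_bary_power_pos[of 0 k] by (simp flip: sum_distrib_left)
  note sol = grad_bary_inner_solve[OF this]
  define w where "w = (\<lambda>y :: real ^ 3. (1 / (1 + real k)) *\<^sub>R (\<Sum>j\<in>UNIV. c j *\<^sub>R (x j - x 0)))"
  have w: "w \<in> pol 0" unfolding w_def by (rule pol_const)
  have gw: "(1 + real k) * (grad_bary i \<bullet> w y) = c i" for i y
    by (simp only: w_def inner_scaleR_right sol) (simp add: add_nonneg_eq_0_iff)
  have dw: "pt_div w y = 0" for y
    unfolding w_def using pt_div_eq[OF has_derivative_const] by simp
  show ?case
  proof (intro exI[of _ "\<lambda>i y. bary i y ^ Suc k *\<^sub>R w y"] conjI allI)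
    show "(\<lambda>y. bary i y ^ Suc k *\<^sub>R w y) \<in> pol (Suc k + 0)" for i by (rule pol_bary_power_mult[OF w])
    show "compat (\<lambda>i y. bary i y ^ Suc k *\<^sub>R w y)" by (rule compatI) simp
    show "pt_div (\<lambda>y. bary i y ^ Suc k *\<^sub>R w y) y = bary i y ^ k * p i y" for i y
      unfolding pt_div_bary_power[OF w] gw dw c by simp
  qed simp
next
  case (Suc s)
  obtain w Q where w: "w \<in> pol (Suc s)" and Q: "\<And>i. Q i \<in> pol s"
    and split: "\<And>i y. (1 / (1 + real k)) * p i y = grad_bary i \<bullet> w y + bary i y * Q i y"
  proof (rule div_step[of "\<lambda>i y. (1 / (1 + real k)) * p i y" s])
    show "(\<lambda>y. (1 / (1 + real k)) * p i y) \<in> pol (Suc s)" for i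
      by (rule pol_mult_const[OF Suc.prems(1)])
  qed blast
  have split: "p i y = (1 + real k) * (grad_bary i \<bullet> w y) + (1 + real k) * (bary i y * Q i y)" for i y
  proof -
    have "p i y = (1 + real k) * ((1 / (1 + real k)) * p i y)" by (simp add: add_nonneg_eq_0_iff)
    then show ?thesis unfolding split by (simp add: distrib_left)
  qed
  \<comment> \<open>the scalar that remains, divided by \<open>bary i ^ Suc k\<close>\<close>
  define p' where "p' i = (\<lambda>y. (1 + real k) * Q i y - pt_div w y)" for i
  have p': "p' i \<in> pol s" for i
    unfolding p'_def using pol_pt_div[OF w] by (intro pol_diff pol_mult_const Q) simp
  have eq: "bary i y ^ k * p i y = pt_div (\<lambda>y. bary i y ^ Suc k *\<^sub>R w y) y + bary i y ^ Suc k * p' i y" for i y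
    unfolding pt_div_bary_power[OF w] split p'_def by (simp add: algebra_simps)
  have pw: "(\<lambda>y. bary i y ^ Suc k *\<^sub>R w y) \<in> pol (Suc k + Suc s)" for i
    by (rule pol_bary_power_mult[OF w])
  have int1: "integrable lborel (pw (\<lambda>i. pt_div (\<lambda>y. bary i y ^ Suc k *\<^sub>R w y)))"
    by (rule pw_integrable[where d = "k + Suc s"]) (use pol_pt_div[OF pw] in simp)
  have int2: "integrable lborel (pw (\<lambda>i y. bary i y ^ Suc k * p' i y))"
    by (rule pw_integrable[where d = "Suc k + s"]) (rule pol_mult[OF pol_bary_power p'])
  have "(LINT y|lborel. pw (\<lambda>i y. bary i y ^ Suc k * p' i y) y) = 0"
    using Suc.prems(2) unfolding eq pw_add
    by (simp only: Bochner_Integration.integral_add[OF int1 int2] integral_pw_divergence_bary_power[OF w] add_0)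
  from Suc.IH[OF p' this] obtain V where V: "\<And>i. V i \<in> pol (Suc (Suc k) + s)" "compat V" "\<And>i y. bary i y = 0 \<Longrightarrow> V i y = 0"
    "\<And>i y. pt_div (V i) y = bary i y ^ Suc k * p' i y" by blast
  show ?case
  proof (intro exI[of _ "\<lambda>i y. bary i y ^ Suc k *\<^sub>R w y + V i y"] conjI allI impI)
    show "(\<lambda>y. bary i y ^ Suc k *\<^sub>R w y + V i y) \<in> pol (Suc k + Suc s)" for i
      using V(1)[of i] by (intro pol_add pw) simp
    show "compat (\<lambda>i y. bary i y ^ Suc k *\<^sub>R w y + V i y)"
      by (rule compat_combine[OF V(2) V(2), where h = "\<lambda>b y p _. b ^ Suc k *\<^sub>R w y + p"])
    show "bary i y ^ Suc k *\<^sub>R w y + V i y = 0" if "bary i y = 0" for i y using V(3)[OF that] that by simp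
    show "pt_div (\<lambda>y. bary i y ^ Suc k *\<^sub>R w y + V i y) y = bary i y ^ k * p i y" for i y
      unfolding eq pt_div_add[OF pw V(1)] V(4) by simp
  qed
qed

end

section \<open>Dimensions of the test spaces on edges and faces\<close>

lemma PolyOn_negative: "r < 0 \<Longrightarrow> PolyOn r S = {\<lambda>y. 0}"
proof -
  assume "r < 0"
  then have empty: "{\<alpha> :: nat ^ 3. int (\<Sum>i\<in>UNIV. \<alpha> $ i) \<le> r} = {}"
    using of_nat_0_le_iff by (smt (verit) Collect_empty_eq)
  show ?thesis unfolding PolyOn_def empty by (auto simp: fun_eq_iff)
qed

lemma fun_dim_zero: "fun_dim {\<lambda>y. 0} = 0"
  by (rule fun_dim_basis_family[where J = "{}" and b = undefined, simplified])
     (auto simp: is_basis_family_def)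

context tetrahedron
begin

text \<open>
  On a subsimplex only the monomials in the coordinates of its own vertices survive.
\<close>

lemma is_basis_family_PolyOn:
  assumes "J \<noteq> {}"
  shows "is_basis_family {\<alpha> \<in> expos d. \<forall>i. i \<notin> J \<longrightarrow> \<alpha> i = 0}
    (\<lambda>\<alpha> y. if y \<in> convex hull (x ` J) then mon \<alpha> y else 0) (PolyOn (int d) (convex hull (x ` J)))"
    (is "is_basis_family ?A ?b _")
proof -
  let ?S = "convex hull (x ` J)"
  note S = convex_hull_subset_eq[OF assms]
  have drop: "(\<Sum>\<alpha>\<in>expos d. mon \<alpha> y *\<^sub>R a \<alpha>) = (\<Sum>\<alpha>\<in>?A. a \<alpha> *\<^sub>R mon \<alpha> y)" if "y \<in> ?S" for y and a :: "(4 \<Rightarrow> nat) \<Rightarrow> real"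
  proof -
    have "(\<Sum>\<alpha>\<in>expos d. mon \<alpha> y *\<^sub>R a \<alpha>) = (\<Sum>\<alpha>\<in>?A. mon \<alpha> y *\<^sub>R a \<alpha>)"
    proof (rule sum.mono_neutral_right)
      show "\<forall>\<alpha>\<in>expos d - ?A. mon \<alpha> y *\<^sub>R a \<alpha> = 0"
      proof
        fix \<alpha> assume "\<alpha> \<in> expos d - ?A"
        then obtain i where "i \<notin> J" "0 < \<alpha> i" by blast
        then have "mon \<alpha> y = 0" using that by (intro mon_zero[of i]) (auto simp: S)
        then show "mon \<alpha> y *\<^sub>R a \<alpha> = 0" by simp
      qed
    qed auto
    then show ?thesis by (simp add: mult.commute)
  qed
  show ?thesis
    unfolding is_basis_family_def
  proof (intro conjI allI impI)
    show "finite ?A" by simp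
    show "PolyOn (int d) ?S = {\<lambda>y. \<Sum>\<alpha>\<in>?A. c \<alpha> *\<^sub>R ?b \<alpha> y | c. True}"
    proof (intro equalityI subsetI)
      fix f assume "f \<in> PolyOn (int d) ?S"
      then obtain p where out: "\<And>y. y \<notin> ?S \<Longrightarrow> f y = 0" and p: "p \<in> pol d" "\<And>y. y \<in> ?S \<Longrightarrow> f y = p y"
        unfolding PolyOn_iff by blast
      obtain a where a: "p = (\<lambda>y. \<Sum>\<alpha>\<in>expos d. mon \<alpha> y *\<^sub>R a \<alpha>)" using p(1) by (rule polE)
      have "f = (\<lambda>y. \<Sum>\<alpha>\<in>?A. a \<alpha> *\<^sub>R ?b \<alpha> y)"
      proof
        fix y show "f y = (\<Sum>\<alpha>\<in>?A. a \<alpha> *\<^sub>R ?b \<alpha> y)"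
          using out[of y] p(2)[of y] drop[of y a] by (cases "y \<in> ?S") (simp_all add: a)
      qed
      then show "f \<in> {\<lambda>y. \<Sum>\<alpha>\<in>?A. c \<alpha> *\<^sub>R ?b \<alpha> y | c. True}" by blast
    next
      fix f assume "f \<in> {\<lambda>y. \<Sum>\<alpha>\<in>?A. c \<alpha> *\<^sub>R ?b \<alpha> y | c. True}"
      then obtain c where c: "f = (\<lambda>y. \<Sum>\<alpha>\<in>?A. c \<alpha> *\<^sub>R ?b \<alpha> y)" by blast
      show "f \<in> PolyOn (int d) ?S"
        unfolding PolyOn_iff
      proof (intro conjI allI impI bexI ballI)
        show "(\<lambda>y. \<Sum>\<alpha>\<in>?A. mon \<alpha> y *\<^sub>R c \<alpha>) \<in> pol d" by (intro pol_sum pol_mon) simp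
        show "f y = (\<Sum>\<alpha>\<in>?A. mon \<alpha> y *\<^sub>R c \<alpha>)" if "y \<in> ?S" for y using that by (simp add: c mult.commute)
      qed (simp add: c)
    qed
    fix c assume zero: "(\<lambda>y. \<Sum>\<alpha>\<in>?A. c \<alpha> *\<^sub>R ?b \<alpha> y) = (\<lambda>y. 0)"
    show "\<forall>\<alpha>\<in>?A. c \<alpha> = 0"
    proof
      fix \<beta> assume \<beta>: "\<beta> \<in> ?A"
      show "c \<beta> = 0"
      proof (rule bernstein_coeff_zero[OF assms, where d = d and a = c])
        fix y assume "\<And>i. i \<notin> J \<Longrightarrow> bary i y = 0" "\<And>i. i \<in> J \<Longrightarrow> 0 < bary i y"
        then have "y \<in> ?S" unfolding S by (auto simp: less_imp_le) (metis less_eq_real_def)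
        then show "(\<Sum>\<alpha>\<in>expos d. mon \<alpha> y *\<^sub>R c \<alpha>) = 0"
          using fun_cong[OF zero, of y] by (simp only: drop) simp
      qed (use \<beta> in auto)
    qed
  qed
qed

lemma fun_dim_PolyOn:
  assumes "J \<noteq> {}"
  shows "fun_dim (PolyOn (int d) (convex hull (x ` J))) = (d + card J - 1) choose (card J - 1)"
  using fun_dim_basis_family[OF is_basis_family_PolyOn[OF assms]] card_expos_supported[OF assms] by simp

lemma fun_dim_vec3_PolyOn:
  assumes "J \<noteq> {}"
  shows "fun_dim (vec3 (PolyOn (int d) (convex hull (x ` J)))) = 3 * ((d + card J - 1) choose (card J - 1))"
  using fun_dim_vec3[OF is_basis_family_PolyOn[OF assms]] fun_dim_PolyOn[OF assms] by simp

lemma card_edges: "card (edges x) = 6"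
proof -
  have "edges x = (\<lambda>(i, j). (x i, x j)) ` {(i, j). i < j}" by (auto simp: edges_def)
  moreover have "inj_on (\<lambda>(i, j). (x i, x j)) {(i, j). i < j}" using inj_x by (auto simp: inj_on_def inj_def)
  ultimately show ?thesis by (simp add: card_image card_increasing_pairs choose_two)
qed

lemma card_faces: "card (faces x) = 4"
proof -
  have "faces x = (\<lambda>(i, j, k). (x i, x j, x k)) ` {(i, j, k). i < j \<and> j < k}"
    unfolding faces_def by force
  moreover have "inj_on (\<lambda>(i, j, k). (x i, x j, x k)) {(i, j, k). i < j \<and> j < k}"
    using inj_x by (auto simp: inj_on_def inj_def)
  ultimately show ?thesis by (simp add: card_image card_increasing_triples) (simp add: numeral_eq_Suc)
qed

lemma sum_edges:
  fixes N :: nat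
  assumes "\<And>J. card J = 2 \<Longrightarrow> g (convex hull (x ` J)) = N"
  shows "(\<Sum>(a, b)\<in>edges x. g (convex hull {a, b})) = 6 * N"
proof -
  have "(\<Sum>(a, b)\<in>edges x. g (convex hull {a, b})) = (\<Sum>e\<in>edges x. N)"
  proof (rule sum.cong[OF refl], clarify)
    fix a b assume "(a, b) \<in> edges x"
    then obtain i j where "a = x i" "b = x j" "i < j" by (auto simp: edges_def)
    then show "g (convex hull {a, b}) = N" using assms[of "{i, j}"] by simp
  qed
  then show ?thesis by (simp add: card_edges)
qed

lemma sum_faces:
  fixes N :: nat
  assumes "\<And>J. card J = 3 \<Longrightarrow> g (convex hull (x ` J)) = N"
  shows "(\<Sum>(a, b, c)\<in>faces x. g (convex hull {a, b, c})) = 4 * N"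
proof -
  have "(\<Sum>(a, b, c)\<in>faces x. g (convex hull {a, b, c})) = (\<Sum>e\<in>faces x. N)"
  proof (rule sum.cong[OF refl], clarify)
    fix a b c assume "(a, b, c) \<in> faces x"
    then obtain i j k where "a = x i" "b = x j" "c = x k" "i < j" "j < k" by (auto simp: faces_def)
    moreover from this have "i \<noteq> j" "i \<noteq> k" "j \<noteq> k" by auto
    ultimately show "g (convex hull {a, b, c}) = N" using assms[of "{i, j, k}"] by simp
  qed
  then show ?thesis by (simp add: card_faces)
qed

section \<open>Dimension of the continuous piecewise polynomials\<close>

text \<open>
  Exponents of the monomials that do not vanish identically on the boundary, up to total
  degree \<open>s\<close>.
\<close>

definition boundary_expos :: "nat \<Rightarrow> (4 \<Rightarrow> nat) set" where
  "boundary_expos s = {\<alpha>. sum \<alpha> UNIV \<le> s \<and> (\<exists>i. \<alpha> i = 0)}"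

text \<open>
  The pieces of \<open>min\<^sub>i \<lambda>\<^sub>i ^ (s - |\<alpha>|)
  \<lambda>\<^sup>\<alpha>\<close>, where \<open>\<lambda>\<^sub>i\<close> are the barycentric
  coordinates.
\<close>

definition basis_piece :: "nat \<Rightarrow> (4 \<Rightarrow> nat) \<Rightarrow> 4 \<Rightarrow> real ^ 3 \<Rightarrow> real" where
  "basis_piece s \<alpha> i y = bary i y ^ (s - sum \<alpha> UNIV) * mon \<alpha> y"

lemma finite_boundary_expos [simp]: "finite (boundary_expos s)"
  by (rule finite_subset[of _ "\<Union>d\<le>s. expos d"]) (simp_all add: boundary_expos_def expos_def[symmetric], auto simp: expos_def)

lemma boundary_expos_0: "boundary_expos 0 = {\<lambda>_. 0}"
  by (auto simp: boundary_expos_def)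

lemma boundary_expos_Suc: "boundary_expos (Suc s) = {\<alpha> \<in> expos (Suc s). \<exists>i. \<alpha> i = 0} \<union> boundary_expos s"
  "{\<alpha> \<in> expos (Suc s). \<exists>i. \<alpha> i = 0} \<inter> boundary_expos s = {}"
  by (auto simp: boundary_expos_def expos_def)

lemma sum_boundary_expos_Suc:
  fixes c :: "(4 \<Rightarrow> nat) \<Rightarrow> real"
  shows "(\<Sum>\<alpha>\<in>boundary_expos (Suc s). c \<alpha> * basis_piece (Suc s) \<alpha> i y) =
   (\<Sum>\<alpha>\<in>{\<alpha> \<in> expos (Suc s). \<exists>i. \<alpha> i = 0}. mon \<alpha> y *\<^sub>R c \<alpha>) + bary i y * (\<Sum>\<alpha>\<in>boundary_expos s. c \<alpha> * basis_piece s \<alpha> i y)"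
proof -
  have 1: "c \<alpha> * basis_piece (Suc s) \<alpha> i y = mon \<alpha> y *\<^sub>R c \<alpha>" if "\<alpha> \<in> {\<alpha> \<in> expos (Suc s). \<exists>i. \<alpha> i = 0}" for \<alpha>
    using that by (simp add: basis_piece_def expos_def)
  have 2: "c \<alpha> * basis_piece (Suc s) \<alpha> i y = bary i y * (c \<alpha> * basis_piece s \<alpha> i y)" if "\<alpha> \<in> boundary_expos s" for \<alpha>
    using that by (simp add: basis_piece_def boundary_expos_def Suc_diff_le)
  have "(\<Sum>\<alpha>\<in>boundary_expos (Suc s). c \<alpha> * basis_piece (Suc s) \<alpha> i y) =
     (\<Sum>\<alpha>\<in>{\<alpha> \<in> expos (Suc s). \<exists>i. \<alpha> i = 0}. c \<alpha> * basis_piece (Suc s) \<alpha> i y) + (\<Sum>\<alpha>\<in>boundary_expos s. c \<alpha> * basis_piece (Suc s) \<alpha> i y)"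
    unfolding boundary_expos_Suc(1) by (rule sum.union_disjoint) (simp_all add: boundary_expos_Suc(2))
  also have "\<dots> = (\<Sum>\<alpha>\<in>{\<alpha> \<in> expos (Suc s). \<exists>i. \<alpha> i = 0}. mon \<alpha> y *\<^sub>R c \<alpha>) + (\<Sum>\<alpha>\<in>boundary_expos s. bary i y * (c \<alpha> * basis_piece s \<alpha> i y))"
    by (simp only: 1 2 cong: sum.cong)
  finally show ?thesis by (simp add: sum_distrib_left)
qed

lemma pol_basis_piece: "\<alpha> \<in> boundary_expos s \<Longrightarrow> basis_piece s \<alpha> i \<in> pol s"
proof -
  assume \<alpha>: "\<alpha> \<in> boundary_expos s"
  have "(\<lambda>y. mon \<alpha> y *\<^sub>R (1::real)) \<in> pol (sum \<alpha> UNIV)" by (rule pol_mon) (simp add: expos_def)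
  then have "(\<lambda>y. bary i y ^ (s - sum \<alpha> UNIV) * mon \<alpha> y) \<in> pol (s - sum \<alpha> UNIV + sum \<alpha> UNIV)"
    by (intro pol_mult pol_bary_power) simp
  then show ?thesis using \<alpha> by (simp add: basis_piece_def[abs_def] boundary_expos_def)
qed

lemma compat_divide_bary:
  fixes Q :: "4 \<Rightarrow> real ^ 3 \<Rightarrow> real"
  assumes "\<And>i. Q i \<in> pol d" "\<And>i j y. bary i y = bary j y \<Longrightarrow> bary i y * Q i y = bary j y * Q j y"
  shows "compat Q"
proof (rule compatI)
  fix i j y assume y: "bary i y = bary j y"
  have "Q i y - Q j y = 0"
  proof (rule pol_zero_off_interface[OF pol_diff[OF assms(1) assms(1)] _ y])
    fix z assume z: "bary i z = bary j z" "bary i z \<noteq> 0"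
    then show "Q i z - Q j z = 0" using assms(2)[OF z(1)] by simp
  qed
  then show "Q i y = Q j y" by simp
qed

text \<open>
  On the boundary of the tetrahedron a continuous piecewise polynomial is the restriction of
  one polynomial, since Bernstein coefficients of two faces agree on their common edge. What
  is left after subtracting it vanishes on the boundary, so it is the minimum of the
  coordinates times a function of the same kind and lower degree.
\<close>

lemma compat_pieces_expand:
  fixes P :: "4 \<Rightarrow> real ^ 3 \<Rightarrow> real"
  assumes "compat P" "\<And>i. P i \<in> pol s"
  shows "\<exists>c. \<forall>i y. P i y = (\<Sum>\<alpha>\<in>boundary_expos s. c \<alpha> * basis_piece s \<alpha> i y)"
  using assms
proof (induction s arbitrary: P)
  case 0
  have "\<forall>i. \<exists>c. P i = (\<lambda>y. c)" using 0(2) pol_0E by blast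
  then obtain c where c: "\<And>i. P i = (\<lambda>y. c i)" using choice[of "\<lambda>i c. P i = (\<lambda>y. c)"] by blast
  have "P i y = c 0" for i y
    using compatD[OF 0(1), of i "barycenter x" 0] by (simp add: c bary_barycenter)
  then show ?case
    by (intro exI[of _ "\<lambda>_. c 0"]) (simp add: boundary_expos_0 basis_piece_def mon_def)
next
  case (Suc s)
  let ?A = "{\<alpha> \<in> expos (Suc s). \<exists>i. \<alpha> i = 0}"
  obtain a where a: "\<And>i. P i = (\<lambda>y. \<Sum>\<alpha>\<in>expos (Suc s). mon \<alpha> y *\<^sub>R a i \<alpha>)"
    using pol_family_coeffs[of P "Suc s", OF Suc.prems(2)] by blast
  have agree: "a i \<alpha> = a j \<alpha>" if \<alpha>: "\<alpha> \<in> expos (Suc s)" "\<alpha> i = 0" "\<alpha> j = 0" for i j \<alpha>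
  proof -
    have "a i \<alpha> - a j \<alpha> = 0"
    proof (rule bernstein_coeff_zero[where J = "UNIV - {i, j}" and d = "Suc s" and a = "\<lambda>\<alpha>. a i \<alpha> - a j \<alpha>"])
      fix y assume "\<And>l. l \<notin> UNIV - {i, j} \<Longrightarrow> bary l y = 0"
      then have "bary i y = bary j y" by simp
      from compatD[OF Suc.prems(1) this]
      show "(\<Sum>\<alpha>\<in>expos (Suc s). mon \<alpha> y *\<^sub>R (a i \<alpha> - a j \<alpha>)) = 0"
        by (simp add: a right_diff_distrib sum_subtractf)
    qed (use \<alpha> UNIV_minus_nonempty in auto)
    then show ?thesis by simp
  qed
  \<comment> \<open>the coefficient on any face that sees the exponent\<close>
  define c where "c \<alpha> = a (SOME i. \<alpha> i = 0) \<alpha>" for \<alpha>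
  have c: "a i \<alpha> = c \<alpha>" if "\<alpha> \<in> expos (Suc s)" "\<alpha> i = 0" for i \<alpha>
  proof -
    have "\<alpha> (SOME i. \<alpha> i = 0) = 0" using that(2) by (rule someI)
    then show ?thesis unfolding c_def using agree that by blast
  qed
  have "\<exists>q. q \<in> pol s \<and> (\<forall>y. P i y = (\<Sum>\<alpha>\<in>?A. mon \<alpha> y *\<^sub>R c \<alpha>) + bary i y * q y)" for i
  proof -
    let ?e = "\<lambda>\<alpha>. a i \<alpha> - (if \<exists>i. \<alpha> i = 0 then c \<alpha> else 0)"
    obtain q where q: "q \<in> pol s" "\<And>y. (\<Sum>\<alpha>\<in>expos (Suc s). mon \<alpha> y *\<^sub>R ?e \<alpha>) = bary i y *\<^sub>R q y"
    proof (rule pol_factor[of s i ?e])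
      fix \<alpha> assume \<alpha>: "\<alpha> \<in> expos (Suc s)" "\<alpha> i = 0"
      then have "\<exists>i. \<alpha> i = 0" by blast
      then show "?e \<alpha> = 0" using c[OF \<alpha>] by simp
    qed blast
    have "P i y = (\<Sum>\<alpha>\<in>?A. mon \<alpha> y *\<^sub>R c \<alpha>) + bary i y * q y" for y
    proof -
      have "(\<Sum>\<alpha>\<in>expos (Suc s). mon \<alpha> y *\<^sub>R ?e \<alpha>) =
          P i y - (\<Sum>\<alpha>\<in>expos (Suc s). mon \<alpha> y *\<^sub>R (if \<exists>i. \<alpha> i = 0 then c \<alpha> else 0))"
        by (simp only: a scaleR_diff_right sum_subtractf)
      also have "(\<Sum>\<alpha>\<in>expos (Suc s). mon \<alpha> y *\<^sub>R (if \<exists>i. \<alpha> i = 0 then c \<alpha> else 0)) = (\<Sum>\<alpha>\<in>?A. mon \<alpha> y *\<^sub>R c \<alpha>)"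
        by (rule sum.mono_neutral_cong_right) auto
      finally show ?thesis using q(2)[of y] by simp
    qed
    then show ?thesis using q(1) by blast
  qed
  then obtain Q where Q: "\<And>i. Q i \<in> pol s" "\<And>i y. P i y = (\<Sum>\<alpha>\<in>?A. mon \<alpha> y *\<^sub>R c \<alpha>) + bary i y * Q i y"
    using choice[of "\<lambda>i q. q \<in> pol s \<and> (\<forall>y. P i y = (\<Sum>\<alpha>\<in>?A. mon \<alpha> y *\<^sub>R c \<alpha>) + bary i y * q y)"] by blast
  have "compat Q"
  proof (rule compat_divide_bary[OF Q(1)])
    fix i j y assume "bary i y = bary j y"
    from compatD[OF Suc.prems(1) this] show "bary i y * Q i y = bary j y * Q j y" by (simp add: Q(2))
  qed
  from Suc.IH[OF this Q(1)] obtain c' where c': "\<And>i y. Q i y = (\<Sum>\<alpha>\<in>boundary_expos s. c' \<alpha> * basis_piece s \<alpha> i y)" by blast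
  define e where "e \<alpha> = (if \<alpha> \<in> boundary_expos s then c' \<alpha> else c \<alpha>)" for \<alpha>
  have "(\<Sum>\<alpha>\<in>?A. mon \<alpha> y *\<^sub>R e \<alpha>) = (\<Sum>\<alpha>\<in>?A. mon \<alpha> y *\<^sub>R c \<alpha>)" for y
    using boundary_expos_Suc(2)[of s] by (intro sum.cong) (auto simp: e_def)
  moreover have "(\<Sum>\<alpha>\<in>boundary_expos s. e \<alpha> * basis_piece s \<alpha> i y) = Q i y" for i y
    unfolding c' by (rule sum.cong) (auto simp: e_def)
  ultimately have "P i y = (\<Sum>\<alpha>\<in>boundary_expos (Suc s). e \<alpha> * basis_piece (Suc s) \<alpha> i y)" for i y
    unfolding sum_boundary_expos_Suc Q(2) by simp
  then show ?case by blast
qed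

text \<open>
  The restriction to the boundary determines the coefficients of total degree
  \<open>s\<close>; the others follow after division by \<open>bary i\<close>.
\<close>

lemma basis_piece_independent:
  assumes "\<And>i y. (\<Sum>\<alpha>\<in>boundary_expos s. c \<alpha> * basis_piece s \<alpha> i y) = 0" "\<alpha> \<in> boundary_expos s"
  shows "c \<alpha> = 0"
  using assms
proof (induction s arbitrary: \<alpha>)
  case 0
  then show ?case using 0(1)[of 0 0] by (simp add: boundary_expos_0 basis_piece_def mon_def)
next
  case (Suc s)
  let ?A = "{\<alpha> \<in> expos (Suc s). \<exists>i. \<alpha> i = 0}"
  note zero = Suc.prems(1)[unfolded sum_boundary_expos_Suc]
  have A: "c \<beta> = 0" if \<beta>: "\<beta> \<in> ?A" for \<beta>
  proof -
    obtain i where i: "\<beta> i = 0" using \<beta> by blast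
    then have ex: "\<exists>i. \<beta> i = 0" by blast
    have "(if \<exists>i. \<beta> i = 0 then c \<beta> else 0) = 0"
    proof (rule bernstein_coeff_zero[where J = "UNIV - {i}" and d = "Suc s" and a = "\<lambda>\<alpha>. if \<exists>i. \<alpha> i = 0 then c \<alpha> else 0"])
      fix y assume "\<And>l. l \<notin> UNIV - {i} \<Longrightarrow> bary l y = 0"
      then have "bary i y = 0" by simp
      then have "(\<Sum>\<alpha>\<in>?A. mon \<alpha> y *\<^sub>R c \<alpha>) = 0" using zero[of y i] by simp
      moreover have "(\<Sum>\<alpha>\<in>expos (Suc s). mon \<alpha> y *\<^sub>R (if \<exists>i. \<alpha> i = 0 then c \<alpha> else 0)) = (\<Sum>\<alpha>\<in>?A. mon \<alpha> y *\<^sub>R c \<alpha>)"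
        by (rule sum.mono_neutral_cong_right) auto
      ultimately show "(\<Sum>\<alpha>\<in>expos (Suc s). mon \<alpha> y *\<^sub>R (if \<exists>i. \<alpha> i = 0 then c \<alpha> else 0)) = 0" by simp
    qed (use \<beta> i UNIV_minus_nonempty in auto)
    then show ?thesis unfolding if_P[OF ex] .
  qed
  have "(\<Sum>\<alpha>\<in>boundary_expos s. c \<alpha> * basis_piece s \<alpha> i y) = 0" for i y
  proof (rule pol_zero_off_face[where i = i and d = s])
    show "(\<lambda>y. \<Sum>\<alpha>\<in>boundary_expos s. c \<alpha> * basis_piece s \<alpha> i y) \<in> pol s"
      by (intro pol_sum pol_mult_const pol_basis_piece)
    fix y assume "bary i y \<noteq> 0"
    then show "(\<Sum>\<alpha>\<in>boundary_expos s. c \<alpha> * basis_piece s \<alpha> i y) = 0" using zero[of y i] A by simp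
  qed
  then show ?case using Suc.IH A Suc.prems(2) boundary_expos_Suc(1) by blast
qed

lemma glue_sum: "(\<Sum>\<alpha>\<in>A. c \<alpha> *\<^sub>R glue (P \<alpha>) y) = glue (\<lambda>i y. \<Sum>\<alpha>\<in>A. c \<alpha> *\<^sub>R P \<alpha> i y) y"
  for P :: "'j \<Rightarrow> 4 \<Rightarrow> real ^ 3 \<Rightarrow> 'b::real_vector"
  by (simp add: glue_def)

lemma glue_zeroD:
  fixes P :: "4 \<Rightarrow> real ^ 3 \<Rightarrow> 'b::real_inner"
  assumes "compat P" "\<And>i. P i \<in> pol d" "glue P = (\<lambda>y. 0)"
  shows "P i y = 0"
proof (rule pol_zero_on_cell[OF assms(2)])
  fix z assume "z \<in> open_cell i"
  then have "z \<in> alfeld x i" using open_cell_subset by blast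
  then show "P i z = 0" using glue_eq[OF assms(1)] fun_cong[OF assms(3), of z] by simp
qed

definition M0_zero :: "nat \<Rightarrow> (real ^ 3 \<Rightarrow> real) set" where
  "M0_zero n = {f \<in> M0 (int n) x. \<forall>y\<in>frontier (tetra x). f y = 0}"

lemma M0_zero_iff: "f \<in> M0_zero n \<longleftrightarrow> (\<exists>P. (\<forall>i. P i \<in> pol n) \<and> compat P \<and> (\<forall>i y. bary i y = 0 \<longrightarrow> P i y = 0) \<and> f = glue P)"
  unfolding M0_zero_def mem_Collect_eq M0_iff using glue_zero_frontier by blast

lemma vec3_M0_zero_iff: "f \<in> vec3 (M0_zero n) \<longleftrightarrow>
   (\<exists>P. (\<forall>i. P i \<in> pol n) \<and> compat P \<and> (\<forall>i y. bary i y = 0 \<longrightarrow> P i y = 0) \<and> f = glue P)"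
proof -
  have "f \<in> vec3 (M0_zero n) \<longleftrightarrow> f \<in> vec3 (M0 (int n) x) \<and> (\<forall>y\<in>frontier (tetra x). f y = 0)"
    by (auto simp: vec3_def M0_zero_def vec_eq_iff)
  then show ?thesis unfolding vec3_M0_iff using glue_zero_frontier by blast
qed

text \<open>
  Functions with zero boundary values are the minimum of the coordinates times arbitrary
  functions of one degree less.
\<close>

lemma is_basis_family_M0_zero:
  "is_basis_family (boundary_expos s) (\<lambda>\<alpha>. glue (\<lambda>i y. bary i y * basis_piece s \<alpha> i y)) (M0_zero (Suc s))"
proof -
  let ?P = "\<lambda>c i y. \<Sum>\<alpha>\<in>boundary_expos s. c \<alpha> *\<^sub>R (bary i y * basis_piece s \<alpha> i y)"
  have P_eq: "?P c i y = bary i y *\<^sub>R (\<Sum>\<alpha>\<in>boundary_expos s. c \<alpha> * basis_piece s \<alpha> i y)" for c i y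
    by (simp add: sum_distrib_left mult.left_commute)
  have polq: "(\<lambda>y. \<Sum>\<alpha>\<in>boundary_expos s. c \<alpha> * basis_piece s \<alpha> i y) \<in> pol s" for c i
    by (intro pol_sum pol_mult_const pol_basis_piece)
  have polP: "?P c i \<in> pol (Suc s)" for c i unfolding P_eq by (rule pol_bary_mult[OF polq])
  have compatP: "compat (?P c)" for c by (rule compatI) (simp add: basis_piece_def)
  show ?thesis
    unfolding is_basis_family_def glue_sum
  proof (intro conjI allI impI)
    show "M0_zero (Suc s) = {\<lambda>y. glue (?P c) y | c. True}"
    proof (intro equalityI subsetI)
      fix f assume "f \<in> M0_zero (Suc s)"
      then obtain P where P: "\<And>i. P i \<in> pol (Suc s)" "compat P" "\<And>i y. bary i y = 0 \<Longrightarrow> P i y = 0" "f = glue P"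
        unfolding M0_zero_iff by blast
      obtain Q where Q: "\<And>i. Q i \<in> pol s" "\<And>i. P i = (\<lambda>y. bary i y *\<^sub>R Q i y)"
        using pol_divisible_family[of P s, OF P(1,3)] by blast
      have "compat Q"
      proof (rule compat_divide_bary[OF Q(1)])
        fix i j y assume "bary i y = bary j y"
        from compatD[OF P(2) this] show "bary i y * Q i y = bary j y * Q j y" by (simp add: Q(2))
      qed
      from compat_pieces_expand[OF this Q(1)] obtain c where
        c: "\<And>i y. Q i y = (\<Sum>\<alpha>\<in>boundary_expos s. c \<alpha> * basis_piece s \<alpha> i y)" by blast
      have "P = ?P c" unfolding P_eq by (intro ext) (simp add: Q(2) c)
      then show "f \<in> {\<lambda>y. glue (?P c) y | c. True}" using P(4) by blast
    next
      fix f assume "f \<in> {\<lambda>y. glue (?P c) y | c. True}"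
      then obtain c where "f = glue (?P c)" by auto
      then show "f \<in> M0_zero (Suc s)"
        unfolding M0_zero_iff using polP compatP by (intro exI[of _ "?P c"]) simp
    qed
    fix c assume zero: "(\<lambda>y. glue (?P c) y) = (\<lambda>y. 0)"
    have "?P c i y = 0" for i y by (rule glue_zeroD[OF compatP polP]) (use zero in simp)
    then have prod: "bary i y *\<^sub>R (\<Sum>\<alpha>\<in>boundary_expos s. c \<alpha> * basis_piece s \<alpha> i y) = 0" for i y by (simp only: P_eq)
    have "(\<Sum>\<alpha>\<in>boundary_expos s. c \<alpha> * basis_piece s \<alpha> i y) = 0" for i y
    proof (rule pol_zero_off_face[OF polq, where i = i])
      fix z assume "bary i z \<noteq> 0"
      then show "(\<Sum>\<alpha>\<in>boundary_expos s. c \<alpha> * basis_piece s \<alpha> i z) = 0" using prod[of i z] by simp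
    qed
    then show "\<forall>\<alpha>\<in>boundary_expos s. c \<alpha> = 0" using basis_piece_independent by blast
  qed simp
qed

lemma fun_dim_M0_zero: "fun_dim (M0_zero (Suc s)) = card (boundary_expos s)"
  by (rule fun_dim_basis_family[OF is_basis_family_M0_zero])


section \<open>Dimensions of the interior test spaces\<close>

definition pw_pol :: "nat \<Rightarrow> (real ^ 3 \<Rightarrow> real) set" where
  "pw_pol m = {pw Q | Q. \<forall>i. Q i \<in> pol m}"

lemma is_basis_family_pw_pol:
  "is_basis_family (UNIV \<times> expos m) (\<lambda>(i, \<alpha>) y. indicat_real (open_cell i) y * mon \<alpha> y) (pw_pol m)"
proof -
  have comb: "(\<Sum>p\<in>UNIV \<times> expos m. c p *\<^sub>R (case p of (i, \<alpha>) \<Rightarrow> \<lambda>y. indicat_real (open_cell i) y * mon \<alpha> y) y) =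
    pw (\<lambda>i y. \<Sum>\<alpha>\<in>expos m. mon \<alpha> y *\<^sub>R c (i, \<alpha>)) y" for c :: "4 \<times> (4 \<Rightarrow> nat) \<Rightarrow> real" and y
  proof -
    have "(\<Sum>p\<in>UNIV \<times> expos m. c p *\<^sub>R (case p of (i, \<alpha>) \<Rightarrow> \<lambda>y. indicat_real (open_cell i) y * mon \<alpha> y) y) =
      (\<Sum>i\<in>UNIV. \<Sum>\<alpha>\<in>expos m. c (i, \<alpha>) * (indicat_real (open_cell i) y * mon \<alpha> y))"
      by (simp add: sum.cartesian_product split_def)
    also have "\<dots> = pw (\<lambda>i y. \<Sum>\<alpha>\<in>expos m. mon \<alpha> y *\<^sub>R c (i, \<alpha>)) y"
      unfolding pw_def by (simp add: sum_distrib_left mult.left_commute mult.commute)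
    finally show ?thesis .
  qed
  show ?thesis
    unfolding is_basis_family_def comb
  proof (intro conjI allI impI)
    show "pw_pol m = {\<lambda>y. pw (\<lambda>i y. \<Sum>\<alpha>\<in>expos m. mon \<alpha> y *\<^sub>R c (i, \<alpha>)) y | c. True}"
    proof (intro equalityI subsetI)
      fix f assume "f \<in> pw_pol m"
      then obtain Q where Q: "f = pw Q" "\<And>i. Q i \<in> pol m" by (auto simp: pw_pol_def)
      obtain a where a: "\<And>i. Q i = (\<lambda>y. \<Sum>\<alpha>\<in>expos m. mon \<alpha> y *\<^sub>R a i \<alpha>)"
        using pol_family_coeffs[of Q m, OF Q(2)] by blast
      have "Q = (\<lambda>i y. \<Sum>\<alpha>\<in>expos m. mon \<alpha> y *\<^sub>R (\<lambda>(i, \<alpha>). a i \<alpha>) (i, \<alpha>))"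
        by (rule ext) (simp add: a)
      then have "f = (\<lambda>y. pw (\<lambda>i y. \<Sum>\<alpha>\<in>expos m. mon \<alpha> y *\<^sub>R (\<lambda>(i, \<alpha>). a i \<alpha>) (i, \<alpha>)) y)"
        unfolding Q(1) by simp
      then show "f \<in> {\<lambda>y. pw (\<lambda>i y. \<Sum>\<alpha>\<in>expos m. mon \<alpha> y *\<^sub>R c (i, \<alpha>)) y | c. True}" by blast
    next
      fix f assume "f \<in> {\<lambda>y. pw (\<lambda>i y. \<Sum>\<alpha>\<in>expos m. mon \<alpha> y *\<^sub>R c (i, \<alpha>)) y | c. True}"
      then obtain c where c: "f = pw (\<lambda>i y. \<Sum>\<alpha>\<in>expos m. mon \<alpha> y *\<^sub>R c (i, \<alpha>))" by auto
      show "f \<in> pw_pol m" unfolding c pw_pol_def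
        by (intro CollectI exI[of _ "\<lambda>i y. \<Sum>\<alpha>\<in>expos m. mon \<alpha> y *\<^sub>R c (i, \<alpha>)"] conjI refl allI pol_sum pol_mon)
    qed
    fix c :: "4 \<times> (4 \<Rightarrow> nat) \<Rightarrow> real"
    assume zero: "(\<lambda>y. pw (\<lambda>i y. \<Sum>\<alpha>\<in>expos m. mon \<alpha> y *\<^sub>R c (i, \<alpha>)) y) = (\<lambda>y. 0)"
    show "\<forall>p\<in>UNIV \<times> expos m. c p = 0"
    proof
      fix p assume "p \<in> (UNIV :: 4 set) \<times> expos m"
      then obtain i \<alpha> where p: "p = (i, \<alpha>)" "\<alpha> \<in> expos m" by auto
      have all: "(\<Sum>\<alpha>\<in>expos m. mon \<alpha> y *\<^sub>R c (i, \<alpha>)) = 0" for y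
      proof (rule pol_zero_on_cell[where i = i and d = m])
        show "(\<lambda>y. \<Sum>\<alpha>\<in>expos m. mon \<alpha> y *\<^sub>R c (i, \<alpha>)) \<in> pol m" by (intro pol_sum pol_mon)
        show "(\<Sum>\<alpha>\<in>expos m. mon \<alpha> z *\<^sub>R c (i, \<alpha>)) = 0" if "z \<in> open_cell i" for z
          using fun_cong[OF zero, of z] pw_cell[OF that] by simp
      qed
      have "c (i, \<alpha>) = 0"
        by (rule bernstein_coeff_zero[where J = UNIV and d = m and a = "\<lambda>\<alpha>. c (i, \<alpha>)"]) (use all p in auto)
      then show "c p = 0" by (simp add: p)
    qed
  qed simp
qed

lemma pol_one: "(\<lambda>y. 1 :: real) \<in> pol m"
  by (rule pol_mono[OF pol_const]) simp

lemma pw_pol_integrable: "f \<in> pw_pol m \<Longrightarrow> integrable lborel f"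
  by (auto simp: pw_pol_def intro: pw_integrable)

lemma fun_dim_pw_pol_mean_zero:
  "fun_dim {f \<in> pw_pol m. (LINT y|lborel. f y) = 0} + 1 = 4 * ((m + 3) choose 3)"
proof -
  have "fun_dim (pw_pol m) = fun_dim {f \<in> pw_pol m. (LINT y|lborel. f y) = 0} + 1"
  proof (rule fun_dim_kernel_of_functional[OF is_basis_family_pw_pol])
    show "pw (\<lambda>i y. 1) \<in> pw_pol m" using pol_one by (auto simp: pw_pol_def)
    have "(LINT y|lborel. pw (\<lambda>i y. 1) y) = (\<Sum>i\<in>UNIV. LINT y:open_cell i|lborel. bary i y ^ 0)"
      by (subst integral_pw[OF pol_const]) simp
    also have "\<dots> > 0" by (intro sum_pos integral_open_cell_bary_power_pos) auto
    finally show "(LINT y|lborel. pw (\<lambda>i y. 1) y) \<noteq> 0" by simp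
  qed (simp_all add: pw_pol_integrable)
  moreover have "fun_dim (pw_pol m) = 4 * ((m + 3) choose 3)"
    using fun_dim_basis_family[OF is_basis_family_pw_pol, of m]
    by (simp add: card_cartesian_product card_expos)
  ultimately show ?thesis by simp
qed

text \<open>
  One dimension is lost to the mean value condition.
\<close>

lemma fun_dim_M3_zero: "fun_dim (M3_zero (int (Suc s)) x) + 1 = card (boundary_expos s)"
proof -
  let ?l = "\<lambda>f. LINT y:tetra x|lborel. f y"
  have int: "set_integrable lborel (tetra x) f" if "f \<in> M0_zero (Suc s)" for f
    using that glue_integrable unfolding M0_zero_iff by blast
  have "fun_dim (M0_zero (Suc s)) = fun_dim {f \<in> M0_zero (Suc s). ?l f = 0} + 1"
  proof (rule fun_dim_kernel_of_functional[OF is_basis_family_M0_zero])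
    let ?P = "\<lambda>i y. bary i y ^ Suc s"
    have P: "?P i \<in> pol (Suc s)" "compat ?P" for i
      by (rule pol_bary_power) (rule compatI, simp)
    show "glue ?P \<in> M0_zero (Suc s)" unfolding M0_zero_iff using P by (intro exI[of _ ?P]) simp
    have "?l (glue ?P) = (\<Sum>i\<in>UNIV. LINT y:open_cell i|lborel. bary i y ^ Suc s)"
      unfolding integral_glue_eq_pw[OF P(2,1)] by (rule integral_pw[OF P(1)])
    also have "\<dots> > 0" by (intro sum_pos integral_open_cell_bary_power_pos) auto
    finally show "?l (glue ?P) \<noteq> 0" by simp
  qed (use int in \<open>simp_all add: set_integral_add\<close>)
  moreover have "M3_zero (int (Suc s)) x = {f \<in> M0_zero (Suc s). ?l f = 0}"
    unfolding M3_zero_def M0_zero_def by blast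
  ultimately show ?thesis by (simp add: fun_dim_M0_zero)
qed

text \<open>
  The divergence as a function that is 0 off the open cells: defined for fields with
  discontinuous divergence, with values in \<open>pw_pol\<close>.
\<close>

definition pw_div :: "(real ^ 3 \<Rightarrow> real ^ 3) \<Rightarrow> real ^ 3 \<Rightarrow> real" where
  "pw_div \<omega> = pw (\<lambda>i. pt_div \<omega>)"

lemma pw_div_glue:
  assumes "compat P" "\<And>i. P i \<in> pol d"
  shows "pw_div (glue P) = pw (\<lambda>i. pt_div (P i))"
proof
  fix y
  show "pw_div (glue P) y = pw (\<lambda>i. pt_div (P i)) y"
  proof (cases "\<exists>i. y \<in> open_cell i")
    case True
    then obtain i where i: "y \<in> open_cell i" by blast
    then have "y \<in> interior (alfeld x i)" using open_cell_interior by blast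
    from pt_div_glue[OF assms this] show ?thesis by (simp add: pw_div_def pw_cell[OF i])
  next
    case False
    then show ?thesis by (simp add: pw_div_def pw_outside)
  qed
qed

definition div_free :: "nat \<Rightarrow> (real ^ 3 \<Rightarrow> real ^ 3) set" where
  "div_free n = {\<omega> \<in> vec3 (M0_zero n). pw_div \<omega> = (\<lambda>y. 0)}"

text \<open>
  The divergence theorem and \<open>div_potential_pieces\<close> are the two inclusions.
\<close>

lemma pw_div_image: "pw_div ` vec3 (M0_zero (Suc s)) = {f \<in> pw_pol s. (LINT y|lborel. f y) = 0}"
proof (intro equalityI subsetI)
  fix f assume "f \<in> pw_div ` vec3 (M0_zero (Suc s))"
  then obtain P where P: "\<And>i. P i \<in> pol (Suc s)" "compat P" "\<And>i y. bary i y = 0 \<Longrightarrow> P i y = 0" "f = pw_div (glue P)"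
    unfolding vec3_M0_zero_iff[THEN iffD1] image_iff Bex_def vec3_M0_zero_iff by blast
  have f: "f = pw (\<lambda>i. pt_div (P i))" using pw_div_glue[OF P(2,1)] P(4) by simp
  have "pt_div (P i) \<in> pol s" for i using pol_pt_div[OF P(1)[of i]] by simp
  then have "f \<in> pw_pol s" unfolding f pw_pol_def by blast
  moreover have "(LINT y|lborel. f y) = 0" unfolding f by (rule integral_divergence[OF P(2,1,3)])
  ultimately show "f \<in> {f \<in> pw_pol s. (LINT y|lborel. f y) = 0}" by blast
next
  fix f assume "f \<in> {f \<in> pw_pol s. (LINT y|lborel. f y) = 0}"
  then obtain Q where Q: "f = pw Q" "\<And>i. Q i \<in> pol s" "(LINT y|lborel. pw Q y) = 0" by (auto simp: pw_pol_def)
  have Q0: "(LINT y|lborel. pw (\<lambda>i y. bary i y ^ 0 * Q i y) y) = 0" using Q(3) by simp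
  obtain V where V: "\<And>i. V i \<in> pol (Suc 0 + s)" "compat V" "\<And>i y. bary i y = 0 \<Longrightarrow> V i y = 0"
    "\<And>i y. pt_div (V i) y = bary i y ^ 0 * Q i y"
    using div_potential_pieces[of Q s 0, OF Q(2) Q0] by blast
  have "(\<lambda>i. pt_div (V i)) = Q" by (intro ext) (simp add: V(4))
  then have "f = pw_div (glue V)" unfolding Q(1) pw_div_glue[OF V(2,1)] by simp
  moreover have "glue V \<in> vec3 (M0_zero (Suc s))"
    unfolding vec3_M0_zero_iff using V(1,2,3) by (intro exI[of _ V]) simp
  ultimately show "f \<in> pw_div ` vec3 (M0_zero (Suc s))" by blast
qed

lemma pt_div_scale:
  assumes "w \<in> pol d"
  shows "pt_div (\<lambda>y. c *\<^sub>R w y) y = c * pt_div w y"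
  using pt_div_eq[OF has_derivative_scaleR_right[OF pol_deriv(1)[OF assms, of y], of c]]
  by (simp add: pt_div_pol[OF assms] sum_distrib_left)

lemma fun_dim_div_free:
  "fun_dim (div_free (Suc s)) + 4 * ((s + 3) choose 3) = 3 * card (boundary_expos s) + 1"
proof -
  have "fun_dim (vec3 (M0_zero (Suc s))) =
      fun_dim (pw_div ` vec3 (M0_zero (Suc s))) + fun_dim {\<omega> \<in> vec3 (M0_zero (Suc s)). pw_div \<omega> = (\<lambda>z. 0)}"
  proof (rule fun_dim_rank_nullity[OF is_basis_family_vec3[OF is_basis_family_M0_zero]])
    fix f g assume "f \<in> vec3 (M0_zero (Suc s))" "g \<in> vec3 (M0_zero (Suc s))"
    then obtain P Q where P: "\<And>i. P i \<in> pol (Suc s)" "compat P" "f = glue P"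
      and Q: "\<And>i. Q i \<in> pol (Suc s)" "compat Q" "g = glue Q" unfolding vec3_M0_zero_iff by blast
    have PQ: "compat (\<lambda>i y. P i y + Q i y)"
      by (rule compat_combine[OF P(2) Q(2), where h = "\<lambda>_ _ p q. p + q"])
    show "pw_div (\<lambda>y. f y + g y) = (\<lambda>z. pw_div f z + pw_div g z)"
      unfolding P(3) Q(3) glue_linear(1)[symmetric] pw_div_glue[OF PQ pol_add[OF P(1) Q(1)]]
        pw_div_glue[OF P(2,1)] pw_div_glue[OF Q(2,1)]
      by (rule ext) (simp add: pt_div_add[OF P(1) Q(1)] pw_def distrib_left sum.distrib)
  next
    fix f and c :: real assume "f \<in> vec3 (M0_zero (Suc s))"
    then obtain P where P: "\<And>i. P i \<in> pol (Suc s)" "compat P" "f = glue P" unfolding vec3_M0_zero_iff by blast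
    have cP: "compat (\<lambda>i y. c *\<^sub>R P i y)"
      by (rule compat_combine[OF P(2) P(2), where h = "\<lambda>_ _ p _. c *\<^sub>R p"])
    have eq: "(\<lambda>i. pt_div (\<lambda>y. c *\<^sub>R P i y)) = (\<lambda>i y. c * pt_div (P i) y)"
      by (intro ext) (rule pt_div_scale[OF P(1)])
    show "pw_div (\<lambda>y. c *\<^sub>R f y) = (\<lambda>z. c *\<^sub>R pw_div f z)"
      unfolding P(3) glue_linear(3)[symmetric] pw_div_glue[OF cP pol_scaleR[OF P(1)]] pw_div_glue[OF P(2,1)]
      by (rule ext) (simp only: eq pw_scale real_scaleR_def)
  qed
  moreover have "fun_dim (vec3 (M0_zero (Suc s))) = 3 * card (boundary_expos s)"
    using fun_dim_vec3[OF is_basis_family_M0_zero] by (simp add: fun_dim_M0_zero)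
  ultimately show ?thesis
    using fun_dim_pw_pol_mean_zero[of s] unfolding pw_div_image div_free_def by simp
qed

text \<open>
  The space of test functions in (f) consists of all divergence-free fields with zero boundary
  values. This identifies its dimension, and it is what makes \<open>\<omega>\<close> itself a
  test function once its boundary values and its divergence vanish.
\<close>

lemma curl_image: "curl_T x ` M1_zero (int (Suc (Suc s))) x = div_free (Suc s)"
proof (intro equalityI subsetI)
  fix \<omega> assume "\<omega> \<in> curl_T x ` M1_zero (int (Suc (Suc s))) x"
  then obtain v where v: "v \<in> M1_zero (int (Suc (Suc s))) x" "\<omega> = curl_T x v" by blast
  then have "v \<in> M1 (int (Suc (Suc s))) x" by (simp add: M1_zero_def)
  then obtain P where P: "\<And>i. P i \<in> pol (Suc (Suc s))" "compat P" "compat (\<lambda>i. pt_curl (P i))" "v = glue P"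
    unfolding M1_iff by blast
  have \<omega>: "\<omega> = glue (\<lambda>i. pt_curl (P i))" using v(2) curl_T_glue[OF P(2,1,3)] P(4) by simp
  have C: "pt_curl (P i) \<in> pol (Suc s)" for i using pol_pt_curl[OF P(1)[of i]] by simp
  have "\<forall>y\<in>frontier (tetra x). \<omega> y = 0" using v by (simp add: M1_zero_def)
  then have "\<forall>i y. bary i y = 0 \<longrightarrow> pt_curl (P i) y = 0"
    unfolding \<omega> glue_zero_frontier[OF P(3) C] .
  then have "\<omega> \<in> vec3 (M0_zero (Suc s))" unfolding vec3_M0_zero_iff using C P(3) \<omega>
    by (intro exI[of _ "\<lambda>i. pt_curl (P i)"]) simp
  moreover have "pw_div \<omega> = (\<lambda>y. 0)"
    unfolding \<omega> pw_div_glue[OF P(3) C] by (rule ext) (simp add: pw_def pt_div_curl[OF P(1)])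
  ultimately show "\<omega> \<in> div_free (Suc s)" by (simp add: div_free_def)
next
  fix \<omega> assume \<omega>: "\<omega> \<in> div_free (Suc s)"
  then obtain P where P: "\<And>i. P i \<in> pol (Suc s)" "compat P" "\<And>i y. bary i y = 0 \<Longrightarrow> P i y = 0" "\<omega> = glue P"
    unfolding div_free_def mem_Collect_eq vec3_M0_zero_iff by blast
  have zero: "pw (\<lambda>i. pt_div (P i)) = (\<lambda>y. 0)"
    using \<omega> pw_div_glue[OF P(2,1)] by (simp add: div_free_def P(4))
  have D: "pt_div (P i) y = 0" for i y
  proof (rule pol_zero_on_cell[OF pol_pt_div[OF P(1)]])
    fix z assume "z \<in> open_cell i"
    from pw_cell[OF this, of "\<lambda>i. pt_div (P i)"] show "pt_div (P i) z = 0" by (simp add: zero)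
  qed
  obtain V where V: "\<And>i. V i \<in> pol (Suc (Suc s))" "compat V" "\<And>i y. bary i y = 0 \<Longrightarrow> V i y = 0"
    "\<And>i. pt_curl (V i) = P i"
    using curl_potential[OF P(2,1,3) D] by blast
  have C: "compat (\<lambda>i. pt_curl (V i))" unfolding V(4) by (rule P(2))
  have curl: "curl_T x (glue V) = \<omega>" unfolding curl_T_glue[OF V(2,1) C] by (simp add: V(4) P(4))
  have "glue V \<in> M1 (int (Suc (Suc s))) x" unfolding M1_iff using V(1,2) C by blast
  moreover have "\<forall>y\<in>frontier (tetra x). glue V y = 0" using glue_zero_frontier[OF V(2,1)] V(3) by blast
  moreover have "\<forall>y\<in>frontier (tetra x). \<omega> y = 0" using glue_zero_frontier[OF P(2,1)] P(3,4) by blast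
  ultimately have "glue V \<in> M1_zero (int (Suc (Suc s))) x" by (simp add: M1_zero_def curl)
  then show "\<omega> \<in> curl_T x ` M1_zero (int (Suc (Suc s))) x" using curl by blast
qed

end

section \<open>Integrals over edges and faces\<close>

lemma convex_hull_2_param: "y \<in> convex hull {a, b} \<longleftrightarrow> (\<exists>s\<in>{0..1}. y = a + s *\<^sub>R (b - a))"
  for a b y :: "'a::euclidean_space"
proof -
  have "(1 - u) *\<^sub>R a + u *\<^sub>R b = a + u *\<^sub>R (b - a)" for u :: real by (simp add: algebra_simps)
  then show ?thesis unfolding segment_convex_hull[symmetric] in_segment by auto
qed

lemma edge_integral_integrable:
  fixes f :: "real ^ 3 \<Rightarrow> real"
  assumes "continuous_on (convex hull {a, b}) f"
  shows "set_integrable lborel {0..1} (\<lambda>s. f (a + s *\<^sub>R (b - a)))"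
    and "continuous_on {0..1} (\<lambda>s. f (a + s *\<^sub>R (b - a)))"
proof -
  show "continuous_on {0..1} (\<lambda>s. f (a + s *\<^sub>R (b - a)))"
  proof (rule continuous_on_compose2[OF assms])
    show "(\<lambda>s. a + s *\<^sub>R (b - a)) ` {0..1} \<subseteq> convex hull {a, b}"
    proof (rule image_subsetI)
      fix s :: real assume "s \<in> {0..1}"
      then show "a + s *\<^sub>R (b - a) \<in> convex hull {a, b}" unfolding convex_hull_2_param by blast
    qed
  qed (intro continuous_intros)
  then show "set_integrable lborel {0..1} (\<lambda>s. f (a + s *\<^sub>R (b - a)))"
    by (rule borel_integrable_atLeastAtMost')
qed

lemma edge_integral_diff:
  assumes "continuous_on (convex hull {a, b}) f" "continuous_on (convex hull {a, b}) g"
  shows "edge_integral a b (\<lambda>y. f y - g y) = edge_integral a b f - edge_integral a b g"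
  unfolding edge_integral_def
  by (simp add: set_integral_diff(2)[OF edge_integral_integrable(1)[OF assms(1)] edge_integral_integrable(1)[OF assms(2)]] right_diff_distrib)

lemma edge_integral_eq_zero:
  assumes "continuous_on (convex hull {a, b}) f" "\<And>y. y \<in> convex hull {a, b} \<Longrightarrow> 0 \<le> f y"
    "edge_integral a b f = 0" "a \<noteq> b" "y \<in> convex hull {a, b}"
  shows "f y = 0"
proof -
  let ?h = "\<lambda>s. f (a + s *\<^sub>R (b - a))"
  have mem: "a + s *\<^sub>R (b - a) \<in> convex hull {a, b}" if "s \<in> {0..1}" for s
    using that unfolding convex_hull_2_param by blast
  have "(LINT s:{0..1}|lborel. ?h s) = 0" using assms(3,4) by (simp add: edge_integral_def)
  then have "(?h has_integral 0) {0..1}"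
    using has_integral_set_lebesgue[of "{0..1}" ?h] edge_integral_integrable(1)[OF assms(1)]
      set_borel_integral_eq_integral[OF edge_integral_integrable(1)[OF assms(1)]]
    by (metis integrable_integral)
  then have int0: "(?h has_integral 0) (cbox 0 1)" by (simp only: cbox_interval)
  have "?h s = 0" if "s \<in> {0..1}" for s
  proof (rule has_integral_0_cbox_imp_0[OF _ _ int0])
    show "continuous_on (cbox 0 1) ?h"
      unfolding cbox_interval by (rule edge_integral_integrable(2)[OF assms(1)])
    show "0 \<le> ?h s" if "s \<in> box 0 1" for s
      using assms(2)[OF mem] that by (simp add: box_real)
    show "box 0 (1::real) \<noteq> {}" by simp
    show "s \<in> cbox 0 1" using that by (simp add: cbox_interval)
  qed
  moreover obtain s where "s \<in> {0..1}" "y = a + s *\<^sub>R (b - a)"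
    using assms(5) unfolding convex_hull_2_param by blast
  ultimately show ?thesis by simp
qed

definition ref_triangle :: "(real \<times> real) set" where
  "ref_triangle = {(s, t). 0 \<le> s \<and> 0 \<le> t \<and> s + t \<le> 1}"

definition triangle_param :: "'a \<Rightarrow> 'a \<Rightarrow> 'a \<Rightarrow> real \<times> real \<Rightarrow> 'a::real_vector" where
  "triangle_param a b c p = a + fst p *\<^sub>R (b - a) + snd p *\<^sub>R (c - a)"

lemma compact_ref_triangle: "compact ref_triangle"
proof -
  have eq: "ref_triangle = {p. 0 \<le> fst p} \<inter> {p. 0 \<le> snd p} \<inter> {p. fst p + snd p \<le> 1}"
    by (auto simp: ref_triangle_def)
  have "closed ref_triangle" unfolding eq
    by (intro closed_Int closed_Collect_le continuous_intros)
  moreover have "bounded ref_triangle"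
    by (rule bounded_subset[of "{0..1} \<times> {0..1}"]) (auto simp: ref_triangle_def intro: bounded_Times)
  ultimately show ?thesis by (simp add: compact_eq_bounded_closed)
qed

lemma triangle_param_hull: "p \<in> ref_triangle \<Longrightarrow> triangle_param a b c p \<in> convex hull {a, b, c}"
  unfolding convex_hull_3_alt triangle_param_def
  by (intro CollectI exI[of _ "fst p"] exI[of _ "snd p"]) (auto simp: ref_triangle_def)

lemma triangle_integrable:
  fixes f :: "real ^ 3 \<Rightarrow> real"
  assumes "continuous_on (convex hull {a, b, c}) f"
  shows "integrable lborel (\<lambda>p. indicator ref_triangle p *\<^sub>R f (triangle_param a b c p))"
    and "continuous_on ref_triangle (\<lambda>p. f (triangle_param a b c p))"
proof -
  show "continuous_on ref_triangle (\<lambda>p. f (triangle_param a b c p))"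
  proof (rule continuous_on_compose2[OF assms])
    show "continuous_on ref_triangle (triangle_param a b c)"
      unfolding triangle_param_def[abs_def] by (intro continuous_intros)
  qed (auto intro: triangle_param_hull)
  then show "integrable lborel (\<lambda>p. indicator ref_triangle p *\<^sub>R f (triangle_param a b c p))"
    by (rule borel_integrable_compact[OF compact_ref_triangle])
qed

text \<open>
  By Fubini the iterated integral is an integral over the reference triangle in the plane. In
  this form linearity and definiteness are evident.
\<close>

lemma face_integral_eq:
  assumes "continuous_on (convex hull {a, b, c}) f"
  shows "face_integral a b c f = norm (cross3 (b - a) (c - a)) *
    (LINT p|lborel. indicator ref_triangle p *\<^sub>R f (triangle_param a b c p))"
proof -
  let ?F = "\<lambda>p. indicat_real ref_triangle p *\<^sub>R f (triangle_param a b c p)"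
  have inner: "indicat_real {0..1} s *\<^sub>R (LINT t:{0..1 - s}|lborel. f (a + s *\<^sub>R (b - a) + t *\<^sub>R (c - a))) =
     (LINT t|lborel. ?F (s, t))" for s
  proof -
    show ?thesis
    proof (cases "s \<in> {0..1}")
      case True
      have "indicat_real {0..1 - s} t *\<^sub>R f (a + s *\<^sub>R (b - a) + t *\<^sub>R (c - a)) = ?F (s, t)" for t
        using True by (auto simp: indicator_def ref_triangle_def triangle_param_def)
      then show ?thesis using True unfolding set_lebesgue_integral_def by simp
    next
      case False
      then have F0: "?F (s, t) = 0" for t by (auto simp: ref_triangle_def)
      show ?thesis unfolding F0 using False by simp
    qed
  qed
  have int: "integrable (lborel \<Otimes>\<^sub>M lborel) ?F"
    using triangle_integrable(1)[OF assms] by (simp add: lborel_prod)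
  have "(LINT s:{0..1}|lborel. LINT t:{0..1 - s}|lborel. f (a + s *\<^sub>R (b - a) + t *\<^sub>R (c - a))) =
     (LINT s|lborel. LINT t|lborel. ?F (s, t))"
    unfolding set_lebesgue_integral_def[of _ "{0..1::real}"] inner ..
  also have "\<dots> = (LINT p|lborel. ?F p)"
    using lborel_pair.integral_fst'[OF int] by (simp add: lborel_prod)
  finally show ?thesis by (simp add: face_integral_def)
qed

lemma face_integral_diff:
  assumes "continuous_on (convex hull {a, b, c}) f" "continuous_on (convex hull {a, b, c}) g"
  shows "face_integral a b c (\<lambda>y. f y - g y) = face_integral a b c f - face_integral a b c g"
proof -
  have "continuous_on (convex hull {a, b, c}) (\<lambda>y. f y - g y)" using assms by (intro continuous_intros)
  then show ?thesis
    by (simp only: face_integral_eq assms scaleR_diff_right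
        Bochner_Integration.integral_diff[OF triangle_integrable(1)[OF assms(1)] triangle_integrable(1)[OF assms(2)]] right_diff_distrib)
qed

text \<open>
  Only interior points of the face are covered; the boundary of a face is treated by its
  edges.
\<close>

lemma face_integral_eq_zero:
  assumes cont: "continuous_on (convex hull {a, b, c}) f" and nonneg: "\<And>y. y \<in> convex hull {a, b, c} \<Longrightarrow> 0 \<le> f y"
    and zero: "face_integral a b c f = 0" and nondeg: "cross3 (b - a) (c - a) \<noteq> 0"
    and st: "0 < s" "0 < t" "s + t < 1"
  shows "f (a + s *\<^sub>R (b - a) + t *\<^sub>R (c - a)) = 0"
proof -
  let ?F = "\<lambda>p. indicat_real ref_triangle p *\<^sub>R f (triangle_param a b c p)"
  let ?U = "{p. 0 < fst p} \<inter> {p. 0 < snd p} \<inter> {p. fst p + snd p < (1::real)}"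
  have U: "open ?U" by (intro open_Int open_Collect_less continuous_intros)
  have sub: "?U \<subseteq> ref_triangle" by (auto simp: ref_triangle_def)
  have "(LINT p|lborel. ?F p) = 0" using zero nondeg by (simp add: face_integral_eq[OF cont])
  moreover have "AE p in lborel. 0 \<le> ?F p"
    by (rule AE_I2) (auto simp: indicator_def intro!: nonneg triangle_param_hull)
  ultimately have "AE p in lborel. ?F p = 0"
    using integral_nonneg_eq_0_iff_AE[OF triangle_integrable(1)[OF cont]] by simp
  then have "AE p in lborel. p \<notin> {p \<in> ?U. f (triangle_param a b c p) \<noteq> 0}"
    by eventually_elim (use sub in auto)
  moreover have "open {p \<in> ?U. f (triangle_param a b c p) \<noteq> 0}"
  proof -
    have "continuous_on ?U (\<lambda>p. f (triangle_param a b c p))"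
      by (rule continuous_on_subset[OF triangle_integrable(2)[OF cont] sub])
    from continuous_open_preimage[OF this U, of "- {0}"]
    have "open (?U \<inter> (\<lambda>p. f (triangle_param a b c p)) -` (- {0}))" by auto
    also have "?U \<inter> (\<lambda>p. f (triangle_param a b c p)) -` (- {0}) = {p \<in> ?U. f (triangle_param a b c p) \<noteq> 0}" by auto
    finally show ?thesis .
  qed
  ultimately have "{p \<in> ?U. f (triangle_param a b c p) \<noteq> 0} = {}" by (rule AE_zero_on_open[rotated])
  moreover have "(s, t) \<in> ?U" using st by simp
  ultimately have "f (triangle_param a b c (s, t)) = 0" by blast
  then show ?thesis by (simp add: triangle_param_def)
qed

lemma zero_in_PolyOn: "(\<lambda>y. 0) \<in> PolyOn r S"
  unfolding PolyOn_def by (auto intro!: exI[of _ "\<lambda>_. 0"])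

section \<open>Moments determine boundary values\<close>

context tetrahedron
begin

lemma PolyOn_continuous: "f \<in> PolyOn r S \<Longrightarrow> continuous_on S f"
proof (cases "r < 0")
  case True
  then show "f \<in> PolyOn r S \<Longrightarrow> continuous_on S f" by (simp add: PolyOn_negative)
next
  case False
  then obtain d where r: "r = int d" by (metis not_le_imp_less nonneg_int_cases)
  assume "f \<in> PolyOn r S"
  then obtain p where "p \<in> pol d" "\<forall>y\<in>S. f y = p y" unfolding r PolyOn_iff by blast
  then show "continuous_on S f" using continuous_on_eq[OF pol_continuous[of p d S]] by metis
qed

text \<open>
  A polynomial that vanishes on the relative boundary of a subsimplex has only Bernstein
  coefficients with full support there, so the product of the coordinates splits off. For
  \<open>d < card J\<close> there are no such exponents, and \<open>\<kappa>\<close> is 0, the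
  only element of the space of negative degree.
\<close>

lemma bubble_factor:
  fixes p :: "real ^ 3 \<Rightarrow> real"
  assumes p: "p \<in> pol d" and J: "2 \<le> card J"
    and zero: "\<And>y j. y \<in> convex hull (x ` J) \<Longrightarrow> j \<in> J \<Longrightarrow> bary j y = 0 \<Longrightarrow> p y = 0"
  obtains \<kappa> where "\<kappa> \<in> PolyOn (int d - int (card J)) (convex hull (x ` J))"
    "\<And>y. y \<in> convex hull (x ` J) \<Longrightarrow> p y = (\<Prod>j\<in>J. bary j y) * \<kappa> y"
proof -
  let ?S = "convex hull (x ` J)"
  let ?A = "{\<alpha> \<in> expos d. \<forall>i. 0 < \<alpha> i \<longleftrightarrow> i \<in> J}"
  have Jne: "J \<noteq> {}" using J by auto
  obtain a where a: "p = (\<lambda>y. \<Sum>\<alpha>\<in>expos d. mon \<alpha> y *\<^sub>R a \<alpha>)" using p by (rule polE)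
  have a0: "a \<alpha> = 0" if \<alpha>: "\<alpha> \<in> expos d" "\<And>i. i \<notin> J \<Longrightarrow> \<alpha> i = 0" "j \<in> J" "\<alpha> j = 0" for \<alpha> j
  proof (rule bernstein_coeff_zero[where J = "J - {j}" and d = d])
    show "J - {j} \<noteq> {}"
    proof
      assume "J - {j} = {}"
      then have "card J \<le> card {j}" by (intro card_mono) auto
      then show False using J by simp
    qed
    fix y assume y: "\<And>i. i \<notin> J - {j} \<Longrightarrow> bary i y = 0" "\<And>i. i \<in> J - {j} \<Longrightarrow> 0 < bary i y"
    have "0 \<le> bary i y" for i using y[of i] by (cases "i \<in> J - {j}") (auto simp: less_imp_le)
    then have "y \<in> ?S" using y(1) unfolding convex_hull_subset_eq[OF Jne] by blast
    moreover have "bary j y = 0" using y(1) by blast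
    ultimately show "(\<Sum>\<alpha>\<in>expos d. mon \<alpha> y *\<^sub>R a \<alpha>) = 0" using zero[of y j] \<alpha>(3) by (simp add: a)
  next
    show "\<alpha> i = 0" if "i \<notin> J - {j}" for i using that \<alpha> by (cases "i = j") auto
  qed (rule \<alpha>(1))
  have p_eq: "p y = (\<Sum>\<alpha>\<in>?A. mon \<alpha> y *\<^sub>R a \<alpha>)" if y: "y \<in> ?S" for y
    unfolding a
  proof (rule sum.mono_neutral_right)
    show "\<forall>\<alpha>\<in>expos d - ?A. mon \<alpha> y *\<^sub>R a \<alpha> = 0"
    proof
      fix \<alpha> assume \<alpha>: "\<alpha> \<in> expos d - ?A"
      show "mon \<alpha> y *\<^sub>R a \<alpha> = 0"
      proof (cases "\<exists>i. i \<notin> J \<and> 0 < \<alpha> i")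
        case True
        then obtain i where "i \<notin> J" "0 < \<alpha> i" by blast
        then have "mon \<alpha> y = 0" using y by (intro mon_zero[of i]) (auto simp: convex_hull_subset_eq[OF Jne])
        then show ?thesis by simp
      next
        case False
        have off: "\<alpha> i = 0" if "i \<notin> J" for i
        proof -
          have "\<not> (i \<notin> J \<and> 0 < \<alpha> i)" using False by (rule contrapos_nn) (rule exI)
          then show ?thesis using that by simp
        qed
        have "\<alpha> \<in> expos d" "\<not> (\<forall>j. 0 < \<alpha> j \<longleftrightarrow> j \<in> J)" using \<alpha> by simp_all
        then obtain j where "\<not> (0 < \<alpha> j \<longleftrightarrow> j \<in> J)" unfolding not_all by (elim exE)
        then have "j \<in> J" "\<alpha> j = 0" using off[of j] by auto
        moreover have "\<alpha> \<in> expos d" using \<alpha> by simp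
        ultimately have "a \<alpha> = 0" using off by (intro a0)
        then show ?thesis by simp
      qed
    qed
  qed auto
  \<comment> \<open>divide the monomial by the bubble\<close>
  define \<beta> where "\<beta> \<alpha> i = \<alpha> i - (if i \<in> J then 1 else 0)" for \<alpha> :: "4 \<Rightarrow> nat" and i
  have \<beta>: "sum (\<beta> \<alpha>) UNIV = d - card J" "card J \<le> d" "mon \<alpha> y = (\<Prod>j\<in>J. bary j y) * mon (\<beta> \<alpha>) y"
    if \<alpha>: "\<alpha> \<in> ?A" for \<alpha> y
  proof -
    have ind: "(\<Sum>i\<in>UNIV. if i \<in> J then 1 else 0 :: nat) = card J" by (simp add: sum.If_cases)
    have le: "(if i \<in> J then 1 else 0) \<le> \<alpha> i" for i using \<alpha> by (auto simp: Suc_le_eq)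
    have "card J \<le> sum \<alpha> UNIV" unfolding ind[symmetric] by (rule sum_mono) (rule le)
    then show "card J \<le> d" using \<alpha> by (simp add: expos_def)
    have "sum (\<beta> \<alpha>) UNIV = sum \<alpha> UNIV - card J"
      unfolding \<beta>_def[abs_def] ind[symmetric] by (rule sum_subtractf_nat) (rule le)
    then show "sum (\<beta> \<alpha>) UNIV = d - card J" using \<alpha> by (simp add: expos_def)
    have "mon \<alpha> y = (\<Prod>i\<in>UNIV. bary i y ^ (if i \<in> J then 1 else 0) * bary i y ^ \<beta> \<alpha> i)"
      unfolding mon_def by (rule prod.cong) (use le in \<open>simp_all add: \<beta>_def flip: power_add\<close>)
    also have "\<dots> = (\<Prod>i\<in>UNIV. if i \<in> J then bary i y else 1) * mon (\<beta> \<alpha>) y"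
      by (simp add: prod.distrib mon_def if_distrib[of "\<lambda>a. _ ^ a"] cong: if_cong)
    also have "(\<Prod>i\<in>UNIV. if i \<in> J then bary i y else 1) = (\<Prod>j\<in>J. bary j y)"
      by (simp add: prod.If_cases)
    finally show "mon \<alpha> y = (\<Prod>j\<in>J. bary j y) * mon (\<beta> \<alpha>) y" .
  qed
  define q where "q = (\<lambda>y. \<Sum>\<alpha>\<in>?A. mon (\<beta> \<alpha>) y *\<^sub>R a \<alpha>)"
  have pq: "p y = (\<Prod>j\<in>J. bary j y) * q y" if "y \<in> ?S" for y
    unfolding p_eq[OF that] q_def sum_distrib_left by (rule sum.cong) (simp_all add: \<beta>(3))
  show thesis
  proof (rule that[of "\<lambda>y. if y \<in> ?S then q y else 0"])
    show "p y = (\<Prod>j\<in>J. bary j y) * (if y \<in> ?S then q y else 0)" if "y \<in> ?S" for y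
      using pq[OF that] that by simp
    show "(\<lambda>y. if y \<in> ?S then q y else 0) \<in> PolyOn (int d - int (card J)) ?S"
    proof (cases "card J \<le> d")
      case True
      then have eq: "int d - int (card J) = int (d - card J)" by simp
      have "q \<in> pol (d - card J)" unfolding q_def by (intro pol_sum pol_mon) (simp add: expos_def \<beta>(1))
      then show ?thesis unfolding eq PolyOn_iff by auto
    next
      case False
      then have "?A = {}" using \<beta>(2) by blast
      then have "q = (\<lambda>y. 0)" unfolding q_def by (simp only: sum.empty)
      then have "(\<lambda>y. if y \<in> ?S then q y else 0) = (\<lambda>y. 0)" by auto
      then show ?thesis using zero_in_PolyOn by (simp only:)
    qed
  qed
qed

lemma prod_bary_nonneg: "y \<in> tetra x \<Longrightarrow> 0 \<le> (\<Prod>j\<in>J. bary j y)"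
  by (intro prod_nonneg) (auto simp: tetra_eq)

lemma face_subset_tetra: "J \<noteq> {} \<Longrightarrow> convex hull (x ` J) \<subseteq> tetra x"
  by (auto simp: convex_hull_subset_eq tetra_eq)

lemma glue_on_face:
  assumes "compat P" "J \<noteq> {}" "l \<notin> J" "y \<in> convex hull (x ` J)"
  shows "glue P y = P l y"
proof (rule glue_eq[OF assms(1)])
  have "bary l y = 0" "\<And>j. 0 \<le> bary j y" using assms(3,4) by (auto simp: convex_hull_subset_eq[OF assms(2)])
  then show "y \<in> alfeld x l" by (auto simp: alfeld_eq)
qed

lemma cross_edges_nonzero:
  assumes "i \<noteq> j" "i \<noteq> k" "j \<noteq> k"
  shows "cross3 (x j - x i) (x k - x i) \<noteq> 0"
proof
  assume zero: "cross3 (x j - x i) (x k - x i) = 0"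
  have "0 = cross3 (grad_bary j) (cross3 (x j - x i) (x k - x i))" by (simp add: zero)
  also have "\<dots> = (grad_bary j \<bullet> (x k - x i)) *\<^sub>R (x j - x i) - (grad_bary j \<bullet> (x j - x i)) *\<^sub>R (x k - x i)"
    by (rule Lagrange)
  also have "\<dots> = - (x k - x i)" unfolding grad_bary_dual using assms by auto
  finally have "x k = x i" by simp
  then show False using assms inj_x by (auto dest: injD)
qed

text \<open>
  On a simplex \<open>S\<close> the function is the bubble times a polynomial
  \<open>\<kappa>\<close>, and \<open>\<kappa>\<close> is an admissible test function. The
  corresponding moment integrates the bubble times the square of \<open>\<kappa>\<close>,
  which is nonnegative. The integral enters through its definiteness alone, so edges and faces
  are treated alike.
\<close>

lemma moments_zero_imp_zero:
  assumes P: "compat P" "\<And>i. P i \<in> pol d" and J: "2 \<le> card J" "l \<notin> J"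
    and bd: "\<And>z j. z \<in> convex hull (x ` J) \<Longrightarrow> j \<in> J \<Longrightarrow> bary j z = 0 \<Longrightarrow> glue P z = (0::real)"
    and moment: "\<And>\<kappa>. \<kappa> \<in> PolyOn (int d - int (card J)) (convex hull (x ` J)) \<Longrightarrow> I (\<lambda>z. glue P z * \<kappa> z) = (0::real)"
    and definite: "\<And>f. continuous_on (convex hull (x ` J)) f \<Longrightarrow> (\<And>z. z \<in> convex hull (x ` J) \<Longrightarrow> 0 \<le> f z) \<Longrightarrow>
      I f = 0 \<Longrightarrow> f y = 0"
    and y: "y \<in> convex hull (x ` J)"
  shows "glue P y = 0"
proof -
  let ?S = "convex hull (x ` J)"
  have Jne: "J \<noteq> {}" using J(1) by auto
  have glue: "glue P z = P l z" if "z \<in> ?S" for z by (rule glue_on_face[OF P(1) Jne J(2) that])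
  obtain \<kappa> where \<kappa>: "\<kappa> \<in> PolyOn (int d - int (card J)) ?S"
    "\<And>z. z \<in> ?S \<Longrightarrow> P l z = (\<Prod>j\<in>J. bary j z) * \<kappa> z"
  proof (rule bubble_factor[OF P(2) J(1), of l])
    show "P l z = 0" if "z \<in> ?S" "j \<in> J" "bary j z = 0" for z j
      using bd[OF that] glue[OF that(1)] by simp
  qed blast
  have sq: "glue P z * \<kappa> z = (\<Prod>j\<in>J. bary j z) * (\<kappa> z)\<^sup>2" if "z \<in> ?S" for z
    using glue[OF that] \<kappa>(2)[OF that] by (simp add: power2_eq_square)
  have "continuous_on ?S (glue P)"
    using glue_C0[OF P] face_subset_tetra[OF Jne] by (auto simp: C0_def intro: continuous_on_subset)
  then have cont: "continuous_on ?S (\<lambda>z. glue P z * \<kappa> z)"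
    by (intro continuous_intros PolyOn_continuous[OF \<kappa>(1)])
  have nonneg: "0 \<le> glue P z * \<kappa> z" if "z \<in> ?S" for z
    unfolding sq[OF that] using face_subset_tetra[OF Jne] that
    by (intro mult_nonneg_nonneg prod_bary_nonneg) auto
  have "glue P y * \<kappa> y = 0"
    by (rule definite[OF cont nonneg moment[OF \<kappa>(1)]])
  then have "(\<Prod>j\<in>J. bary j y) = 0 \<or> \<kappa> y = 0" using sq[OF y] by simp
  then show ?thesis using glue[OF y] \<kappa>(2)[OF y] by auto
qed

lemma M0_zero_on_edge:
  assumes P: "compat P" "\<And>i. P i \<in> pol d" and ij: "i \<noteq> j"
    and vertex: "glue P (x i) = 0" "glue P (x j) = 0"
    and moment: "\<And>\<kappa>. \<kappa> \<in> PolyOn (int d - 2) (convex hull {x i, x j}) \<Longrightarrow> edge_integral (x i) (x j) (\<lambda>y. glue P y * \<kappa> y) = 0"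
    and y: "y \<in> convex hull {x i, x j}"
  shows "glue P y = (0::real)"
proof -
  let ?J = "{i, j}"
  have card: "card ?J = 2" using ij by simp
  obtain l where l: "l \<notin> ?J" using UNIV_minus_nonempty(2)[of i j] by blast
  have S: "convex hull (x ` ?J) = convex hull {x i, x j}" by simp
  have bd: "glue P z = 0" if z: "z \<in> convex hull (x ` ?J)" "k \<in> ?J" "bary k z = 0" for z k
  proof -
    have on_S: "bary m z = 0" if "m \<notin> ?J" for m
      using z(1) that unfolding convex_hull_subset_eq[OF insert_not_empty] by blast
    define k' where "k' = (if k = i then j else i)"
    have off: "bary m z = 0" if "m \<noteq> k'" for m
    proof (cases "m \<in> ?J")
      case True
      then have "m = k" using that z(2) by (auto simp: k'_def split: if_splits)
      then show ?thesis using z(3) by simp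
    qed (rule on_S)
    have "(\<Sum>m\<in>UNIV. bary m z) = (\<Sum>m\<in>{k'}. bary m z)"
      by (rule sum.mono_neutral_right) (use off in auto)
    then have one: "bary k' z = 1" by (simp add: sum_bary)
    have "z = x k'"
    proof (rule bary_eqI)
      show "bary m z = bary m (x k')" for m using off[of m] one by (cases "m = k'") (auto simp: bary_vertex)
    qed
    then show ?thesis using vertex by (simp add: k'_def)
  qed
  show ?thesis
  proof (rule moments_zero_imp_zero[OF P _ l bd])
    show "edge_integral (x i) (x j) (\<lambda>y. glue P y * \<kappa> y) = 0"
      if "\<kappa> \<in> PolyOn (int d - int (card ?J)) (convex hull (x ` ?J))" for \<kappa>
      using moment that unfolding S card by simp
    show "f y = 0" if "continuous_on (convex hull (x ` ?J)) f" "\<And>z. z \<in> convex hull (x ` ?J) \<Longrightarrow> 0 \<le> f z"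
      "edge_integral (x i) (x j) f = 0" for f
      using that ij inj_x y unfolding S by (intro edge_integral_eq_zero[of "x i" "x j" f]) (auto dest: injD)
  qed (use card y in auto)
qed

lemma M0_zero_on_face:
  assumes P: "compat P" "\<And>i. P i \<in> pol d" and ijk: "i \<noteq> j" "i \<noteq> k" "j \<noteq> k"
    and edge: "\<And>a b y. a \<in> {i, j, k} \<Longrightarrow> b \<in> {i, j, k} \<Longrightarrow> a \<noteq> b \<Longrightarrow> y \<in> convex hull {x a, x b} \<Longrightarrow> glue P y = 0"
    and moment: "\<And>\<kappa>. \<kappa> \<in> PolyOn (int d - 3) (convex hull {x i, x j, x k}) \<Longrightarrow>
      face_integral (x i) (x j) (x k) (\<lambda>y. glue P y * \<kappa> y) = 0"
    and y: "y \<in> convex hull {x i, x j, x k}"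
  shows "glue P y = (0::real)"
proof -
  let ?J = "{i, j, k}"
  have card: "card ?J = 3" using ijk by simp
  then have "?J \<noteq> UNIV" by auto
  then obtain l where l: "l \<notin> ?J" by blast
  have S: "convex hull (x ` ?J) = convex hull {x i, x j, x k}" by simp
  note hull = convex_hull_subset_eq[OF insert_not_empty]
  have bd: "glue P z = 0" if z: "z \<in> convex hull (x ` ?J)" "m \<in> ?J" "bary m z = 0" for z m
  proof -
    obtain a b where ab: "a \<in> ?J" "b \<in> ?J" "a \<noteq> b" "?J = {a, b, m}" using z(2) ijk by auto
    have "z \<in> convex hull (x ` {a, b})" using z(1,3) unfolding hull ab(4) by auto
    then show ?thesis using edge[OF ab(1-3), of z] by simp
  qed
  show ?thesis
  proof (cases "\<exists>m\<in>?J. bary m y = 0")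
    case True
    then show ?thesis using bd[of y] y by auto
  next
    case False
    define s t where "s = bary j y" and "t = bary k y"
    have b: "bary m y = 0" if "m \<notin> ?J" for m using y that unfolding S[symmetric] hull by blast
    have pos: "0 < bary m y" if "m \<in> ?J" for m
      using y False that unfolding S[symmetric] hull by (auto simp: order_le_less)
    have "(\<Sum>m\<in>UNIV. bary m y) = (\<Sum>m\<in>?J. bary m y)"
      by (rule sum.mono_neutral_right) (use b in auto)
    then have sum1: "bary i y = 1 - s - t" using ijk by (simp add: sum_bary s_def t_def)
    have "y = (\<Sum>m\<in>UNIV. bary m y *\<^sub>R x m)" by (rule sum_bary_x[symmetric])
    also have "\<dots> = (\<Sum>m\<in>?J. bary m y *\<^sub>R x m)"
      by (rule sum.mono_neutral_right) (use b in auto)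
    also have "\<dots> = (1 - s - t) *\<^sub>R x i + s *\<^sub>R x j + t *\<^sub>R x k"
      using ijk sum1 by (simp add: s_def t_def)
    finally have y_eq: "y = x i + s *\<^sub>R (x j - x i) + t *\<^sub>R (x k - x i)" by (simp add: algebra_simps)
    have st: "0 < s" "0 < t" "s + t < 1" using pos[of i] pos[of j] pos[of k] sum1 by (auto simp: s_def t_def)
    show ?thesis
    proof (rule moments_zero_imp_zero[OF P _ l bd])
      show "face_integral (x i) (x j) (x k) (\<lambda>y. glue P y * \<kappa> y) = 0"
        if "\<kappa> \<in> PolyOn (int d - int (card ?J)) (convex hull (x ` ?J))" for \<kappa>
        using moment that unfolding S card by simp
      show "f y = 0" if "continuous_on (convex hull (x ` ?J)) f" "\<And>z. z \<in> convex hull (x ` ?J) \<Longrightarrow> 0 \<le> f z"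
        "face_integral (x i) (x j) (x k) f = 0" for f
        unfolding y_eq using that cross_edges_nonzero[OF ijk] st unfolding S
        by (intro face_integral_eq_zero[of "x i" "x j" "x k" f]) auto
    qed (use card y in auto)
  qed
qed

lemma M0_zero_on_boundary:
  assumes P: "compat P" "\<And>i. P i \<in> pol d"
    and vertex: "\<And>a. a \<in> vertices x \<Longrightarrow> glue P a = 0"
    and edge: "\<And>a b \<kappa>. (a, b) \<in> edges x \<Longrightarrow> \<kappa> \<in> PolyOn (int d - 2) (convex hull {a, b}) \<Longrightarrow>
      edge_integral a b (\<lambda>y. glue P y * \<kappa> y) = 0"
    and face: "\<And>a b c \<kappa>. (a, b, c) \<in> faces x \<Longrightarrow> \<kappa> \<in> PolyOn (int d - 3) (convex hull {a, b, c}) \<Longrightarrow>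
      face_integral a b c (\<lambda>y. glue P y * \<kappa> y) = 0"
    and y: "y \<in> frontier (tetra x)"
  shows "glue P y = (0::real)"
proof -
  have E: "glue P z = 0" if ij: "i < j" and z: "z \<in> convex hull {x i, x j}" for i j z
  proof (rule M0_zero_on_edge[OF P _ _ _ _ z])
    show "i \<noteq> j" using ij by simp
    show "glue P (x i) = 0" "glue P (x j) = 0" by (auto intro!: vertex simp: vertices_def)
    show "edge_integral (x i) (x j) (\<lambda>y. glue P y * \<kappa> y) = 0"
      if "\<kappa> \<in> PolyOn (int d - 2) (convex hull {x i, x j})" for \<kappa>
      by (rule edge[OF _ that]) (use ij in \<open>auto simp: edges_def\<close>)
  qed
  obtain l where l: "y \<in> tetra x" "bary l y = 0" using y by (auto simp: frontier_tetra)
  have "card (UNIV - {l}) = 3" by (simp add: card_Diff_singleton)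
  then obtain i j k where ijk: "i < j" "j < k" "UNIV - {l} = {i, j, k}" using exists_sorted_triple by blast
  show ?thesis
  proof (rule M0_zero_on_face[OF P])
    show "i \<noteq> j" "i \<noteq> k" "j \<noteq> k" using ijk by auto
    show "glue P z = 0" if "a \<in> {i, j, k}" "b \<in> {i, j, k}" "a \<noteq> b" "z \<in> convex hull {x a, x b}" for a b z
    proof (cases "a < b")
      case True
      then show ?thesis using E that(4) by blast
    next
      case False
      then have "b < a" using that(3) by simp
      then show ?thesis using E[of b a z] that(4) by (simp add: insert_commute)
    qed
    show "face_integral (x i) (x j) (x k) (\<lambda>y. glue P y * \<kappa> y) = 0"
      if "\<kappa> \<in> PolyOn (int d - 3) (convex hull {x i, x j, x k})" for \<kappa>
      by (rule face[OF _ that]) (use ijk in \<open>auto simp: faces_def\<close>)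
    have "y \<in> convex hull (x ` (UNIV - {l}))"
      unfolding convex_hull_subset_eq[OF UNIV_minus_nonempty(1)] using l by (auto simp: tetra_eq)
    then show "y \<in> convex hull {x i, x j, x k}" unfolding ijk(3) by simp
  qed
qed


lemma edge_subset_tetra: "(a, b) \<in> edges x \<Longrightarrow> convex hull {a, b} \<subseteq> tetra x"
  using face_subset_tetra[of "{_, _}"] by (auto simp: edges_def)

lemma face_triple_subset_tetra: "(a, b, c) \<in> faces x \<Longrightarrow> convex hull {a, b, c} \<subseteq> tetra x"
  using face_subset_tetra[of "{_, _, _}"] by (auto simp: faces_def)

section \<open>Unisolvence\<close>

lemma M0_continuous: "f \<in> M0 r x \<Longrightarrow> continuous_on (tetra x) f"
  by (simp add: M0_def C0_def)

lemma glue_in_M0: "compat P \<Longrightarrow> (\<And>i. P i \<in> pol d) \<Longrightarrow> glue P \<in> M0 (int d) x"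
  unfolding M0_iff by (intro exI[of _ P]) simp

text \<open>
  Used twice, with different degrees: for the components of \<open>\<omega>\<close> and for
  \<open>div \<omega>\<close>. The degrees of the test functions match in both cases.
\<close>

lemma M0_boundary_determined:
  assumes f: "f \<in> M0 (int d) x" and g: "g \<in> M0 (int d) x"
    and vertex: "\<And>a. a \<in> vertices x \<Longrightarrow> f a = g a"
    and edge: "\<And>a b \<kappa>. (a, b) \<in> edges x \<Longrightarrow> \<kappa> \<in> PolyOn (int d - 2) (convex hull {a, b}) \<Longrightarrow>
      edge_integral a b (\<lambda>y. f y * \<kappa> y) = edge_integral a b (\<lambda>y. g y * \<kappa> y)"
    and face: "\<And>a b c \<kappa>. (a, b, c) \<in> faces x \<Longrightarrow> \<kappa> \<in> PolyOn (int d - 3) (convex hull {a, b, c}) \<Longrightarrow>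
      face_integral a b c (\<lambda>y. f y * \<kappa> y) = face_integral a b c (\<lambda>y. g y * \<kappa> y)"
    and y: "y \<in> frontier (tetra x)"
  shows "f y = g y"
proof -
  obtain P where P: "\<And>i. P i \<in> pol d" "compat P" "f = glue P" using f unfolding M0_iff by blast
  obtain Q where Q: "\<And>i. Q i \<in> pol d" "compat Q" "g = glue Q" using g unfolding M0_iff by blast
  let ?R = "\<lambda>i y. P i y - Q i y"
  have R: "compat ?R"
    by (rule compat_combine[OF P(2) Q(2), where h = "\<lambda>_ _ p q. p - q"])
  have diff: "glue ?R = (\<lambda>y. f y - g y)" unfolding P(3) Q(3) by (rule glue_linear(2))
  have cont: "continuous_on S f" "continuous_on S g" if "S \<subseteq> tetra x" for S
    using M0_continuous[OF f] M0_continuous[OF g] that by (auto intro: continuous_on_subset)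
  have "glue ?R y = 0"
  proof (rule M0_zero_on_boundary[OF R pol_diff[OF P(1) Q(1)] _ _ _ y])
    show "glue ?R a = 0" if "a \<in> vertices x" for a using vertex[OF that] by (simp add: diff)
    show "edge_integral a b (\<lambda>y. glue ?R y * \<kappa> y) = 0"
      if e: "(a, b) \<in> edges x" and \<kappa>: "\<kappa> \<in> PolyOn (int d - 2) (convex hull {a, b})" for a b \<kappa>
    proof -
      note c = cont[OF edge_subset_tetra[OF e]] PolyOn_continuous[OF \<kappa>]
      show ?thesis unfolding diff left_diff_distrib
        by (subst edge_integral_diff) (use c edge[OF e \<kappa>] in \<open>auto intro!: continuous_intros\<close>)
    qed
    show "face_integral a b c (\<lambda>y. glue ?R y * \<kappa> y) = 0"
      if e: "(a, b, c) \<in> faces x" and \<kappa>: "\<kappa> \<in> PolyOn (int d - 3) (convex hull {a, b, c})" for a b c \<kappa>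
    proof -
      note c = cont[OF face_triple_subset_tetra[OF e]] PolyOn_continuous[OF \<kappa>]
      show ?thesis unfolding diff left_diff_distrib
        by (subst face_integral_diff) (use c face[OF e \<kappa>] in \<open>auto intro!: continuous_intros\<close>)
    qed
  qed
  then show ?thesis by (simp add: diff)
qed

text \<open>
  Vector-valued test functions contain scalar ones for each component.
\<close>

lemma vec3_PolyOn_axis:
  assumes "\<kappa> \<in> PolyOn r S"
  shows "(\<lambda>y. \<kappa> y *\<^sub>R axis c 1) \<in> vec3 (PolyOn r S)"
proof -
  have "(\<lambda>y. (\<kappa> y *\<^sub>R axis c 1 :: real ^ 3) $ i) = (if i = c then \<kappa> else (\<lambda>y. 0))" for i
    by (auto simp: axis_def)
  then show ?thesis using assms zero_in_PolyOn by (auto simp: vec3_def)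
qed

lemma inner_axis_moment: "\<omega> \<bullet> (k *\<^sub>R axis c 1) = \<omega> $ c * k" for \<omega> :: "real ^ 3"
  by (simp add: inner_axis)

text \<open>
  For the difference of two fields with equal degrees of freedom, (a) to (e) make the field
  and its divergence vanish on the boundary. The divergence then has mean value zero and may
  be tested against itself in (g), so it vanishes. Hence the difference is a curl that may be
  tested against itself in (f).
\<close>

lemma unisolvence:
  assumes \<omega>: "\<omega> \<in> M2 (int (Suc s)) x" and \<eta>: "\<eta> \<in> M2 (int (Suc s)) x"
    and vertex: "\<forall>a\<in>vertices x. \<omega> a = \<eta> a \<and> div_T x \<omega> a = div_T x \<eta> a"
    and edge: "\<forall>(a, b)\<in>edges x. \<forall>\<kappa>\<in>vec3 (PolyOn (int (Suc s) - 2) (convex hull {a, b})).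
      edge_integral a b (\<lambda>y. \<omega> y \<bullet> \<kappa> y) = edge_integral a b (\<lambda>y. \<eta> y \<bullet> \<kappa> y)"
    and edge_div: "\<forall>(a, b)\<in>edges x. \<forall>\<kappa>\<in>PolyOn (int s - 2) (convex hull {a, b}).
      edge_integral a b (\<lambda>y. div_T x \<omega> y * \<kappa> y) = edge_integral a b (\<lambda>y. div_T x \<eta> y * \<kappa> y)"
    and face: "\<forall>(a, b, c)\<in>faces x. \<forall>\<kappa>\<in>vec3 (PolyOn (int (Suc s) - 3) (convex hull {a, b, c})).
      face_integral a b c (\<lambda>y. \<omega> y \<bullet> \<kappa> y) = face_integral a b c (\<lambda>y. \<eta> y \<bullet> \<kappa> y)"
    and face_div: "\<forall>(a, b, c)\<in>faces x. \<forall>\<kappa>\<in>PolyOn (int s - 3) (convex hull {a, b, c}).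
      face_integral a b c (\<lambda>y. div_T x \<omega> y * \<kappa> y) = face_integral a b c (\<lambda>y. div_T x \<eta> y * \<kappa> y)"
    and curl: "\<forall>\<kappa>\<in>curl_T x ` M1_zero (int (Suc (Suc s))) x.
      (LINT y:tetra x|lborel. \<omega> y \<bullet> \<kappa> y) = (LINT y:tetra x|lborel. \<eta> y \<bullet> \<kappa> y)"
    and div: "\<forall>\<kappa>\<in>M3_zero (int s) x.
      (LINT y:tetra x|lborel. div_T x \<omega> y * \<kappa> y) = (LINT y:tetra x|lborel. div_T x \<eta> y * \<kappa> y)"
  shows "\<omega> = \<eta>"
proof -
  obtain P where P: "\<And>i. P i \<in> pol (Suc s)" "compat P" "compat (\<lambda>i. pt_div (P i))" "\<omega> = glue P"
    using \<omega> unfolding M2_iff by blast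
  obtain Q where Q: "\<And>i. Q i \<in> pol (Suc s)" "compat Q" "compat (\<lambda>i. pt_div (Q i))" "\<eta> = glue Q"
    using \<eta> unfolding M2_iff by blast
  define R where "R = (\<lambda>i y. P i y - Q i y)"
  have R: "R i \<in> pol (Suc s)" for i unfolding R_def by (intro pol_diff P Q)
  have compat_R: "compat R"
    unfolding R_def by (rule compat_combine[OF P(2) Q(2), where h = "\<lambda>_ _ p q. p - q"])
  have diff: "glue R = (\<lambda>y. \<omega> y - \<eta> y)" unfolding P(4) Q(4) R_def by (rule glue_linear(2))
  have div_R: "pt_div (R i) = (\<lambda>y. pt_div (P i) y - pt_div (Q i) y)" for i
    unfolding R_def by (rule ext) (rule pt_div_diff[OF P(1) Q(1)])
  \<comment> \<open>the divergence has degree \<open>s\<close>, one less than the field\<close>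
  have DP: "pt_div (P i) \<in> pol s" and DQ: "pt_div (Q i) \<in> pol s" and DR: "pt_div (R i) \<in> pol s" for i
    using pol_pt_div[OF P(1)[of i]] pol_pt_div[OF Q(1)[of i]] pol_pt_div[OF R[of i]] by simp_all
  have compat_DR: "compat (\<lambda>i. pt_div (R i))"
    unfolding div_R by (rule compat_combine[OF P(3) Q(3), where h = "\<lambda>_ _ p q. p - q"])
  have div_T: "div_T x \<omega> = glue (\<lambda>i. pt_div (P i))" "div_T x \<eta> = glue (\<lambda>i. pt_div (Q i))"
    unfolding P(4) Q(4) by (rule div_T_glue[OF P(2,1,3)], rule div_T_glue[OF Q(2,1,3)])
  have div_diff: "glue (\<lambda>i. pt_div (R i)) = (\<lambda>y. div_T x \<omega> y - div_T x \<eta> y)"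
    unfolding div_T div_R by (rule glue_linear(2))
  have M0_div: "div_T x \<omega> \<in> M0 (int s) x" "div_T x \<eta> \<in> M0 (int s) x"
    unfolding div_T by (rule glue_in_M0[OF P(3) DP], rule glue_in_M0[OF Q(3) DQ])
  have M0_comp: "(\<lambda>y. \<omega> y $ c) \<in> M0 (int (Suc s)) x" "(\<lambda>y. \<eta> y $ c) \<in> M0 (int (Suc s)) x" for c
    using \<omega> \<eta> by (simp_all add: M2_def vec3_def)
  have "\<omega> y = \<eta> y" if y: "y \<in> frontier (tetra x)" for y
  proof -
    have "\<omega> y $ c = \<eta> y $ c" for c
    proof (rule M0_boundary_determined[OF M0_comp _ _ _ y])
      show "\<omega> a $ c = \<eta> a $ c" if "a \<in> vertices x" for a using vertex that by simp
      show "edge_integral a b (\<lambda>y. \<omega> y $ c * \<kappa> y) = edge_integral a b (\<lambda>y. \<eta> y $ c * \<kappa> y)"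
        if "(a, b) \<in> edges x" "\<kappa> \<in> PolyOn (int (Suc s) - 2) (convex hull {a, b})" for a b \<kappa>
        using bspec[OF edge that(1)] vec3_PolyOn_axis[OF that(2), of c]
        by (simp only: prod.case flip: inner_axis_moment)
      show "face_integral a b d (\<lambda>y. \<omega> y $ c * \<kappa> y) = face_integral a b d (\<lambda>y. \<eta> y $ c * \<kappa> y)"
        if "(a, b, d) \<in> faces x" "\<kappa> \<in> PolyOn (int (Suc s) - 3) (convex hull {a, b, d})" for a b d \<kappa>
        using bspec[OF face that(1)] vec3_PolyOn_axis[OF that(2), of c]
        by (simp only: prod.case flip: inner_axis_moment)
    qed
    then show ?thesis by (simp add: vec_eq_iff)
  qed
  then have "\<forall>y\<in>frontier (tetra x). glue R y = 0" by (simp add: diff)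
  then have R0: "\<And>i y. bary i y = 0 \<Longrightarrow> R i y = 0" unfolding glue_zero_frontier[OF compat_R R] by blast
  have "div_T x \<omega> y = div_T x \<eta> y" if y: "y \<in> frontier (tetra x)" for y
  proof (rule M0_boundary_determined[OF M0_div _ _ _ y])
    show "div_T x \<omega> a = div_T x \<eta> a" if "a \<in> vertices x" for a using vertex that by simp
    show "edge_integral a b (\<lambda>y. div_T x \<omega> y * \<kappa> y) = edge_integral a b (\<lambda>y. div_T x \<eta> y * \<kappa> y)"
      if "(a, b) \<in> edges x" "\<kappa> \<in> PolyOn (int s - 2) (convex hull {a, b})" for a b \<kappa>
      using bspec[OF edge_div that(1)] that(2) by simp
    show "face_integral a b c (\<lambda>y. div_T x \<omega> y * \<kappa> y) = face_integral a b c (\<lambda>y. div_T x \<eta> y * \<kappa> y)"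
      if "(a, b, c) \<in> faces x" "\<kappa> \<in> PolyOn (int s - 3) (convex hull {a, b, c})" for a b c \<kappa>
      using bspec[OF face_div that(1)] that(2) by simp
  qed
  then have DR_bd: "\<forall>y\<in>frontier (tetra x). glue (\<lambda>i. pt_div (R i)) y = 0" by (simp add: div_diff)
  have int_inner: "set_integrable lborel (tetra x) (\<lambda>y. f y \<bullet> g y)"
    if "continuous_on (tetra x) f" "continuous_on (tetra x) g" for f g :: "real ^ 3 \<Rightarrow> 'b::real_inner"
    unfolding set_integrable_def using that
    by (intro borel_integrable_compact compact_tetra continuous_intros)
  have cont: "continuous_on (tetra x) (glue F)" if "compat F" "\<And>i. F i \<in> pol d"
    for F :: "4 \<Rightarrow> real ^ 3 \<Rightarrow> 'b::real_normed_vector" and d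
    using glue_C0[OF that] by (simp add: C0_def)
  have M3: "glue (\<lambda>i. pt_div (R i)) \<in> M3_zero (int s) x"
  proof -
    have "(LINT y:tetra x|lborel. glue (\<lambda>i. pt_div (R i)) y) = 0"
      unfolding integral_glue_eq_pw[OF compat_DR DR] by (rule integral_divergence[OF compat_R R R0])
    moreover have "glue (\<lambda>i. pt_div (R i)) \<in> M0 (int s) x" by (rule glue_in_M0[OF compat_DR DR])
    ultimately show ?thesis using DR_bd by (simp add: M3_zero_def)
  qed
  have "pt_div (R i) y = 0" for i y
  proof (rule glue_L2_zero[OF compat_DR DR])
    let ?D = "glue (\<lambda>i. pt_div (R i))"
    have "(LINT y:tetra x|lborel. ?D y \<bullet> ?D y) =
      (LINT y:tetra x|lborel. div_T x \<omega> y \<bullet> ?D y - div_T x \<eta> y \<bullet> ?D y)"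
      by (simp add: div_diff algebra_simps)
    also have "\<dots> = (LINT y:tetra x|lborel. div_T x \<omega> y \<bullet> ?D y) - (LINT y:tetra x|lborel. div_T x \<eta> y \<bullet> ?D y)"
      unfolding div_T by (intro set_integral_diff(2) int_inner cont[OF P(3) DP] cont[OF Q(3) DQ] cont[OF compat_DR DR])
    also have "\<dots> = 0" using bspec[OF div M3] by simp
    finally show "(LINT y:tetra x|lborel. ?D y \<bullet> ?D y) = 0" .
  qed
  note DR0 = this
  have "glue R \<in> div_free (Suc s)"
  proof -
    have "glue R \<in> vec3 (M0_zero (Suc s))" unfolding vec3_M0_zero_iff
      using R compat_R R0 by (intro exI[of _ R]) simp
    moreover have "pw_div (glue R) = (\<lambda>y. 0)"
      unfolding pw_div_glue[OF compat_R R] by (rule ext) (simp add: pw_def DR0)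
    ultimately show ?thesis by (simp add: div_free_def)
  qed
  then have R_curl: "glue R \<in> curl_T x ` M1_zero (int (Suc (Suc s))) x" unfolding curl_image .
  have "R i y = 0" for i y
  proof (rule glue_L2_zero[OF compat_R R])
    have "(LINT y:tetra x|lborel. glue R y \<bullet> glue R y) =
      (LINT y:tetra x|lborel. \<omega> y \<bullet> glue R y - \<eta> y \<bullet> glue R y)"
      by (simp add: diff inner_diff_left)
    also have "\<dots> = (LINT y:tetra x|lborel. \<omega> y \<bullet> glue R y) - (LINT y:tetra x|lborel. \<eta> y \<bullet> glue R y)"
      unfolding P(4) Q(4) by (intro set_integral_diff(2) int_inner cont[OF P(2,1)] cont[OF Q(2,1)] cont[OF compat_R R])
    also have "\<dots> = 0" using bspec[OF curl R_curl] by simp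
    finally show "(LINT y:tetra x|lborel. glue R y \<bullet> glue R y) = 0" .
  qed
  then have "glue R = (\<lambda>y. 0)" by (auto simp: glue_def)
  then show ?thesis unfolding diff by (auto simp: fun_eq_iff)
qed

lemma card_vertices: "card (vertices x) = 4"
  using inj_x by (simp add: vertices_def card_image)

lemma card_boundary_expos: "3 * card (boundary_expos s) = 3 + 6 * s + s * (s + 1) * (2 * s + 1)"
  unfolding boundary_expos_def by (rule card_expos_upto_zero_entry)

end

theorem lemma4p13:
  fixes x :: "4 \<Rightarrow> real ^ 3" and r :: int
  assumes "nondegenerate x" and "5 \<le> r"
  shows
    "(\<forall>\<omega>\<in>M2 (r - 2) x. \<forall>\<eta>\<in>M2 (r - 2) x.
        (\<forall>a\<in>vertices x. \<omega> a = \<eta> a \<and> div_T x \<omega> a = div_T x \<eta> a) \<and>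
        (\<forall>(a, b)\<in>edges x. \<forall>\<kappa>\<in>vec3 (PolyOn (r - 4) (convex hull {a, b})).
           edge_integral a b (\<lambda>y. \<omega> y \<bullet> \<kappa> y) = edge_integral a b (\<lambda>y. \<eta> y \<bullet> \<kappa> y)) \<and>
        (\<forall>(a, b)\<in>edges x. \<forall>\<kappa>\<in>PolyOn (r - 5) (convex hull {a, b}).
           edge_integral a b (\<lambda>y. div_T x \<omega> y * \<kappa> y) =
           edge_integral a b (\<lambda>y. div_T x \<eta> y * \<kappa> y)) \<and>
        (\<forall>(a, b, c)\<in>faces x. \<forall>\<kappa>\<in>vec3 (PolyOn (r - 5) (convex hull {a, b, c})).
           face_integral a b c (\<lambda>y. \<omega> y \<bullet> \<kappa> y) = face_integral a b c (\<lambda>y. \<eta> y \<bullet> \<kappa> y)) \<and>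
        (\<forall>(a, b, c)\<in>faces x. \<forall>\<kappa>\<in>PolyOn (r - 6) (convex hull {a, b, c}).
           face_integral a b c (\<lambda>y. div_T x \<omega> y * \<kappa> y) =
           face_integral a b c (\<lambda>y. div_T x \<eta> y * \<kappa> y)) \<and>
        (\<forall>\<kappa>\<in>curl_T x ` M1_zero (r - 1) x.
           (LINT y:tetra x|lborel. \<omega> y \<bullet> \<kappa> y) = (LINT y:tetra x|lborel. \<eta> y \<bullet> \<kappa> y)) \<and>
        (\<forall>\<kappa>\<in>M3_zero (r - 3) x.
           (LINT y:tetra x|lborel. div_T x \<omega> y * \<kappa> y) =
           (LINT y:tetra x|lborel. div_T x \<eta> y * \<kappa> y))
        \<longrightarrow> \<omega> = \<eta>)
     \<and> card (vertices x) * (DIM(real ^ 3) + DIM(real)) = 16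
     \<and> int (\<Sum>(a, b)\<in>edges x. fun_dim (vec3 (PolyOn (r - 4) (convex hull {a, b})))) = 18 * (r - 3)
     \<and> int (\<Sum>(a, b)\<in>edges x. fun_dim (PolyOn (r - 5) (convex hull {a, b}))) = 6 * (r - 4)
     \<and> int (\<Sum>(a, b, c)\<in>faces x. fun_dim (vec3 (PolyOn (r - 5) (convex hull {a, b, c}))))
         = 6 * (r - 3) * (r - 4)
     \<and> int (\<Sum>(a, b, c)\<in>faces x. fun_dim (PolyOn (r - 6) (convex hull {a, b, c})))
         = 2 * (r - 4) * (r - 5)
     \<and> real (fun_dim (curl_T x ` M1_zero (r - 1) x))
         = (real_of_int r - 4) * (real_of_int r - 3) * (4 * real_of_int r - 11) / 3
     \<and> real (fun_dim (M3_zero (r - 3) x))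
         = 1 / 3 * (2 * real_of_int r - 7) * ((real_of_int r)\<^sup>2 - 7 * real_of_int r + 15) - 1"
proof -
  interpret tetrahedron x by unfold_locales (rule assms(1))
  obtain n where n: "r - 5 = int n" using assms(2) by (metis diff_ge_0_iff_ge nonneg_int_cases)
  \<comment> \<open>the degree of \<open>div \<omega>\<close>; the polynomial degrees have to be natural numbers in the lemmas\<close>
  define s where "s = n + 2"
  have r: "r = int n + 5" using n by simp
  have deg: "r - 1 = int (Suc (Suc s))" "r - 2 = int (Suc s)" "r - 3 = int s" "r - 4 = int (n + 1)" "r - 5 = int n"
    "r - 4 = int (Suc s) - 2" "r - 5 = int (Suc s) - 3" "r - 5 = int s - 2" "r - 6 = int s - 3"
    by (simp_all add: r s_def)
  have ne: "J \<noteq> {}" if "card J = 2 \<or> card J = 3" for J :: "4 set" using that by auto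
  have "(\<Sum>(a, b)\<in>edges x. fun_dim (vec3 (PolyOn (int (n + 1)) (convex hull {a, b})))) = 6 * (3 * (n + 2))"
  proof (rule sum_edges)
    fix J :: "4 set" assume "card J = 2"
    then show "fun_dim (vec3 (PolyOn (int (n + 1)) (convex hull (x ` J)))) = 3 * (n + 2)"
      using fun_dim_vec3_PolyOn[of J "n + 1"] ne[of J] by simp
  qed
  then have b: "int (\<Sum>(a, b)\<in>edges x. fun_dim (vec3 (PolyOn (r - 4) (convex hull {a, b})))) = 18 * (r - 3)"
    unfolding deg(4) by (simp add: r)
  have "(\<Sum>(a, b)\<in>edges x. fun_dim (PolyOn (int n) (convex hull {a, b}))) = 6 * (n + 1)"
  proof (rule sum_edges)
    fix J :: "4 set" assume "card J = 2"
    then show "fun_dim (PolyOn (int n) (convex hull (x ` J))) = n + 1"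
      using fun_dim_PolyOn[of J n] ne[of J] by simp
  qed
  then have c: "int (\<Sum>(a, b)\<in>edges x. fun_dim (PolyOn (r - 5) (convex hull {a, b}))) = 6 * (r - 4)"
    unfolding deg(5) by (simp add: r)
  have "(\<Sum>(a, b, c)\<in>faces x. fun_dim (vec3 (PolyOn (int n) (convex hull {a, b, c})))) = 4 * (3 * (Suc (n + 1) choose 2))"
  proof (rule sum_faces)
    fix J :: "4 set" assume "card J = 3"
    then show "fun_dim (vec3 (PolyOn (int n) (convex hull (x ` J)))) = 3 * (Suc (n + 1) choose 2)"
      using fun_dim_vec3_PolyOn[of J n] ne[of J] by simp
  qed
  also have "\<dots> = 6 * (2 * (Suc (n + 1) choose 2))" by simp
  also have "\<dots> = 6 * ((n + 2) * (n + 1))" unfolding two_times_choose_two by simp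
  finally have d: "int (\<Sum>(a, b, c)\<in>faces x. fun_dim (vec3 (PolyOn (r - 5) (convex hull {a, b, c})))) = 6 * (r - 3) * (r - 4)"
    unfolding deg(5) by (simp add: r algebra_simps)
  have e: "int (\<Sum>(a, b, c)\<in>faces x. fun_dim (PolyOn (r - 6) (convex hull {a, b, c}))) = 2 * (r - 4) * (r - 5)"
  proof (cases n)
    case 0
    \<comment> \<open>for \<open>r = 5\<close> the degree is negative and the space is zero\<close>
    then have "PolyOn (r - 6) S = {\<lambda>y. 0}" for S by (intro PolyOn_negative) (simp add: r)
    then show ?thesis using 0 by (simp add: fun_dim_zero r split_def)
  next
    case (Suc m)
    then have r6: "r - 6 = int m" by (simp add: r)
    have "(\<Sum>(a, b, c)\<in>faces x. fun_dim (PolyOn (int m) (convex hull {a, b, c}))) = 4 * (Suc (m + 1) choose 2)"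
    proof (rule sum_faces)
      fix J :: "4 set" assume "card J = 3"
      then show "fun_dim (PolyOn (int m) (convex hull (x ` J))) = Suc (m + 1) choose 2"
        using fun_dim_PolyOn[of J m] ne[of J] by simp
    qed
    also have "\<dots> = 2 * (2 * (Suc (m + 1) choose 2))" by simp
    also have "\<dots> = 2 * ((m + 2) * (m + 1))" unfolding two_times_choose_two by simp
    finally show ?thesis unfolding r6 using Suc by (simp add: r algebra_simps)
  qed
  have real_r: "real_of_int r = real n + 5" by (simp add: r)
  have f: "real (fun_dim (curl_T x ` M1_zero (r - 1) x))
      = (real_of_int r - 4) * (real_of_int r - 3) * (4 * real_of_int r - 11) / 3"
  proof -
    have 1: "real (fun_dim (div_free (Suc s))) + 4 * real ((s + 3) choose 3) = 3 * real (card (boundary_expos s)) + 1"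
      using arg_cong[OF fun_dim_div_free[of s], of real] by simp
    have 2: "3 * real (card (boundary_expos s)) = 3 + 6 * real s + real s * (real s + 1) * (2 * real s + 1)"
      using arg_cong[OF card_boundary_expos[of s], of real] by (simp add: algebra_simps)
    have 3: "6 * real ((s + 3) choose 3) = (real s + 1) * (real s + 2) * (real s + 3)"
      using arg_cong[OF six_times_choose_three[of s], of real] by (simp add: algebra_simps)
    have 4: "real_of_int r = real s + 3" by (simp add: real_r s_def)
    show ?thesis unfolding deg(1) curl_image 4 using 1 2 3 by (simp add: field_simps)
  qed
  have g: "real (fun_dim (M3_zero (r - 3) x))
      = 1 / 3 * (2 * real_of_int r - 7) * ((real_of_int r)\<^sup>2 - 7 * real_of_int r + 15) - 1"
  proof -
    have s: "s = Suc (n + 1)" by (simp add: s_def)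
    have 1: "real (fun_dim (M3_zero (r - 3) x)) + 1 = real (card (boundary_expos (n + 1)))"
      using arg_cong[OF fun_dim_M3_zero[of "n + 1"], of real] unfolding deg(3) s by simp
    have 2: "3 * real (card (boundary_expos (n + 1))) = 3 + 6 * (real n + 1) + (real n + 1) * (real n + 2) * (2 * real n + 3)"
      using arg_cong[OF card_boundary_expos[of "n + 1"], of real] by (simp add: algebra_simps)
    show ?thesis using 1 2 unfolding real_r by (simp add: field_simps power2_eq_square)
  qed
  have uni: "\<omega> = \<eta>" if "\<omega> \<in> M2 (r - 2) x" "\<eta> \<in> M2 (r - 2) x"
    and dofs: "(\<forall>a\<in>vertices x. \<omega> a = \<eta> a \<and> div_T x \<omega> a = div_T x \<eta> a) \<and>
        (\<forall>(a, b)\<in>edges x. \<forall>\<kappa>\<in>vec3 (PolyOn (r - 4) (convex hull {a, b})).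
           edge_integral a b (\<lambda>y. \<omega> y \<bullet> \<kappa> y) = edge_integral a b (\<lambda>y. \<eta> y \<bullet> \<kappa> y)) \<and>
        (\<forall>(a, b)\<in>edges x. \<forall>\<kappa>\<in>PolyOn (r - 5) (convex hull {a, b}).
           edge_integral a b (\<lambda>y. div_T x \<omega> y * \<kappa> y) =
           edge_integral a b (\<lambda>y. div_T x \<eta> y * \<kappa> y)) \<and>
        (\<forall>(a, b, c)\<in>faces x. \<forall>\<kappa>\<in>vec3 (PolyOn (r - 5) (convex hull {a, b, c})).
           face_integral a b c (\<lambda>y. \<omega> y \<bullet> \<kappa> y) = face_integral a b c (\<lambda>y. \<eta> y \<bullet> \<kappa> y)) \<and>
        (\<forall>(a, b, c)\<in>faces x. \<forall>\<kappa>\<in>PolyOn (r - 6) (convex hull {a, b, c}).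
           face_integral a b c (\<lambda>y. div_T x \<omega> y * \<kappa> y) =
           face_integral a b c (\<lambda>y. div_T x \<eta> y * \<kappa> y)) \<and>
        (\<forall>\<kappa>\<in>curl_T x ` M1_zero (r - 1) x.
           (LINT y:tetra x|lborel. \<omega> y \<bullet> \<kappa> y) = (LINT y:tetra x|lborel. \<eta> y \<bullet> \<kappa> y)) \<and>
        (\<forall>\<kappa>\<in>M3_zero (r - 3) x.
           (LINT y:tetra x|lborel. div_T x \<omega> y * \<kappa> y) =
           (LINT y:tetra x|lborel. div_T x \<eta> y * \<kappa> y))" for \<omega> \<eta>
    using that(1,2) dofs
    by (elim conjE, intro unisolvence[of \<omega> s \<eta>]) (simp_all only: deg(1-3) deg(6)[symmetric] deg(7)[symmetric] deg(8)[symmetric] deg(9)[symmetric])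
  have a: "card (vertices x) * (DIM(real ^ 3) + DIM(real)) = 16" by (simp add: card_vertices)
  show ?thesis
  proof (rule conjI, goal_cases)
    case 1
    show ?case by (intro ballI impI) (rule uni)
  next
    case 2
    show ?case by (intro conjI a b c d e f g)
  qed
qed

end
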